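(* Let $V\in L^\infty_{loc}(\mathbb{R}^n\times(0,\infty))$ be nonnegative. Assume that $V$ satisfies, for some $\tau_0>0$ and for any $R>0$, $$\lim_{|E|\to0}\iint_EH(x-y,t)V(x,t+\tau)\,dx\,dt=0,\qquad E\text{ Borel subset of }B_R\times(0,T),$$ uniformly with respect to $y$ in any compact subset of $\mathbb{R}^n$ and $\tau\in[0,\tau_0]$. If $u$ is a positive solution of $\partial_tu-\Delta u+V(x,t)u=0$ in $Q_T$, then $\mathcal{R}(u)=\mathbb{R}^n$.
   Context: Here $n\ge1$, $T>0$, $Q_T=\mathbb{R}^n\times(0,T]$, $B_R$ is the ball of center $0$ and radius $R$, $H(x,t)=(4\pi t)^{-n/2}e^{-|x|^2/(4t)}$, and $|E|$ is the Lebesgue measure of $E$. Since $V$ is locally bounded, any solution $u$ of the equation belongs to $\bigcap_{1\le p<\infty}W^{2,1}_{p,loc}(Q_T)$ and the equation holds a.e.; no initial condition is imposed. The regular set of $u$ is $$\mathcal{R}(u)=\Big\{y\in\mathbb{R}^n:\ \exists\text{ a bounded neighborhood }U\text{ of }y\text{ with }\iint_{U\times(0,T)}u(x,t)V(x,t)\,dx\,dt<\infty\Big\}.$$ *)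

theory Defs
  imports "HOL-Analysis.Analysis"
begin

text \<open>Space-time is the Euclidean space \<open>'a \<times> real\<close>, where \<open>'a :: euclidean_space\<close> stands for
  \<open>\<real>\<^sup>n\<close> with \<open>n = DIM('a) \<ge> 1\<close>. Elements of Lebesgue and Sobolev spaces are represented by
  functions, and all pointwise requirements on them are almost-everywhere requirements.\<close>

definition heat_kernel :: "'a::euclidean_space \<Rightarrow> real \<Rightarrow> real" where
  "heat_kernel x t = (4 * pi * t) powr (- real DIM('a) / 2) * exp (- (norm x)\<^sup>2 / (4 * t))"

definition Q :: "real \<Rightarrow> ('a::euclidean_space \<times> real) set" where
  "Q T = UNIV \<times> {0<..T}"

text \<open>Locality is with respect to the compact subsets of \<open>\<Omega>\<close>, which need not be open: compact
  subsets of \<open>Q T\<close> may reach the time \<open>T\<close> but stay away from the time \<open>0\<close>.\<close>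

definition Lp_loc :: "real \<Rightarrow> 'b::euclidean_space set \<Rightarrow> ('b \<Rightarrow> real) set" where
  "Lp_loc p \<Omega> = {f \<in> borel_measurable (lebesgue_on \<Omega>).
     \<forall>K. compact K \<and> K \<subseteq> \<Omega> \<longrightarrow> integrable (lebesgue_on K) (\<lambda>z. \<bar>f z\<bar> powr p)}"

definition Linf_loc :: "'b::euclidean_space set \<Rightarrow> ('b \<Rightarrow> real) set" where
  "Linf_loc \<Omega> = {f \<in> borel_measurable (lebesgue_on \<Omega>).
     \<forall>K. compact K \<and> K \<subseteq> \<Omega> \<longrightarrow> (\<exists>C. AE z in lebesgue_on K. \<bar>f z\<bar> \<le> C)}"

fun partials :: "'b::euclidean_space list \<Rightarrow> ('b \<Rightarrow> real) \<Rightarrow> 'b \<Rightarrow> real" where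
  "partials [] f = f"
| "partials (v # vs) f = (\<lambda>z. frechet_derivative (partials vs f) (at z) v)"

text \<open>A function is smooth iff all its iterated directional derivatives exist and are
  differentiable.\<close>

definition test_functions :: "'b::euclidean_space set \<Rightarrow> ('b \<Rightarrow> real) set" where
  "test_functions \<Omega> = {\<phi>. (\<forall>vs. partials vs \<phi> differentiable_on UNIV) \<and>
     compact (closure {z. \<phi> z \<noteq> 0}) \<and> closure {z. \<phi> z \<noteq> 0} \<subseteq> \<Omega>}"

text \<open>\<open>g\<close> is the weak derivative of \<open>f\<close>, in the open set \<open>\<Omega>\<close>, along the directions listed in
  \<open>vs\<close>.\<close>

definition has_weak_deriv ::
    "'b::euclidean_space set \<Rightarrow> 'b list \<Rightarrow> ('b \<Rightarrow> real) \<Rightarrow> ('b \<Rightarrow> real) \<Rightarrow> bool" where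
  "has_weak_deriv \<Omega> vs f g \<longleftrightarrow> f \<in> Lp_loc 1 \<Omega> \<and> g \<in> Lp_loc 1 \<Omega> \<and>
     (\<forall>\<phi>\<in>test_functions \<Omega>.
        (LINT z|lebesgue_on \<Omega>. f z * partials vs \<phi> z)
          = (-1) ^ length vs * (LINT z|lebesgue_on \<Omega>. g z * \<phi> z))"

text \<open>The derivatives \<open>D\<^sub>x\<^sup>\<alpha> D\<^sub>t\<^sup>k\<close> with \<open>\<bar>\<alpha>\<bar> + 2 k \<le> 2\<close>.\<close>

definition parabolic_dirs :: "('a::euclidean_space \<times> real) list set" where
  "parabolic_dirs =
     {[], [(0, 1)]} \<union> {[(i, 0)] | i. i \<in> Basis} \<union> {[(i, 0), (j, 0)] | i j. i \<in> Basis \<and> j \<in> Basis}"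

text \<open>The space \<open>W\<^sup>2\<^sup>,\<^sup>1\<close> with exponent \<open>p\<close>, local in \<open>Q T\<close>. The slice \<open>t = T\<close> is a null set, so
  derivatives are taken in the open cylinder, while integrability is required up to time \<open>T\<close>.\<close>

definition W21p_loc :: "real \<Rightarrow> real \<Rightarrow> ('a::euclidean_space \<times> real \<Rightarrow> real) set" where
  "W21p_loc p T = {u. \<forall>vs\<in>parabolic_dirs. \<exists>g\<in>Lp_loc p (Q T).
     has_weak_deriv (UNIV \<times> {0<..<T}) vs u g}"

text \<open>Solutions of \<open>\<partial>\<^sub>t u - \<Delta> u + V u = 0\<close> in \<open>Q T\<close>; no initial condition is imposed.\<close>

definition solution ::
    "('a::euclidean_space \<times> real \<Rightarrow> real) \<Rightarrow> real \<Rightarrow> ('a \<times> real \<Rightarrow> real) \<Rightarrow> bool" where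
  "solution V T u \<longleftrightarrow> (\<forall>p\<ge>1. u \<in> W21p_loc p T) \<and>
     (\<exists>u\<^sub>t D. has_weak_deriv (UNIV \<times> {0<..<T}) [(0, 1)] u u\<^sub>t \<and>
        (\<forall>i\<in>Basis. has_weak_deriv (UNIV \<times> {0<..<T}) [(i, 0), (i, 0)] u (D i)) \<and>
        (AE z in lebesgue_on (Q T). u\<^sub>t z - (\<Sum>i\<in>Basis. D i z) + V z * u z = 0))"

definition regular_set ::
    "('a::euclidean_space \<times> real \<Rightarrow> real) \<Rightarrow> real \<Rightarrow> ('a \<times> real \<Rightarrow> real) \<Rightarrow> 'a set" where
  "regular_set V T u = {y. \<exists>U. open U \<and> bounded U \<and> y \<in> U \<and>
     (\<integral>\<^sup>+ z \<in> U \<times> {0<..<T}. ennreal (u z * V z) \<partial>lebesgue) < \<infinity>}"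

end

theory Submission
  imports Defs "HOL-Probability.Probability" "HOL-Real_Asymp.Real_Asymp"
begin

text \<open>A neighbourhood of \<open>y\<close> in the regular set is obtained by testing the equation with a function
\<open>\<zeta> \<ge> 0\<close> for which \<open>- \<partial>\<^sub>t \<zeta> - \<Delta> \<zeta> + V \<zeta> \<le> - 3 V \<zeta> + e\<close>. Integration against \<open>u\<close> then gives
\<open>3 \<integral>\<integral> u V \<zeta> \<le> \<integral>\<integral> u e\<close>, so one needs \<open>\<zeta>\<close> bounded below near \<open>{y} \<times> (2 s, T1)\<close> and \<open>\<integral>\<integral> u e\<close> bounded
independently of \<open>s > 0\<close>. Nothing is known about \<open>u\<close> as \<open>t \<rightarrow> 0\<close>; the choice below makes every
contribution of small times have the favourable sign.

Take \<open>\<zeta> = g (b - w)\<close> with \<open>g x = exp (- 1 / x)\<close> for \<open>x > 0\<close> and \<open>g = 0\<close> elsewhere. Here \<open>w\<close> is the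
potential of \<open>V\<close> for the backward heat equation, \<open>- \<partial>\<^sub>t w - \<Delta> w = V\<close>, and the hypothesis on \<open>V\<close>,
applied to a ball times a short time interval, says that \<open>w\<close> is small there
(\<open>smoothed_potential_bound\<close>). The function \<open>b\<close> (\<open>barrier\<close>) is
\<open>3 / 8 - \<bar>x - y\<bar>\<^sup>2 + 2 n t\<close>, a solution of \<open>\<partial>\<^sub>t b + \<Delta> b = 0\<close>, minus two penalties in time. The first
penalty forces \<open>b \<le> 0\<close> for \<open>t \<le> s\<close> and decreases in \<open>t\<close>, hence only helps; the second forces
\<open>b \<le> 0\<close> for \<open>t \<ge> T2\<close> and produces the error \<open>e\<close>, which lives in \<open>T1 \<le> t \<le> T2\<close>, where \<open>u\<close> is
integrable. The nonlinearity \<open>g\<close> truncates \<open>b - w\<close> at \<open>0\<close> smoothly: it is convex on \<open>x \<le> 1 / 2\<close>, so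
the gradient term has the right sign (\<open>backward_heat_flat_exp\<close>), and \<open>4 g \<le> g'\<close> there, so the
term \<open>- g' V\<close> created by \<open>w\<close> absorbs \<open>V g\<close>.

Since \<open>V\<close> is only measurable while test functions are smooth, \<open>w\<close> is replaced by the convolution of
\<open>V\<close> with \<open>H (x, t) exp (- h / (4 t))\<close>, extended by \<open>0\<close> to \<open>t \<le> 0\<close>. This kernel is smooth on the whole
of space-time and lies below the heat kernel \<open>H\<close>, so the bound on \<open>w\<close> survives. The heat operator maps
it to an approximate identity of mass one as \<open>h \<rightarrow> 0\<close> (\<open>heat_equation_heat_smoothed\<close>,
\<open>nn_integral_heat_mollifier\<close>, \<open>heat_mollifier_tail\<close>), and the resulting error tends to zero in mean
with respect to \<open>u\<close> on compact sets (\<open>heat_mollification_weighted_error\<close>).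

These pieces give \<open>interior_estimate\<close>. Away from \<open>t = 0\<close> the potential is bounded and it remains to
integrate \<open>u\<close> up to \<open>t = T\<close>, which is \<open>estimate_near_final_time\<close>.\<close>

section \<open>Smooth functions\<close>

definition smooth :: "('b::euclidean_space \<Rightarrow> real) \<Rightarrow> bool" where
  "smooth f \<longleftrightarrow> (\<forall>vs. partials vs f differentiable_on UNIV)"

lemma partials_append: "partials (vs @ ws) f = partials vs (partials ws f)"
  by (induction vs) auto

lemma smooth_has_derivative:
  assumes "smooth f"
  shows "(f has_derivative (\<lambda>v. partials [v] f z)) (at z)"
proof -
  have "partials [] f differentiable_on UNIV"
    using assms smooth_def by blast
  then have "f differentiable (at z)"
    by (simp add: differentiable_on_def)
  then show ?thesis
    by (simp add: frechet_derivative_works)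
qed

lemma smooth_partials: "smooth f \<Longrightarrow> smooth (partials vs f)"
  unfolding smooth_def by (metis partials_append)

lemma partials_eqI:
  assumes "\<And>z. (f has_derivative f' z) (at z)"
  shows "partials [v] f = (\<lambda>z. f' z v)"
  using frechet_derivative_at[OF assms] by (auto simp: fun_eq_iff)

declare partials.simps(2) [simp del]

lemma partials_Cons: "partials (v # vs) f = partials [v] (partials vs f)"
  using partials_append[of "[v]" vs f] by simp

text \<open>Smoothness is a greatest fixed point: a set of functions closed under directional differentiation,
up to functions already known to be smooth, consists of smooth functions.\<close>

lemma smooth_coinduct:
  assumes "f \<in> S"
    and step: "\<And>f. f \<in> S \<Longrightarrow>
      \<exists>f'. (\<forall>z. (f has_derivative f' z) (at z)) \<and> (\<forall>v. (\<lambda>z. f' z v) \<in> S \<or> smooth (\<lambda>z. f' z v))"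
  shows "smooth f"
proof -
  let ?S = "S \<union> Collect smooth"
  have step': "\<exists>f'. (\<forall>z. (f has_derivative f' z) (at z)) \<and> (\<forall>v. (\<lambda>z. f' z v) \<in> ?S)"
    if "f \<in> ?S" for f
  proof (cases "f \<in> S")
    case True
    then show ?thesis using step by simp
  next
    case False
    with that have "smooth f" by simp
    from smooth_has_derivative[OF this] smooth_partials[OF this, of "[v]" for v]
    show ?thesis
      by (intro exI[of _ "\<lambda>z v. partials [v] f z"]) auto
  qed
  have "partials vs f \<in> ?S" for vs
  proof (induction vs)
    case (Cons v vs)
    from step'[OF this] obtain f' where f': "\<And>z. (partials vs f has_derivative f' z) (at z)"
      "(\<lambda>z. f' z v) \<in> ?S" by blast
    have "partials (v # vs) f = (\<lambda>z. f' z v)"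
      using partials_eqI[OF f'(1), of v] by (simp add: partials_Cons[of v vs])
    with f'(2) show ?case by simp
  qed (use assms in auto)
  then have "\<exists>f'. \<forall>z. (partials vs f has_derivative f' z) (at z)" for vs
    using step' by blast
  then have "partials vs f differentiable (at z)" for vs z
    by (meson differentiableI)
  then show ?thesis
    by (simp add: smooth_def differentiable_at_imp_differentiable_on)
qed

text \<open>The derivatives of a composition or of a product are polynomial expressions in simpler functions.
The algebra generated by a set \<open>B\<close> and the smooth functions collects these expressions, so that
closure under differentiation has to be checked on \<open>B\<close> alone.\<close>

inductive_set smooth_algebra :: "('b::euclidean_space \<Rightarrow> real) set \<Rightarrow> ('b \<Rightarrow> real) set" for B where
  base: "f \<in> B \<Longrightarrow> f \<in> smooth_algebra B"
| smooth: "smooth f \<Longrightarrow> f \<in> smooth_algebra B"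
| add: "f \<in> smooth_algebra B \<Longrightarrow> g \<in> smooth_algebra B \<Longrightarrow> (\<lambda>z. f z + g z) \<in> smooth_algebra B"
| mult: "f \<in> smooth_algebra B \<Longrightarrow> g \<in> smooth_algebra B \<Longrightarrow> (\<lambda>z. f z * g z) \<in> smooth_algebra B"

lemma smooth_algebra_smooth:
  assumes B: "\<And>f. f \<in> B \<Longrightarrow>
      \<exists>f'. (\<forall>z. (f has_derivative f' z) (at z)) \<and> (\<forall>v. (\<lambda>z. f' z v) \<in> smooth_algebra B)"
    and "f \<in> smooth_algebra B"
  shows "smooth f"
proof -
  have "\<exists>f'. (\<forall>z. (f has_derivative f' z) (at z)) \<and> (\<forall>v. (\<lambda>z. f' z v) \<in> smooth_algebra B)"
    if "f \<in> smooth_algebra B" for f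
    using that
  proof (induction rule: smooth_algebra.induct)
    case (base f)
    then show ?case by (rule B)
  next
    case (smooth f)
    from smooth_has_derivative[OF this] smooth_partials[OF this, of "[v]" for v]
    show ?case
      by (intro exI[of _ "\<lambda>z v. partials [v] f z"]) (auto intro: smooth_algebra.smooth)
  next
    case (add f g)
    then obtain f' g' where *: "\<And>z. (f has_derivative f' z) (at z)" "\<And>v. (\<lambda>z. f' z v) \<in> smooth_algebra B"
      "\<And>z. (g has_derivative g' z) (at z)" "\<And>v. (\<lambda>z. g' z v) \<in> smooth_algebra B" by blast
    have "((\<lambda>z. f z + g z) has_derivative (\<lambda>v. f' z v + g' z v)) (at z)" for z
      by (rule has_derivative_add[OF *(1,3)])
    then show ?case
      using smooth_algebra.add[OF *(2,4)] by (intro exI[of _ "\<lambda>z v. f' z v + g' z v"]) blast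
  next
    case (mult f g)
    then obtain f' g' where *: "\<And>z. (f has_derivative f' z) (at z)" "\<And>v. (\<lambda>z. f' z v) \<in> smooth_algebra B"
      "\<And>z. (g has_derivative g' z) (at z)" "\<And>v. (\<lambda>z. g' z v) \<in> smooth_algebra B" by blast
    have "((\<lambda>z. f z * g z) has_derivative (\<lambda>v. f z * g' z v + f' z v * g z)) (at z)" for z
      by (rule has_derivative_mult[OF *(1,3)])
    moreover have "(\<lambda>z. f z * g' z v + f' z v * g z) \<in> smooth_algebra B" for v
      by (rule smooth_algebra.add[OF smooth_algebra.mult[OF mult.hyps(1) *(4)] smooth_algebra.mult[OF *(2) mult.hyps(2)]])
    ultimately show ?case
      by (intro exI[of _ "\<lambda>z v. f z * g' z v + f' z v * g z"]) blast
  qed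
  then show ?thesis
    by (intro smooth_coinduct[of f "smooth_algebra B"] assms(2)) blast
qed

lemma smooth_add: "smooth f \<Longrightarrow> smooth g \<Longrightarrow> smooth (\<lambda>z. f z + g z)"
  by (rule smooth_algebra_smooth[of "{}", OF _ smooth_algebra.add[OF smooth_algebra.smooth smooth_algebra.smooth]]) simp_all

lemma smooth_mult: "smooth f \<Longrightarrow> smooth g \<Longrightarrow> smooth (\<lambda>z. f z * g z)"
  by (rule smooth_algebra_smooth[of "{}", OF _ smooth_algebra.mult[OF smooth_algebra.smooth smooth_algebra.smooth]]) simp_all

lemma smooth_const: "smooth (\<lambda>z. c)"
  by (rule smooth_coinduct[where S = "range (\<lambda>c z. c)"])
    (auto intro!: exI[of _ "\<lambda>z v. 0"])

lemma smooth_linear: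
  assumes "bounded_linear l"
  shows "smooth l"
proof (rule smooth_coinduct[where S = "{l}"])
  fix f assume "f \<in> {l}"
  then show "\<exists>f'. (\<forall>z. (f has_derivative f' z) (at z)) \<and>
      (\<forall>v. (\<lambda>z. f' z v) \<in> {l} \<or> smooth (\<lambda>z. f' z v))"
    using assms by (intro exI[of _ "\<lambda>z v. l v"])
      (simp add: bounded_linear_imp_has_derivative smooth_const)
qed simp

lemma smooth_minus: "smooth f \<Longrightarrow> smooth (\<lambda>z. - f z)"
  using smooth_mult[OF smooth_const[of "-1"], of f] by simp

lemma smooth_diff: "smooth f \<Longrightarrow> smooth g \<Longrightarrow> smooth (\<lambda>z. f z - g z)"
  using smooth_add[of f "\<lambda>z. - g z"] smooth_minus[of g] by simp

lemma smooth_sum: "finite I \<Longrightarrow> (\<And>i. i \<in> I \<Longrightarrow> smooth (f i)) \<Longrightarrow> smooth (\<lambda>z. \<Sum>i\<in>I. f i z)"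
  by (induction I rule: finite_induct) (simp_all add: smooth_add smooth_const)

lemma partials_mult_const:
  assumes "smooth f"
  shows "partials vs (\<lambda>z. c * f z) = (\<lambda>z. c * partials vs f z)"
proof (induction vs)
  case (Cons v vs)
  have "((\<lambda>z. c * partials vs f z) has_derivative (\<lambda>v. c * partials [v] (partials vs f) z)) (at z)" for z
    by (intro has_derivative_mult_right smooth_has_derivative smooth_partials assms)
  from partials_eqI[OF this, of v] show ?case
    by (simp add: partials_Cons[of v vs] Cons.IH)
qed simp

lemma partials_add:
  assumes "smooth f" "smooth g"
  shows "partials vs (\<lambda>z. f z + g z) = (\<lambda>z. partials vs f z + partials vs g z)"
proof (induction vs)
  case (Cons v vs)
  have "((\<lambda>z. partials vs f z + partials vs g z) has_derivative
      (\<lambda>v. partials [v] (partials vs f) z + partials [v] (partials vs g) z)) (at z)" for z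
    by (intro has_derivative_add smooth_has_derivative smooth_partials assms)
  from partials_eqI[OF this, of v] show ?case
    by (simp add: partials_Cons[of v vs] Cons.IH)
qed simp

section \<open>A flat_exp function and the regularised heat kernel\<close>

text \<open>\<open>x\<^sup>-\<^sup>a exp (- c / x)\<close>, continued by \<open>0\<close> to \<open>x \<le> 0\<close>. The exponent \<open>a\<close> makes the family closed under
differentiation, and for \<open>c > 0\<close> all its members are smooth across \<open>0\<close>.\<close>

definition flat_exp :: "real \<Rightarrow> real \<Rightarrow> real \<Rightarrow> real" where
  "flat_exp c a x = (if x > 0 then x powr (- a) * exp (- c / x) else 0)"

lemma flat_exp_nonneg: "0 \<le> flat_exp c a x"
  by (simp add: flat_exp_def)

lemma flat_exp_has_derivative:
  assumes "c > 0"
  shows "(flat_exp c a has_real_derivative (- a * flat_exp c (a + 1) x + c * flat_exp c (a + 2) x)) (at x)"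
proof -
  consider "x > 0" | "x < 0" | "x = 0" by linarith
  then show ?thesis
  proof cases
    case 1
    have "((\<lambda>x. x powr (- a) * exp (- c / x)) has_real_derivative
        (- a * flat_exp c (a + 1) x + c * flat_exp c (a + 2) x)) (at x)"
      using 1
      apply (auto intro!: derivative_eq_intros simp: flat_exp_def)
      apply (simp add: powr_diff powr_minus powr_add field_simps power2_eq_square)
      done
    then show ?thesis
      by (rule has_field_derivative_transform_within_open[where S = "{0<..}"]) (use 1 in \<open>auto simp: flat_exp_def\<close>)
  next
    case 2
    have "((\<lambda>x. 0) has_real_derivative (- a * flat_exp c (a + 1) x + c * flat_exp c (a + 2) x)) (at x)"
      using 2 by (auto intro!: derivative_eq_intros simp: flat_exp_def)
    then show ?thesis
      by (rule has_field_derivative_transform_within_open[where S = "{..<0}"]) (use 2 in \<open>auto simp: flat_exp_def\<close>)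
  next
    case 3
    have "((\<lambda>y. y powr (- a - 1) * exp (- c / y)) \<longlongrightarrow> 0) (at_right 0)"
      using assms by real_asymp
    then have "((\<lambda>y. (flat_exp c a y - flat_exp c a 0) / (y - 0)) \<longlongrightarrow> 0) (at_right 0)"
      by (rule Lim_transform_eventually)
        (auto simp: flat_exp_def powr_diff eventually_at_filter intro!: always_eventually)
    moreover have "((\<lambda>y. (flat_exp c a y - flat_exp c a 0) / (y - 0)) \<longlongrightarrow> 0) (at_left 0)"
      by (rule Lim_transform_eventually[OF tendsto_const])
        (auto simp: flat_exp_def eventually_at_filter intro!: always_eventually)
    ultimately have "((\<lambda>y. (flat_exp c a y - flat_exp c a 0) / (y - 0)) \<longlongrightarrow> 0) (at 0)"
      by (simp add: filterlim_at_split)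
    then show ?thesis
      using 3 by (simp add: has_field_derivative_iff flat_exp_def)
  qed
qed

text \<open>The functions \<open>flat_exp 1 a \<circ> f\<close>, for all \<open>a\<close> at once, generate an algebra that is closed under
differentiation.\<close>

lemma smooth_flat_exp:
  assumes "smooth f"
  shows "smooth (\<lambda>z. flat_exp 1 a (f z))"
proof (rule smooth_algebra_smooth[where B = "range (\<lambda>a z. flat_exp 1 a (f z))"])
  let ?B = "range (\<lambda>a z. flat_exp 1 a (f z))"
  fix g assume "g \<in> ?B"
  then obtain a where g: "g = (\<lambda>z. flat_exp 1 a (f z))" by auto
  let ?f' = "\<lambda>z v. (- a * flat_exp 1 (a + 1) (f z) + flat_exp 1 (a + 2) (f z)) * partials [v] f z"
  have "(g has_derivative ?f' z) (at z)" for z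
    unfolding g
    using has_derivative_compose[OF smooth_has_derivative[OF assms, of z]
        has_field_derivative_imp_has_derivative[OF flat_exp_has_derivative[of 1 a "f z"]]]
    by simp
  moreover have "(\<lambda>z. flat_exp 1 b (f z)) \<in> smooth_algebra ?B" for b
    by (rule smooth_algebra.base) auto
  then have "(\<lambda>z. ?f' z v) \<in> smooth_algebra ?B" for v
    by (intro smooth_algebra.mult smooth_algebra.add smooth_algebra.smooth[OF smooth_const]
        smooth_algebra.smooth[OF smooth_partials[OF assms]])
  ultimately show "\<exists>f'. (\<forall>z. (g has_derivative f' z) (at z)) \<and> (\<forall>v. (\<lambda>z. f' z v) \<in> smooth_algebra ?B)"
    by (intro exI[of _ ?f']) blast
qed (auto intro: smooth_algebra.base)

text \<open>\<open>t\<^sup>-\<^sup>a exp (- (\<bar>x\<bar>\<^sup>2 + h) / (4 t))\<close> for \<open>t > 0\<close>. The shift by \<open>h > 0\<close> removes the singularity of the heat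
kernel at the origin, and the free exponent \<open>a\<close> again serves to close the family under
differentiation.\<close>

definition heat_reg :: "real \<Rightarrow> real \<Rightarrow> 'a::euclidean_space \<times> real \<Rightarrow> real" where
  "heat_reg h a z = flat_exp ((fst z \<bullet> fst z + h) / 4) a (snd z)"

lemma heat_reg_nonneg: "0 \<le> heat_reg h a z"
  by (simp add: heat_reg_def flat_exp_nonneg)

text \<open>The only delicate points are those with \<open>t = 0\<close>: there the function is dominated by its values on
\<open>x = 0\<close>, which vanish to first order.\<close>

lemma heat_reg_has_derivative:
  fixes z :: "'a::euclidean_space \<times> real"
  assumes "h > 0"
  shows "(heat_reg h a has_derivative (\<lambda>v.
      (- a * heat_reg h (a + 1) z + (fst z \<bullet> fst z + h) / 4 * heat_reg h (a + 2) z) * snd v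
      - (fst z \<bullet> fst v) / 2 * heat_reg h (a + 1) z)) (at z)"
    (is "(_ has_derivative ?D) _")
proof -
  consider "snd z > 0" | "snd z < 0" | "snd z = 0" by linarith
  then show ?thesis
  proof cases
    case 1
    define t where "t = snd z"
    have t: "t > 0" using 1 by (simp add: t_def)
    have p: "((\<lambda>y. snd y powr (- a)) has_derivative (\<lambda>v. snd v * (- a * t powr (- a - 1)))) (at z)"
      using has_derivative_compose[OF has_derivative_snd[OF has_derivative_ident]
          has_field_derivative_imp_has_derivative[OF has_real_derivative_powr[OF 1, of "- a"]]]
      by (simp add: t_def mult.commute)
    have q: "((\<lambda>y. exp (- ((fst y \<bullet> fst y + h) / 4) / snd y)) has_derivative
        (\<lambda>v. exp (- ((fst z \<bullet> fst z + h) / 4) / t) *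
          ((fst z \<bullet> fst z + h) / 4 / t\<^sup>2 * snd v - (fst z \<bullet> fst v) / (2 * t)))) (at z)"
      using t unfolding t_def
      by (auto intro!: derivative_eq_intros simp: fun_eq_iff inner_commute power2_eq_square field_simps)
    have "((\<lambda>y. snd y powr (- a) * exp (- ((fst y \<bullet> fst y + h) / 4) / snd y)) has_derivative ?D) (at z)"
      apply (rule has_derivative_eq_rhs[OF has_derivative_mult[OF p q]])
      using t
      apply (simp add: heat_reg_def flat_exp_def fun_eq_iff flip: t_def)
      apply (simp add: powr_diff powr_minus powr_add field_simps power2_eq_square)
      done
    then show ?thesis
      by (rule has_derivative_transform_within_open[where s = "{y. snd y > 0}"])
        (use 1 in \<open>auto simp: heat_reg_def flat_exp_def intro!: open_Collect_less continuous_intros\<close>)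
  next
    case 2
    have "((\<lambda>y. 0) has_derivative ?D) (at z)"
      using 2 by (auto simp: heat_reg_def flat_exp_def)
    then show ?thesis
      by (rule has_derivative_transform_within_open[where s = "{y. snd y < 0}"])
        (use 2 in \<open>auto simp: heat_reg_def flat_exp_def intro!: open_Collect_less continuous_intros\<close>)
  next
    case 3
    let ?g = "\<lambda>y. flat_exp (h / 4) a (snd y)"
    have le: "\<bar>heat_reg h a y\<bar> \<le> \<bar>?g y\<bar>" for y :: "'a \<times> real"
      using assms by (auto simp: heat_reg_def flat_exp_def abs_mult field_simps intro!: mult_left_mono)
    have D: "?D = (\<lambda>v. 0)"
      using 3 by (simp add: heat_reg_def flat_exp_def)
    have "(?g has_derivative (\<lambda>v. 0)) (at z)"
      using has_derivative_compose[OF has_derivative_snd[OF has_derivative_ident]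
          has_field_derivative_imp_has_derivative[OF flat_exp_has_derivative[of "h / 4" a "snd z"]]] assms 3
      by (simp add: flat_exp_def)
    then have "((\<lambda>y. norm (?g y - ?g z - 0) / norm (y - z)) \<longlongrightarrow> 0) (at z)"
      unfolding has_derivative_iff_norm by blast
    then have "((\<lambda>y. norm (heat_reg h a y - heat_reg h a z - 0) / norm (y - z)) \<longlongrightarrow> 0) (at z)"
      by (rule Lim_null_comparison[rotated])
        (use 3 le in \<open>auto simp: heat_reg_def flat_exp_def intro!: always_eventually divide_right_mono\<close>)
    then show ?thesis
      unfolding D has_derivative_iff_norm by simp
  qed
qed

lemma smooth_inner_fst: "smooth (\<lambda>z::'a::euclidean_space \<times> real. fst z \<bullet> c)"
  by (intro smooth_linear bounded_linear_inner_left_comp bounded_linear_fst)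

lemma smooth_snd: "smooth (snd :: 'a::euclidean_space \<times> real \<Rightarrow> real)"
  by (intro smooth_linear bounded_linear_snd)

lemma smooth_norm_fst: "smooth (\<lambda>z::'a::euclidean_space \<times> real. fst z \<bullet> fst z)"
proof -
  have "(\<lambda>z::'a \<times> real. fst z \<bullet> fst z) = (\<lambda>z. \<Sum>i\<in>Basis. (fst z \<bullet> i) * (fst z \<bullet> i))"
    by (rule ext) (rule euclidean_inner)
  moreover have "smooth (\<lambda>z::'a \<times> real. \<Sum>i\<in>Basis. (fst z \<bullet> i) * (fst z \<bullet> i))"
    by (intro smooth_sum smooth_mult smooth_inner_fst finite_Basis)
  ultimately show ?thesis
    by simp
qed

lemma smooth_heat_reg:
  assumes "h > 0"
  shows "smooth (heat_reg h a :: 'a::euclidean_space \<times> real \<Rightarrow> real)"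
proof (rule smooth_algebra_smooth[where B = "range (heat_reg h)"])
  let ?B = "range (heat_reg h :: real \<Rightarrow> 'a \<times> real \<Rightarrow> real)"
  fix g assume "g \<in> ?B"
  then obtain a where g: "g = heat_reg h a" by auto
  let ?f' = "\<lambda>z v. (- a * heat_reg h (a + 1) z + (fst z \<bullet> fst z + h) / 4 * heat_reg h (a + 2) z) * snd v
      - (fst z \<bullet> fst v) / 2 * heat_reg h (a + 1) z"
  have hr: "(\<lambda>z. heat_reg h b z) \<in> smooth_algebra ?B" for b
    by (rule smooth_algebra.base) auto
  have mem: "(\<lambda>z. (- a * heat_reg h (a + 1) z + ((1/4) * (fst z \<bullet> fst z + h)) * heat_reg h (a + 2) z) * snd v
      + ((-1/2) * (fst z \<bullet> fst v)) * heat_reg h (a + 1) z) \<in> smooth_algebra ?B" for v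
    by (intro smooth_algebra.add smooth_algebra.mult hr smooth_algebra.smooth smooth_mult smooth_add smooth_const smooth_inner_fst smooth_norm_fst)
  have eq: "(\<lambda>z. (- a * heat_reg h (a + 1) z + ((1/4) * (fst z \<bullet> fst z + h)) * heat_reg h (a + 2) z) * snd v
      + ((-1/2) * (fst z \<bullet> fst v)) * heat_reg h (a + 1) z) = (\<lambda>z. ?f' z v)" for v
    by (simp add: fun_eq_iff)
  have "(\<lambda>z. ?f' z v) \<in> smooth_algebra ?B" for v
    using mem[of v] unfolding eq .
  then show "\<exists>f'. (\<forall>z. (g has_derivative f' z) (at z)) \<and> (\<forall>v. (\<lambda>z. f' z v) \<in> smooth_algebra ?B)"
    unfolding g using heat_reg_has_derivative[OF assms] by (intro exI[of _ ?f']) blast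
qed (auto intro: smooth_algebra.base)

section \<open>Convolution with a smooth kernel\<close>

lemma smooth_imp_continuous: "smooth f \<Longrightarrow> continuous_on S f"
  by (rule continuous_at_imp_continuous_on) (auto intro: has_derivative_continuous[OF smooth_has_derivative])

lemma smooth_borel: "smooth f \<Longrightarrow> f \<in> borel_measurable borel"
  by (intro borel_measurable_continuous_onI smooth_imp_continuous)

lemma integrable_mult_compact_support:
  fixes f k :: "'b::euclidean_space \<Rightarrow> real"
  assumes "continuous_on UNIV k" "integrable lborel f" "\<And>z. z \<notin> cball 0 R \<Longrightarrow> f z = 0"
  shows "integrable lborel (\<lambda>z. k z * f z)"
proof -
  have "compact (k ` cball 0 R)"
    using assms(1) by (intro compact_continuous_image) (auto intro: continuous_on_subset)
  then have "bounded (k ` cball 0 R)"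
    by (rule compact_imp_bounded)
  then obtain M where M: "\<And>z. z \<in> cball 0 R \<Longrightarrow> \<bar>k z\<bar> \<le> M"
    unfolding bounded_iff by (metis imageI real_norm_def)
  have [measurable]: "k \<in> borel_measurable borel"
    using assms(1) by (rule borel_measurable_continuous_onI)
  have [measurable]: "f \<in> borel_measurable borel"
    using assms(2) by auto
  show ?thesis
  proof (rule Bochner_Integration.integrable_bound)
    show "integrable lborel (\<lambda>z. M * f z)" using assms(2) by simp
    show "AE z in lborel. norm (k z * f z) \<le> norm (M * f z)"
    proof (intro always_eventually allI)
      fix z show "norm (k z * f z) \<le> norm (M * f z)"
      proof (cases "z \<in> cball 0 R")
        case True
        then show ?thesis using M[OF True] by (auto simp: abs_mult intro!: mult_right_mono)
      qed (simp add: assms(3))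
    qed
  qed measurable
qed

text \<open>The gradient of \<open>k\<close> is uniformly continuous on compact sets, so that the mean value theorem bounds
the first-order remainder uniformly in the base point. This allows differentiation under the
integral sign against a merely integrable function.\<close>

lemma smooth_uniform_linearization:
  assumes "smooth k" "e > 0"
  shows "\<exists>d>0. \<forall>a\<in>cball 0 R. \<forall>v. norm v < d \<longrightarrow> \<bar>k (a + v) - k a - partials [v] k a\<bar> \<le> e * norm v"
proof -
  define D where "D = (\<lambda>y v. partials [v] k y)"
  have D: "(k has_derivative D y) (at y)" for y
    using smooth_has_derivative[OF assms(1), of y] by (simp add: D_def)
  define G where "G y = (\<Sum>b\<in>Basis. partials [b] k y *\<^sub>R b)" for y
  have DG: "D y v = G y \<bullet> v" for y v
  proof -
    interpret linear "D y" using D has_derivative_linear by blast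
    have "D y v = D y (\<Sum>b\<in>Basis. (v \<bullet> b) *\<^sub>R b)" by (simp add: euclidean_representation)
    also have "\<dots> = (\<Sum>b\<in>Basis. (v \<bullet> b) * D y b)" by (simp add: sum scale)
    also have "\<dots> = G y \<bullet> v"
      unfolding G_def inner_sum_left by (intro sum.cong) (simp_all add: D_def inner_commute mult.commute)
    finally show ?thesis .
  qed
  have "continuous_on (cball 0 (R + 1)) G"
    unfolding G_def by (intro continuous_intros smooth_imp_continuous smooth_partials assms)
  then have "uniformly_continuous_on (cball 0 (R + 1)) G"
    by (intro compact_uniformly_continuous) auto
  then obtain d where d: "d > 0" "\<And>x y. x \<in> cball 0 (R + 1) \<Longrightarrow> y \<in> cball 0 (R + 1) \<Longrightarrow> dist x y < d
      \<Longrightarrow> dist (G x) (G y) < e"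
    using assms(2) unfolding uniformly_continuous_on_def by metis
  show ?thesis
  proof (intro exI[of _ "min d 1"] conjI ballI allI impI)
    fix a v :: 'a assume a: "a \<in> cball 0 R" and v: "norm v < min d 1"
    have "norm (k (a + v) - k a - D a (a + v - a)) \<le> norm (a + v - a) * e"
    proof (rule differentiable_bound_linearization[where S = "ball a (min d 1)"])
      show "a + t *\<^sub>R (a + v - a) \<in> ball a (min d 1)" if "t \<in> {0..1}" for t
      proof -
        have "\<bar>t\<bar> * norm v \<le> 1 * norm v" using that by (intro mult_right_mono) auto
        then show ?thesis using v by (simp add: dist_norm)
      qed
      show "(k has_derivative D x) (at x within ball a (min d 1))" for x
        using D has_derivative_at_withinI by blast
      show "onorm (D x - D a) \<le> e" if x: "x \<in> ball a (min d 1)" for x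
      proof (rule onorm_le)
        fix w :: 'a
        have "x \<in> cball 0 (R + 1)" "a \<in> cball 0 (R + 1)"
          using x a norm_triangle_sub[of x a] by (auto simp: dist_norm norm_minus_commute)
        with d(2)[of x a] x have "norm (G x - G a) < e"
          by (simp add: dist_norm norm_minus_commute)
        then have "norm (G x - G a) * norm w \<le> e * norm w"
          by (intro mult_right_mono) auto
        then show "norm ((D x - D a) w) \<le> e * norm w"
          using Cauchy_Schwarz_ineq2[of "G x - G a" w]
          by (simp add: DG fun_diff_def inner_diff_left)
      qed
    qed (use d in auto)
    then show "\<bar>k (a + v) - k a - partials [v] k a\<bar> \<le> e * norm v"
      by (simp add: D_def mult.commute)
  qed (use d in auto)
qed

lemma integrable_convolution:
  fixes f k :: "'b::euclidean_space \<Rightarrow> real"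
  assumes "smooth k" "integrable lborel f" "\<And>y. y \<notin> cball 0 R \<Longrightarrow> f y = 0"
  shows "integrable lborel (\<lambda>y. k (y - z) * f y)"
  by (rule integrable_mult_compact_support[OF _ assms(2,3)])
    (auto intro!: continuous_on_compose2[OF smooth_imp_continuous[OF assms(1), of UNIV]] continuous_intros)

lemma convolution_has_derivative:
  fixes f k :: "'b::euclidean_space \<Rightarrow> real"
  assumes k: "smooth k" and f: "integrable lborel f" "\<And>y. y \<notin> cball 0 R \<Longrightarrow> f y = 0"
  shows "((\<lambda>z. LINT y|lborel. k (y - z) * f y) has_derivative
    (\<lambda>v. - (LINT y|lborel. partials [v] k (y - z) * f y))) (at z)"
proof -
  have I1: "integrable lborel (\<lambda>y. k (y - z) * f y)" for z
    by (rule integrable_convolution[OF k f])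
  have I2: "integrable lborel (\<lambda>y. partials [v] k (y - z) * f y)" for v z
    by (rule integrable_convolution[OF smooth_partials[OF k] f])
  let ?F = "\<lambda>v. - (LINT y|lborel. partials [v] k (y - z) * f y)"
  have lin: "linear (\<lambda>v. partials [v] k y)" for y
    using smooth_has_derivative[OF k] has_derivative_linear by blast
  have "linear ?F"
  proof (rule linearI)
    show "?F (v + w) = ?F v + ?F w" for v w
      using I2[of v] I2[of w] by (simp add: linear_add[OF lin] distrib_right)
    show "?F (c *\<^sub>R v) = c *\<^sub>R ?F v" for c v
      by (simp add: linear_scale[OF lin] mult.assoc)
  qed
  then have "bounded_linear ?F" by (simp add: linear_conv_bounded_linear)
  moreover have "\<exists>d>0. \<forall>x. norm (x - z) < d \<longrightarrow>
      norm ((LINT y|lborel. k (y - x) * f y) - (LINT y|lborel. k (y - z) * f y) - ?F (x - z)) \<le> e * norm (x - z)"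
    if "e > 0" for e
  proof -
    define M where "M = (LINT y|lborel. \<bar>f y\<bar>) + 1"
    have "M > 0" unfolding M_def by (intro add_nonneg_pos integral_nonneg) auto
    then have "e / M > 0" using that by simp
    from smooth_uniform_linearization[OF k this, of "R + norm z"] obtain d where
      d: "d > 0" "\<And>a v. a \<in> cball 0 (R + norm z) \<Longrightarrow> norm v < d \<Longrightarrow>
        \<bar>k (a + v) - k a - partials [v] k a\<bar> \<le> e / M * norm v" by blast
    show ?thesis
    proof (intro exI[of _ d] conjI allI impI)
      fix x assume x: "norm (x - z) < d"
      have neg: "partials [z - x] k y = - partials [x - z] k y" for y
        using linear_neg[OF lin[of y], of "x - z"] by simp
      have "(LINT y|lborel. k (y - x) * f y) - (LINT y|lborel. k (y - z) * f y) - ?F (x - z)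
        = (LINT y|lborel. (k (y - x) - k (y - z) - partials [z - x] k (y - z)) * f y)"
        using I1[of x] I1[of z] I2[of "x - z" z]
        by (simp add: left_diff_distrib distrib_right neg)
      also have "norm \<dots> \<le> (LINT y|lborel. e / M * norm (x - z) * \<bar>f y\<bar>)"
      proof (rule order_trans[OF integral_norm_bound integral_mono])
        show "integrable lborel (\<lambda>y. norm ((k (y - x) - k (y - z) - partials [z - x] k (y - z)) * f y))"
          using I1[of x] I1[of z] I2[of "x - z" z]
          by (intro integrable_norm) (simp add: left_diff_distrib distrib_right neg)
        show "integrable lborel (\<lambda>y. e / M * norm (x - z) * \<bar>f y\<bar>)"
          using f(1) by simp
        show "norm ((k (y - x) - k (y - z) - partials [z - x] k (y - z)) * f y) \<le> e / M * norm (x - z) * \<bar>f y\<bar>" for y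
        proof (cases "y \<in> cball 0 R")
          case True
          then have "y - z \<in> cball 0 (R + norm z)"
            using norm_triangle_ineq4[of y z] by auto
          from d(2)[OF this, of "z - x"] x
          have "\<bar>k (y - x) - k (y - z) - partials [z - x] k (y - z)\<bar> \<le> e / M * norm (x - z)"
            by (simp add: norm_minus_commute)
          then show ?thesis
            unfolding real_norm_def abs_mult by (rule mult_right_mono) simp
        qed (simp add: f(2))
      qed
      also have "\<dots> = e * norm (x - z) * ((M - 1) / M)"
        by (simp add: M_def)
      also have "\<dots> \<le> e * norm (x - z) * 1"
        using \<open>M > 0\<close> that by (intro mult_left_mono) auto
      finally show "norm ((LINT y|lborel. k (y - x) * f y) - (LINT y|lborel. k (y - z) * f y) - ?F (x - z)) \<le> e * norm (x - z)"
        by simp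
    qed (use d in auto)
  qed
  ultimately show ?thesis
    unfolding has_derivative_at_alt by blast
qed

lemma partials_convolution:
  fixes f k :: "'b::euclidean_space \<Rightarrow> real"
  assumes k: "smooth k" and f: "integrable lborel f" "\<And>y. y \<notin> cball 0 R \<Longrightarrow> f y = 0"
  shows "partials [v] (\<lambda>z. LINT y|lborel. k (y - z) * f y) =
    (\<lambda>z. - (LINT y|lborel. partials [v] k (y - z) * f y))"
  by (rule partials_eqI[OF convolution_has_derivative[OF assms]])

lemma smooth_convolution:
  fixes f k :: "'b::euclidean_space \<Rightarrow> real"
  assumes k: "smooth k" and f: "integrable lborel f" "\<And>y. y \<notin> cball 0 R \<Longrightarrow> f y = 0"
  shows "smooth (\<lambda>z. LINT y|lborel. k (y - z) * f y)"
proof (rule smooth_coinduct[where S = "(\<lambda>k z. LINT y|lborel. k (y - z) * f y) ` Collect smooth"])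
  fix g assume "g \<in> (\<lambda>k z. LINT y|lborel. k (y - z) * f y) ` Collect smooth"
  then obtain k where k: "smooth k" and g: "g = (\<lambda>z. LINT y|lborel. k (y - z) * f y)" by auto
  let ?f' = "\<lambda>z v. - (LINT y|lborel. partials [v] k (y - z) * f y)"
  have "(\<lambda>z. ?f' z v) \<in> (\<lambda>k z. LINT y|lborel. k (y - z) * f y) ` Collect smooth" for v
    using smooth_minus[OF smooth_partials[OF k, of "[v]"]]
    by (intro image_eqI[where x = "\<lambda>z. - partials [v] k z"]) auto
  then show "\<exists>f'. (\<forall>z. (g has_derivative f' z) (at z)) \<and>
      (\<forall>v. (\<lambda>z. f' z v) \<in> (\<lambda>k z. LINT y|lborel. k (y - z) * f y) ` Collect smooth \<or> smooth (\<lambda>z. f' z v))"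
    unfolding g using convolution_has_derivative[OF k f] by (intro exI[of _ ?f']) blast
qed (use k in auto)

section \<open>The heat mollifier\<close>

text \<open>The heat kernel times \<open>exp (- h / (4 t))\<close> for \<open>t > 0\<close>.\<close>

definition heat_smoothed :: "real \<Rightarrow> 'a::euclidean_space \<times> real \<Rightarrow> real" where
  "heat_smoothed h z = (4 * pi) powr (- real DIM('a) / 2) * heat_reg h (real DIM('a) / 2) z"

text \<open>The image of \<open>heat_smoothed h\<close> under the heat operator: the heat kernel times the probability density
\<open>h / (4 t\<^sup>2) exp (- h / (4 t))\<close> in the time variable.\<close>

definition heat_mollifier :: "real \<Rightarrow> 'a::euclidean_space \<times> real \<Rightarrow> real" where
  "heat_mollifier h z = (4 * pi) powr (- real DIM('a) / 2) * (h / 4) * heat_reg h (real DIM('a) / 2 + 2) z"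

lemma smooth_heat_smoothed: "h > 0 \<Longrightarrow> smooth (heat_smoothed h)"
  unfolding heat_smoothed_def[abs_def] by (intro smooth_mult smooth_const smooth_heat_reg)

lemma smooth_heat_mollifier: "h > 0 \<Longrightarrow> smooth (heat_mollifier h)"
  unfolding heat_mollifier_def[abs_def] by (intro smooth_mult smooth_const smooth_heat_reg)

lemma heat_mollifier_nonneg: "h > 0 \<Longrightarrow> 0 \<le> heat_mollifier h z"
  by (simp add: heat_mollifier_def heat_reg_nonneg)

lemma heat_smoothed_nonneg: "0 \<le> heat_smoothed h z"
  by (simp add: heat_smoothed_def heat_reg_nonneg)

lemma heat_smoothed_nonpos_time: "snd z \<le> 0 \<Longrightarrow> heat_smoothed h z = 0"
  by (simp add: heat_smoothed_def heat_reg_def flat_exp_def)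

lemma heat_smoothed_le_heat_kernel:
  fixes x :: "'a::euclidean_space"
  assumes "h > 0" "t > 0"
  shows "heat_smoothed h (x, t) \<le> heat_kernel x t"
proof -
  have "exp (- ((x \<bullet> x + h) / 4) / t) \<le> exp (- (x \<bullet> x) / (4 * t))"
    using assms by (simp add: field_simps)
  then show ?thesis
    using assms
    by (auto simp: heat_smoothed_def heat_kernel_def heat_reg_def flat_exp_def powr_mult power2_norm_eq_inner
        mult.assoc intro!: mult_left_mono)
qed

lemma partials_heat_reg:
  assumes "h > 0"
  shows "partials [v] (heat_reg h a) = (\<lambda>z.
      (- a * heat_reg h (a + 1) z + (fst z \<bullet> fst z + h) / 4 * heat_reg h (a + 2) z) * snd v
      - (fst z \<bullet> fst v) / 2 * heat_reg h (a + 1) z)"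
  by (rule partials_eqI[OF heat_reg_has_derivative[OF assms]])

lemma sum_inner_Basis_power2: "(\<Sum>b\<in>Basis. (x \<bullet> b)\<^sup>2) = x \<bullet> x"
  unfolding power2_eq_square by (rule euclidean_inner[symmetric])

lemma heat_equation_heat_smoothed:
  fixes z :: "'a::euclidean_space \<times> real"
  assumes "h > 0"
  shows "partials [(0, 1)] (heat_smoothed h) z - (\<Sum>i\<in>Basis. partials [(i, 0), (i, 0)] (heat_smoothed h) z)
    = heat_mollifier h z"
proof -
  let ?n = "real DIM('a)"
  let ?K = "heat_reg h :: real \<Rightarrow> 'a \<times> real \<Rightarrow> real"
  have 2: "partials [(i, 0), (i, 0)] (?K a) z = - 1 / 2 * ?K (a + 1) z + (fst z \<bullet> i)\<^sup>2 / 4 * ?K (a + 2) z"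
    if "i \<in> Basis" for i a
  proof -
    have 1: "partials [(i, 0)] (?K b) = (\<lambda>z. - (fst z \<bullet> i) / 2 * ?K (b + 1) z)" for b
      using assms by (simp add: partials_heat_reg)
    have "((\<lambda>z. - (fst z \<bullet> i) / 2 * ?K (a + 1) z) has_derivative
       (\<lambda>v. - (fst z \<bullet> i) / 2 * partials [v] (?K (a + 1)) z + - (fst v \<bullet> i) / 2 * ?K (a + 1) z)) (at z)" for z
      by (rule has_derivative_mult[OF _ smooth_has_derivative[OF smooth_heat_reg[OF assms]]])
        (auto intro!: derivative_eq_intros)
    from partials_eqI[OF this, of "(i, 0)"]
    have "partials [(i, 0), (i, 0)] (?K a) z =
      - (fst z \<bullet> i) / 2 * partials [(i, 0)] (?K (a + 1)) z + - (i \<bullet> i) / 2 * ?K (a + 1) z"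
      by (simp add: partials_Cons[of "(i,0)" "[(i,0)]"] 1[of a])
    also have "partials [(i, 0)] (?K (a + 1)) z = - (fst z \<bullet> i) / 2 * ?K (a + 2) z"
      using 1[of "a + 1"] by (simp add: add.assoc)
    also have "- (fst z \<bullet> i) / 2 * (- (fst z \<bullet> i) / 2 * ?K (a + 2) z) + - (i \<bullet> i) / 2 * ?K (a + 1) z
      = - 1 / 2 * ?K (a + 1) z + (fst z \<bullet> i)\<^sup>2 / 4 * ?K (a + 2) z"
      using that by (simp add: power2_eq_square)
    finally show ?thesis .
  qed
  have "(\<Sum>i\<in>Basis. partials [(i, 0), (i, 0)] (?K a) z) =
      - ?n / 2 * ?K (a + 1) z + (fst z \<bullet> fst z) / 4 * ?K (a + 2) z" for a
  proof -
    have "(\<Sum>i\<in>Basis. partials [(i, 0), (i, 0)] (?K a) z)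
      = (\<Sum>i\<in>Basis. - 1 / 2 * ?K (a + 1) z + (fst z \<bullet> i)\<^sup>2 * (?K (a + 2) z / 4))"
      using 2 by (intro sum.cong) auto
    also have "\<dots> = - ?n / 2 * ?K (a + 1) z + (\<Sum>i\<in>Basis. (fst z \<bullet> i)\<^sup>2) * (?K (a + 2) z / 4)"
      by (simp add: sum_subtractf sum_distrib_right sum_divide_distrib)
    also have "(\<Sum>i\<in>Basis. (fst z \<bullet> i)\<^sup>2) = fst z \<bullet> fst z"
      by (rule sum_inner_Basis_power2)
    finally show ?thesis by simp
  qed
  note lap = this
  have *: "partials [(0, 1)] (?K (?n / 2)) z - (\<Sum>i\<in>Basis. partials [(i, 0), (i, 0)] (?K (?n / 2)) z)
     = h / 4 * ?K (?n / 2 + 2) z"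
    unfolding lap using assms by (simp add: partials_heat_reg add_divide_distrib distrib_right)
  have S: "heat_smoothed h = (\<lambda>z::'a \<times> real. (4 * pi) powr (- real DIM('a) / 2) * ?K (?n / 2) z)"
    by (simp add: fun_eq_iff heat_smoothed_def)
  show ?thesis
    unfolding S partials_mult_const[OF smooth_heat_reg[OF assms]] heat_mollifier_def
    using * by (simp add: mult.assoc flip: sum_distrib_left right_diff_distrib)
qed

lemma nn_integral_heat_kernel:
  assumes "t > 0"
  shows "(\<integral>\<^sup>+x. heat_kernel (x::'a::euclidean_space) t \<partial>lborel) = 1"
proof -
  have *: "heat_kernel x t = (\<Prod>b\<in>Basis. normal_density 0 (sqrt (2 * t)) (x \<bullet> b))" for x :: 'a
  proof -
    have "(\<Prod>b\<in>Basis. normal_density 0 (sqrt (2 * t)) (x \<bullet> b))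
      = (1 / sqrt (4 * pi * t)) ^ DIM('a) * exp (\<Sum>b\<in>Basis. - (x \<bullet> b)\<^sup>2 / (4 * t))"
      using assms by (simp add: normal_density_def prod.distrib exp_sum mult.assoc power_divide prod_dividef)
    also have "(1 / sqrt (4 * pi * t)) ^ DIM('a) = (4 * pi * t) powr (- real DIM('a) / 2)"
    proof -
      have "1 / sqrt (4 * pi * t) = (4 * pi * t) powr (- 1 / 2)"
        using assms by (simp add: powr_minus powr_half_sqrt inverse_eq_divide)
      then show ?thesis
        using assms by (simp add: powr_realpow[symmetric] powr_powr)
    qed
    also have "(\<Sum>b\<in>Basis. - (x \<bullet> b)\<^sup>2 / (4 * t)) = - (norm x)\<^sup>2 / (4 * t)"
      unfolding power2_norm_eq_inner sum_inner_Basis_power2[symmetric]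
      by (simp add: sum_negf sum_divide_distrib)
    finally show ?thesis by (simp add: heat_kernel_def)
  qed
  have "(\<integral>\<^sup>+x. heat_kernel (x::'a) t \<partial>lborel)
    = (\<integral>\<^sup>+x. (\<Prod>b\<in>Basis. ennreal (normal_density 0 (sqrt (2 * t)) ((x::'a) \<bullet> b))) \<partial>lborel)"
    by (simp add: * prod_ennreal)
  also have "\<dots> = (\<Prod>b\<in>(Basis::'a set). (\<integral>\<^sup>+x. normal_density 0 (sqrt (2 * t)) x \<partial>lborel))"
    by (rule nn_integral_lborel_prod) auto
  also have "(\<integral>\<^sup>+x. normal_density 0 (sqrt (2 * t)) x \<partial>lborel) = 1"
    using assms by (subst nn_integral_eq_integral) auto
  finally show ?thesis by simp
qed

lemma heat_kernel_borel[measurable (raw)]: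
  assumes [measurable]: "f \<in> borel_measurable M" "g \<in> borel_measurable M"
  shows "(\<lambda>z. heat_kernel (f z :: 'a::euclidean_space) (g z)) \<in> borel_measurable M"
  unfolding heat_kernel_def by measurable

text \<open>Integrate first in space, where the heat kernel has mass one at every time.\<close>

lemma nn_integral_heat_kernel_times:
  assumes [measurable]: "g \<in> borel_measurable borel" and "c > 0" and g: "\<And>t. t \<le> 0 \<Longrightarrow> g t = 0"
  shows "(\<integral>\<^sup>+z. ennreal (heat_kernel (fst z :: 'a::euclidean_space) (c * snd z)) * g (snd z) \<partial>lborel)
    = (\<integral>\<^sup>+t. g t \<partial>lborel)"
proof -
  have "(\<integral>\<^sup>+z. ennreal (heat_kernel (fst z :: 'a) (c * snd z)) * g (snd z) \<partial>lborel)
    = (\<integral>\<^sup>+z. ennreal (heat_kernel (fst z :: 'a) (c * snd z)) * g (snd z) \<partial>(lborel \<Otimes>\<^sub>M lborel))"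
    by (simp only: lborel_prod)
  also have "\<dots> = (\<integral>\<^sup>+t. (\<integral>\<^sup>+x. ennreal (heat_kernel (x :: 'a) (c * t)) * g t \<partial>lborel) \<partial>lborel)"
    by (subst lborel_pair.nn_integral_snd[symmetric]) (simp_all)
  also have "\<dots> = (\<integral>\<^sup>+t. g t \<partial>lborel)"
  proof (rule nn_integral_cong)
    fix t
    show "(\<integral>\<^sup>+x. ennreal (heat_kernel (x :: 'a) (c * t)) * g t \<partial>lborel) = g t"
    proof (cases "t > 0")
      case True
      then show ?thesis
        using \<open>c > 0\<close> by (simp add: nn_integral_multc nn_integral_heat_kernel)
    qed (simp add: g)
  qed
  finally show ?thesis .
qed

lemma flat_exp_borel[measurable]: "flat_exp c a \<in> borel_measurable borel"
  unfolding flat_exp_def[abs_def] by measurable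

text \<open>\<open>c flat_exp c 2\<close> is the derivative of \<open>flat_exp c 0\<close>, which tends to \<open>1\<close> at infinity.\<close>

lemma nn_integral_flat_exp_2:
  assumes "c > 0" "r \<ge> 0"
  shows "(\<integral>\<^sup>+t. ennreal (c * flat_exp c 2 t) * indicator {r..} t \<partial>lborel) = ennreal (1 - flat_exp c 0 r)"
proof (rule nn_integral_FTC_atLeast)
  show "(flat_exp c 0 has_real_derivative c * flat_exp c 2 t) (at t)" for t
    using flat_exp_has_derivative[OF assms(1), of 0 t] by simp
  have "((\<lambda>t. exp (- c / t)) \<longlongrightarrow> 1) at_top" by real_asymp
  then show "(flat_exp c 0 \<longlongrightarrow> 1) at_top"
    by (rule Lim_transform_eventually)
      (auto simp: flat_exp_def intro!: eventually_mono[OF eventually_gt_at_top[of 0]])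
qed (use assms in \<open>auto simp: flat_exp_nonneg\<close>)

lemma nn_integral_flat_exp_2_total:
  assumes "c > 0"
  shows "(\<integral>\<^sup>+t. ennreal (c * flat_exp c 2 t) \<partial>lborel) = 1"
proof -
  have "(\<integral>\<^sup>+t. ennreal (c * flat_exp c 2 t) \<partial>lborel) = (\<integral>\<^sup>+t. ennreal (c * flat_exp c 2 t) * indicator {0..} t \<partial>lborel)"
    by (intro nn_integral_cong) (auto simp: flat_exp_def indicator_def)
  also have "\<dots> = 1"
    using nn_integral_flat_exp_2[OF assms, of 0] by (simp add: flat_exp_def)
  finally show ?thesis .
qed

lemma heat_mollifier_eq:
  fixes z :: "'a::euclidean_space \<times> real"
  shows "heat_mollifier h z = heat_kernel (fst z) (snd z) * (h / 4 * flat_exp (h / 4) 2 (snd z))"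
proof (cases "snd z > 0")
  case True
  have "exp (- ((fst z \<bullet> fst z + h) / 4) / snd z) = exp (- (norm (fst z))\<^sup>2 / (4 * snd z)) * exp (- (h / 4) / snd z)"
    using True by (simp add: exp_add[symmetric] power2_norm_eq_inner field_simps)
  moreover have "snd z powr - (real DIM('a) / 2 + 2) = snd z powr (- real DIM('a) / 2) * snd z powr - 2"
    by (simp add: powr_add[symmetric])
  ultimately show ?thesis
    using True
    by (simp add: heat_mollifier_def heat_kernel_def heat_reg_def flat_exp_def powr_mult mult_ac)
qed (simp add: heat_mollifier_def heat_reg_def flat_exp_def)

lemma heat_kernel_nonneg: "0 \<le> heat_kernel x t"
  by (simp add: heat_kernel_def)

lemma ennreal_heat_mollifier:
  assumes "h > 0"
  shows "ennreal (heat_mollifier h z)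
    = ennreal (heat_kernel (fst z) (snd z)) * ennreal (h / 4 * flat_exp (h / 4) 2 (snd z))"
  unfolding heat_mollifier_eq using assms by (intro ennreal_mult) (auto simp: heat_kernel_nonneg flat_exp_nonneg)

lemma nn_integral_heat_mollifier:
  assumes "h > 0"
  shows "(\<integral>\<^sup>+z. heat_mollifier h (z::'a::euclidean_space \<times> real) \<partial>lborel) = 1"
proof -
  have "(\<integral>\<^sup>+z. heat_mollifier h (z::'a \<times> real) \<partial>lborel)
    = (\<integral>\<^sup>+z. ennreal (heat_kernel (fst z :: 'a) (1 * snd z)) * ennreal (h / 4 * flat_exp (h / 4) 2 (snd z)) \<partial>lborel)"
    using assms by (intro nn_integral_cong) (simp only: ennreal_heat_mollifier mult_1)
  also have "\<dots> = (\<integral>\<^sup>+t. ennreal (h / 4 * flat_exp (h / 4) 2 t) \<partial>lborel)"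
    by (rule nn_integral_heat_kernel_times) (auto simp: flat_exp_def)
  also have "\<dots> = 1"
    using assms by (intro nn_integral_flat_exp_2_total) simp
  finally show ?thesis .
qed

text \<open>Outside the ball of radius \<open>r\<close> either \<open>t \<ge> r / 2\<close> or \<open>\<bar>x\<bar> \<ge> r / 2\<close>. In the first case the density in
time has mass \<open>O(h)\<close>. In the second one half of the Gaussian exponent yields a factor
\<open>exp (- r\<^sup>2 / (32 t))\<close>, which makes \<open>t\<^sup>-\<^sup>2\<close> integrable near \<open>0\<close>, and the other half is the heat kernel at
time \<open>2 t\<close>.\<close>

lemma heat_mollifier_tail:
  assumes "r > 0" "h > 0"
  shows "(\<integral>\<^sup>+z. heat_mollifier h (z::'a::euclidean_space \<times> real) * indicator (- ball 0 r) z \<partial>lborel)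
    \<le> ennreal (h * (1 / (2 * r) + 2 powr (real DIM('a) / 2) * (8 / r\<^sup>2)))"
proof -
  let ?n = "real DIM('a)"
  define c where "c = (r / 2)\<^sup>2 / 8"
  have "c > 0" using assms by (simp add: c_def)
  let ?H = "\<lambda>s z. ennreal (heat_kernel (fst z :: 'a) (s * snd z))"
  have pt: "ennreal (heat_mollifier h z * indicator (- ball 0 r) z)
    \<le> ?H 1 z * (ennreal (h / 4 * flat_exp (h / 4) 2 (snd z)) * indicator {r / 2..} (snd z))
      + ?H 2 z * (ennreal (2 powr (?n / 2) * (h / 4 / c)) * ennreal (c * flat_exp c 2 (snd z)))"
    for z :: "'a \<times> real"
  proof -
    consider "z \<in> ball 0 r \<or> snd z \<le> 0" | "snd z \<ge> r / 2" | "z \<notin> ball 0 r" "snd z > 0" "snd z < r / 2"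
      by linarith
    then show ?thesis
    proof cases
      case 1
      then show ?thesis by (auto simp: heat_mollifier_def heat_reg_def flat_exp_def)
    next
      case 2
      have "ennreal (heat_mollifier h z * indicator (- ball 0 r) z) \<le> ennreal (heat_mollifier h z)"
        using assms by (intro ennreal_leI) (auto simp: indicator_def heat_mollifier_nonneg)
      also have "\<dots> = ?H 1 z * (ennreal (h / 4 * flat_exp (h / 4) 2 (snd z)) * indicator {r / 2..} (snd z))"
        using 2 by (simp add: ennreal_heat_mollifier[OF assms(2)])
      finally show ?thesis by (rule order_trans) simp
    next
      case 3
      define t x where "t = snd z" and "x = fst z"
      have t: "t > 0" using 3 by (simp add: t_def)
      have "r \<le> norm z" using 3(1) by simp
      also have "norm z \<le> norm x + \<bar>t\<bar>"
        unfolding x_def t_def using norm_Pair_le[of "fst z" "snd z"] by simp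
      finally have "r / 2 \<le> norm x" using 3 by (simp add: t_def)
      then have "(r / 2)\<^sup>2 \<le> (norm x)\<^sup>2" using assms by (intro power_mono) auto
      then have "- ((norm x)\<^sup>2 / 4 + h / 4) \<le> - ((norm x)\<^sup>2 / 8 + c)"
        using assms unfolding c_def by linarith
      then have "- ((norm x)\<^sup>2 / 4 + h / 4) / t \<le> - ((norm x)\<^sup>2 / 8 + c) / t"
        using t by (intro divide_right_mono) auto
      moreover have "- ((norm x)\<^sup>2 / 4 + h / 4) / t = - (norm x)\<^sup>2 / (4 * t) + - (h / 4) / t"
        "- ((norm x)\<^sup>2 / 8 + c) / t = - (norm x)\<^sup>2 / (4 * (2 * t)) + - c / t"
        using t by (simp_all add: field_simps)
      ultimately have "- (norm x)\<^sup>2 / (4 * t) + - (h / 4) / t \<le> - (norm x)\<^sup>2 / (4 * (2 * t)) + - c / t"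
        by (simp only:)
      then have e: "exp (- (norm x)\<^sup>2 / (4 * t)) * exp (- (h / 4) / t) \<le> exp (- (norm x)\<^sup>2 / (4 * (2 * t))) * exp (- c / t)"
        unfolding exp_add[symmetric] by simp
      have p: "(4 * pi * t) powr (- ?n / 2) = (4 * pi * (2 * t)) powr (- ?n / 2) * 2 powr (?n / 2)"
      proof -
        have "(4 * pi * (2 * t)) powr (- ?n / 2) = (4 * pi * t) powr (- ?n / 2) * 2 powr (- ?n / 2)"
          using powr_mult[of "4 * pi * t" 2 "- ?n / 2"] t by (simp add: mult_ac)
        moreover have "2 powr (- ?n / 2) * 2 powr (?n / 2) = 1"
          by (simp add: powr_add[symmetric])
        ultimately show ?thesis by (simp only: mult.assoc mult_1_right)
      qed
      have "heat_mollifier h z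
        = ((4 * pi * t) powr (- ?n / 2) * (h / 4) * t powr (- 2)) * (exp (- (norm x)\<^sup>2 / (4 * t)) * exp (- (h / 4) / t))"
        using t by (simp add: heat_mollifier_eq heat_kernel_def flat_exp_def mult_ac flip: t_def x_def)
      also have "\<dots> \<le> ((4 * pi * t) powr (- ?n / 2) * (h / 4) * t powr (- 2)) * (exp (- (norm x)\<^sup>2 / (4 * (2 * t))) * exp (- c / t))"
        using assms by (intro mult_left_mono e) auto
      also have "\<dots> = heat_kernel x (2 * t) * (2 powr (?n / 2) * (h / 4 / c) * (c * flat_exp c 2 t))"
        using t \<open>c > 0\<close> unfolding p by (simp add: heat_kernel_def flat_exp_def mult_ac)
      finally have "ennreal (heat_mollifier h z) \<le> ?H 2 z * (ennreal (2 powr (?n / 2) * (h / 4 / c)) * ennreal (c * flat_exp c 2 (snd z)))"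
        using assms \<open>c > 0\<close>
        by (simp add: ennreal_mult''[symmetric] ennreal_mult'[symmetric] flat_exp_nonneg ennreal_leI flip: t_def x_def)
      moreover have "ennreal (heat_mollifier h z * indicator (- ball 0 r) z) \<le> ennreal (heat_mollifier h z)"
        using assms by (intro ennreal_leI) (auto simp: indicator_def heat_mollifier_nonneg)
      ultimately show ?thesis by (meson add_increasing order_trans zero_le)
    qed
  qed
  have "(\<integral>\<^sup>+z. heat_mollifier h (z::'a \<times> real) * indicator (- ball 0 r) z \<partial>lborel)
    \<le> (\<integral>\<^sup>+z. ?H 1 z * (ennreal (h / 4 * flat_exp (h / 4) 2 (snd z)) * indicator {r / 2..} (snd z))
      + ?H 2 z * (ennreal (2 powr (?n / 2) * (h / 4 / c)) * ennreal (c * flat_exp c 2 (snd z))) \<partial>lborel)"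
    by (rule nn_integral_mono) (rule pt)
  also have "\<dots> = (\<integral>\<^sup>+z. ?H 1 z * (ennreal (h / 4 * flat_exp (h / 4) 2 (snd z)) * indicator {r / 2..} (snd z)) \<partial>lborel)
      + (\<integral>\<^sup>+z. ?H 2 z * (ennreal (2 powr (?n / 2) * (h / 4 / c)) * ennreal (c * flat_exp c 2 (snd z))) \<partial>lborel)"
    by (intro nn_integral_add) (simp_all flip: borel_prod)
  also have "(\<integral>\<^sup>+z. ?H 1 z * (ennreal (h / 4 * flat_exp (h / 4) 2 (snd z)) * indicator {r / 2..} (snd z)) \<partial>lborel)
     = ennreal (1 - flat_exp (h / 4) 0 (r / 2))"
  proof -
    have "(\<integral>\<^sup>+z. ?H 1 z * (ennreal (h / 4 * flat_exp (h / 4) 2 (snd z)) * indicator {r / 2..} (snd z)) \<partial>lborel)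
      = (\<integral>\<^sup>+t. ennreal (h / 4 * flat_exp (h / 4) 2 t) * indicator {r / 2..} t \<partial>lborel)"
      by (rule nn_integral_heat_kernel_times) (auto simp: flat_exp_def)
    then show ?thesis
      using nn_integral_flat_exp_2[of "h / 4" "r / 2"] assms by simp
  qed
  also have "(\<integral>\<^sup>+z. ?H 2 z * (ennreal (2 powr (?n / 2) * (h / 4 / c)) * ennreal (c * flat_exp c 2 (snd z))) \<partial>lborel)
    = ennreal (2 powr (?n / 2) * (h / 4 / c))"
    using \<open>c > 0\<close> by (subst nn_integral_heat_kernel_times)
      (auto simp: nn_integral_cmult nn_integral_flat_exp_2_total, simp add: flat_exp_def)
  also have "1 - flat_exp (h / 4) 0 (r / 2) \<le> h / (2 * r)"
    using assms exp_ge_add_one_self[of "- (h / (2 * r))"] by (simp add: flat_exp_def)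
  finally have "(\<integral>\<^sup>+z. heat_mollifier h (z::'a \<times> real) * indicator (- ball 0 r) z \<partial>lborel)
    \<le> ennreal (h / (2 * r)) + ennreal (2 powr (?n / 2) * (h / 4 / c))"
    by (simp add: ennreal_leI add_mono)
  also have "\<dots> = ennreal (h / (2 * r) + 2 powr (?n / 2) * (h / 4 / c))"
    using assms \<open>c > 0\<close> by (simp add: ennreal_plus)
  also have "h / (2 * r) + 2 powr (?n / 2) * (h / 4 / c) = h * (1 / (2 * r) + 2 powr (?n / 2) * (8 / r\<^sup>2))"
    by (simp add: c_def field_simps power2_eq_square)
  finally show ?thesis .
qed

section \<open>Convergence of mollifications in mean\<close>

text \<open>A measurable function is an almost everywhere limit of continuous functions. Clipping these at height
\<open>C\<close> and multiplying by a cut-off in space keeps the limit and provides a dominating function.\<close>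

lemma L1_approx_by_continuous:
  fixes f :: "'b::euclidean_space \<Rightarrow> real"
  assumes [measurable]: "f \<in> borel_measurable borel" and C: "\<And>z. \<bar>f z\<bar> \<le> C"
    and R: "\<And>z. z \<notin> cball 0 R \<Longrightarrow> f z = 0" and "e > 0"
  shows "\<exists>g. continuous_on UNIV g \<and> (\<forall>z. \<bar>g z\<bar> \<le> C) \<and> (\<integral>\<^sup>+z. ennreal \<bar>f z - g z\<bar> \<partial>lborel) < ennreal e"
proof -
  have "C \<ge> 0" using C[of 0] by linarith
  have [measurable]: "cball (0 :: 'b) (R + 1) \<in> sets borel" by simp
  have "f \<in> borel_measurable lebesgue" by (simp add: measurable_completion)
  then have "f measurable_on UNIV"
    by (rule lebesgue_measurable_imp_measurable_on_real) simp
  then obtain N g where N: "negligible N" and g: "\<And>n. continuous_on UNIV (g n)"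
    "\<And>x. x \<notin> N \<Longrightarrow> (\<lambda>n. g n x) \<longlonglongrightarrow> f x"
    unfolding measurable_on_def by auto
  define c where "c z = max 0 (min 1 (R + 1 - norm z))" for z :: 'b
  define G where "G n z = max (- C) (min C (g n z)) * c z" for n z
  have cont: "continuous_on UNIV (G n)" for n
    unfolding G_def c_def by (intro continuous_intros g)
  then have [measurable]: "G n \<in> borel_measurable borel" for n
    by (rule borel_measurable_continuous_onI)
  have c: "0 \<le> c z" "c z \<le> 1" for z by (auto simp: c_def)
  have bound: "\<bar>G n z\<bar> \<le> C" for n z
  proof -
    have "\<bar>max (- C) (min C (g n z))\<bar> * c z \<le> C * 1"
      using \<open>C \<ge> 0\<close> c by (intro mult_mono) auto
    then show ?thesis using c by (simp add: G_def abs_mult)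
  qed
  have lim: "(\<lambda>n. G n z) \<longlonglongrightarrow> f z" if "z \<notin> N" for z
  proof -
    have "(\<lambda>n. G n z) \<longlonglongrightarrow> max (- C) (min C (f z)) * c z"
      unfolding G_def by (intro tendsto_intros g that)
    also have "max (- C) (min C (f z)) = f z"
      using C[of z] by auto
    also have "f z * c z = f z"
      using R[of z] by (cases "z \<in> cball 0 R") (auto simp: c_def)
    finally show ?thesis .
  qed
  have "(\<lambda>n. \<integral>\<^sup>+z. ennreal \<bar>f z - G n z\<bar> \<partial>lebesgue) \<longlonglongrightarrow> (\<integral>\<^sup>+z. 0 \<partial>(lebesgue :: 'b measure))"
  proof (rule nn_integral_dominated_convergence)
    let ?w = "\<lambda>z. ennreal (2 * C) * indicator (cball (0 :: 'b) (R + 1)) z"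
    show "(\<integral>\<^sup>+z. ?w z \<partial>lebesgue) < \<infinity>"
      using emeasure_bounded_finite[OF bounded_cball, of "0::'b" "R + 1"]
      by (subst nn_integral_cmult_indicator) (auto simp: ennreal_mult_less_top)
    show "AE z in lebesgue. ennreal \<bar>f z - G n z\<bar> \<le> ?w z" for n
    proof (intro always_eventually allI)
      fix z show "ennreal \<bar>f z - G n z\<bar> \<le> ?w z"
      proof (cases "z \<in> cball 0 (R + 1)")
        case True
        then show ?thesis using C[of z] bound[of n z] by (auto intro!: ennreal_leI)
      next
        case False
        then show ?thesis using R[of z] by (auto simp: G_def c_def)
      qed
    qed
    have "AE z in lebesgue. z \<notin> N"
      using N by (simp add: negligible_iff_null_sets AE_not_in)
    then show "AE z in lebesgue. (\<lambda>n. ennreal \<bar>f z - G n z\<bar>) \<longlonglongrightarrow> 0"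
    proof eventually_elim
      case (elim z)
      have "(\<lambda>n. ennreal \<bar>f z - G n z\<bar>) \<longlonglongrightarrow> ennreal \<bar>f z - f z\<bar>"
        by (intro tendsto_intros lim elim)
      then show ?case by simp
    qed
  qed (rule measurable_completion, measurable)+
  then have "eventually (\<lambda>n. (\<integral>\<^sup>+z. ennreal \<bar>f z - G n z\<bar> \<partial>lebesgue) < ennreal e) sequentially"
    using \<open>e > 0\<close> by (intro order_tendstoD(2)) auto
  then obtain n where "(\<integral>\<^sup>+z. ennreal \<bar>f z - G n z\<bar> \<partial>lebesgue) < ennreal e"
    using eventually_happens'[OF sequentially_bot] by blast
  then show ?thesis
    using cont bound by (intro exI[of _ "G n"]) (auto simp: nn_integral_completion)
qed

lemma nn_integral_lborel_shift:
  fixes f :: "'b::euclidean_space \<Rightarrow> ennreal"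
  assumes [measurable]: "f \<in> borel_measurable borel"
  shows "(\<integral>\<^sup>+z. f (z - a) \<partial>lborel) = (\<integral>\<^sup>+z. f z \<partial>lborel)"
    and "(\<integral>\<^sup>+z. f (a - z) \<partial>lborel) = (\<integral>\<^sup>+z. f z \<partial>lborel)"
proof -
  have "(\<integral>\<^sup>+z. f z \<partial>lborel) = (\<integral>\<^sup>+z. f z \<partial>(distr lborel borel ((+) (- a))))"
    by (simp only: lborel_distr_plus)
  then show "(\<integral>\<^sup>+z. f (z - a) \<partial>lborel) = (\<integral>\<^sup>+z. f z \<partial>lborel)"
    by (simp add: nn_integral_distr)
  have "(\<integral>\<^sup>+z. f z \<partial>lborel) = (\<integral>\<^sup>+z. f (a + (-1) *\<^sub>R z) * ennreal (\<bar>-1\<bar> ^ DIM('b)) \<partial>lborel)"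
    by (subst lborel_affine[of "-1" a]) (simp_all add: nn_integral_density nn_integral_distr)
  then show "(\<integral>\<^sup>+z. f (a - z) \<partial>lborel) = (\<integral>\<^sup>+z. f z \<partial>lborel)"
    by simp
qed

text \<open>Insert a continuous \<open>g\<close> between \<open>f y\<close> and \<open>f z\<close>. The two differences \<open>f - g\<close> contribute their norm
each, by Tonelli's theorem since \<open>k\<close> has mass one; \<open>g y - g z\<close> is controlled by the modulus of
continuity for \<open>\<bar>y - z\<bar> < r\<close> and by the tail of \<open>k\<close> otherwise.\<close>

lemma nn_integral_mollification_error:
  fixes k f g :: "'b::euclidean_space \<Rightarrow> real"
  assumes [measurable]: "k \<in> borel_measurable borel" "f \<in> borel_measurable borel"
    and g: "continuous_on UNIV g" "\<And>z. \<bar>g z\<bar> \<le> C"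
    and k: "\<And>z. k z \<ge> 0" "(\<integral>\<^sup>+z. k z \<partial>lborel) = 1"
    and "w \<ge> 0" and modulus: "\<And>y z. z \<in> cball 0 S \<Longrightarrow> dist y z < r \<Longrightarrow> \<bar>g y - g z\<bar> \<le> w"
  shows "(\<integral>\<^sup>+z\<in>cball 0 S. (\<integral>\<^sup>+y. ennreal (k (y - z) * \<bar>f y - f z\<bar>) \<partial>lborel) \<partial>lborel)
    \<le> 2 * (\<integral>\<^sup>+z. ennreal \<bar>f z - g z\<bar> \<partial>lborel)
      + (ennreal w + ennreal (2 * C) * (\<integral>\<^sup>+z. k z * indicator (- ball 0 r) z \<partial>lborel)) * emeasure lborel (cball 0 S :: 'b set)"
proof -
  have [measurable]: "g \<in> borel_measurable borel"
    using g(1) by (rule borel_measurable_continuous_onI)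
  have "C \<ge> 0" using g(2)[of 0] by linarith
  have [measurable]: "cball (0 :: 'b) S \<in> sets borel" "ball (0 :: 'b) r \<in> sets borel" by simp_all
  let ?T = "\<integral>\<^sup>+z. k z * indicator (- ball 0 r) z \<partial>lborel"
  let ?d = "\<lambda>z. ennreal \<bar>f z - g z\<bar>"
  have kz: "(\<integral>\<^sup>+y. ennreal (k (y - z)) \<partial>lborel) = 1" for z
    using nn_integral_lborel_shift(1)[of "\<lambda>y. ennreal (k y)" z] k(2) by simp
  have ky: "(\<integral>\<^sup>+z. ennreal (k (y - z)) \<partial>lborel) = 1" for y
    using nn_integral_lborel_shift(2)[of "\<lambda>y. ennreal (k y)" y] k(2) by simp
  have tail: "(\<integral>\<^sup>+y. ennreal (k (y - z)) * indicator (- ball 0 r) (y - z) \<partial>lborel) = ?T" for z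
    using nn_integral_lborel_shift(1)[of "\<lambda>y. ennreal (k y) * indicator (- ball 0 r) y" z]
    by (simp add: ennreal_mult'' ennreal_indicator k(1))
  have inner: "(\<integral>\<^sup>+y. ennreal (k (y - z) * \<bar>f y - f z\<bar>) \<partial>lborel)
    \<le> (\<integral>\<^sup>+y. ennreal (k (y - z)) * ?d y \<partial>lborel) + (ennreal w + ennreal (2 * C) * ?T) + ?d z"
    if z: "z \<in> cball 0 S" for z
  proof -
    have "ennreal (k (y - z) * \<bar>f y - f z\<bar>) \<le> ennreal (k (y - z)) * ?d y
        + (ennreal (k (y - z)) * ennreal w + ennreal (2 * C) * (ennreal (k (y - z)) * indicator (- ball 0 r) (y - z)))
        + ennreal (k (y - z)) * ?d z" for y
    proof -
      have "\<bar>g y - g z\<bar> \<le> w + 2 * C * indicator (- ball 0 r) (y - z)"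
      proof (cases "dist y z < r")
        case True
        then show ?thesis using modulus[OF z True] \<open>C \<ge> 0\<close> by (auto simp: indicator_def)
      next
        case False
        then show ?thesis using g(2)[of y] g(2)[of z] \<open>w \<ge> 0\<close>
          by (auto simp: indicator_def dist_norm norm_minus_commute)
      qed
      then have "\<bar>f y - f z\<bar> \<le> \<bar>f y - g y\<bar> + (w + 2 * C * indicator (- ball 0 r) (y - z)) + \<bar>f z - g z\<bar>"
        by linarith
      then have "k (y - z) * \<bar>f y - f z\<bar> \<le> k (y - z) * (\<bar>f y - g y\<bar> + (w + 2 * C * indicator (- ball 0 r) (y - z)) + \<bar>f z - g z\<bar>)"
        by (intro mult_left_mono k)
      also have "\<dots> = k (y - z) * \<bar>f y - g y\<bar> + (k (y - z) * w + 2 * C * (k (y - z) * indicator (- ball 0 r) (y - z)))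
         + k (y - z) * \<bar>f z - g z\<bar>"
        by (simp add: algebra_simps)
      finally have "ennreal (k (y - z) * \<bar>f y - f z\<bar>) \<le> ennreal (k (y - z) * \<bar>f y - g y\<bar> + (k (y - z) * w + 2 * C * (k (y - z) * indicator (- ball 0 r) (y - z)))
         + k (y - z) * \<bar>f z - g z\<bar>)"
        by (rule ennreal_leI)
      also have "\<dots> = ennreal (k (y - z)) * ?d y
        + (ennreal (k (y - z)) * ennreal w + ennreal (2 * C) * (ennreal (k (y - z)) * indicator (- ball 0 r) (y - z)))
        + ennreal (k (y - z)) * ?d z"
        using \<open>C \<ge> 0\<close> \<open>w \<ge> 0\<close> k(1)[of "y - z"]
        by (simp add: ennreal_plus ennreal_mult ennreal_indicator)
      finally show ?thesis .
    qed
    then have "(\<integral>\<^sup>+y. ennreal (k (y - z) * \<bar>f y - f z\<bar>) \<partial>lborel) \<le> (\<integral>\<^sup>+y. ennreal (k (y - z)) * ?d y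
        + (ennreal (k (y - z)) * ennreal w + ennreal (2 * C) * (ennreal (k (y - z)) * indicator (- ball 0 r) (y - z)))
        + ennreal (k (y - z)) * ?d z \<partial>lborel)"
      by (intro nn_integral_mono)
    also have "\<dots> = (\<integral>\<^sup>+y. ennreal (k (y - z)) * ?d y \<partial>lborel) + (ennreal w + ennreal (2 * C) * ?T) + ?d z"
      by (simp add: nn_integral_add nn_integral_cmult nn_integral_multc kz tail)
    finally show ?thesis .
  qed
  have [measurable]: "(\<lambda>z. \<integral>\<^sup>+y. ennreal (k (y - z)) * ?d y \<partial>lborel) \<in> borel_measurable borel"
    by measurable
  have "(\<integral>\<^sup>+z\<in>cball 0 S. (\<integral>\<^sup>+y. ennreal (k (y - z) * \<bar>f y - f z\<bar>) \<partial>lborel) \<partial>lborel)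
    \<le> (\<integral>\<^sup>+z. (\<integral>\<^sup>+y. ennreal (k (y - z)) * ?d y \<partial>lborel)
        + (ennreal w + ennreal (2 * C) * ?T) * indicator (cball 0 S) z + ?d z \<partial>lborel)"
  proof (intro nn_integral_mono)
    fix z :: 'b
    show "(\<integral>\<^sup>+y. ennreal (k (y - z) * \<bar>f y - f z\<bar>) \<partial>lborel) * indicator (cball 0 S) z
      \<le> (\<integral>\<^sup>+y. ennreal (k (y - z)) * ?d y \<partial>lborel) + (ennreal w + ennreal (2 * C) * ?T) * indicator (cball 0 S) z + ?d z"
      using inner[of z] by (cases "z \<in> cball 0 S") auto
  qed
  also have "\<dots> = (\<integral>\<^sup>+z. (\<integral>\<^sup>+y. ennreal (k (y - z)) * ?d y \<partial>lborel) \<partial>lborel)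
      + (ennreal w + ennreal (2 * C) * ?T) * emeasure lborel (cball 0 S :: 'b set) + (\<integral>\<^sup>+z. ?d z \<partial>lborel)"
    by (simp add: nn_integral_add nn_integral_cmult_indicator)
  also have "(\<integral>\<^sup>+z. (\<integral>\<^sup>+y. ennreal (k (y - z)) * ?d y \<partial>lborel) \<partial>lborel)
     = (\<integral>\<^sup>+y. (\<integral>\<^sup>+z. ennreal (k (y - z)) * ?d y \<partial>lborel) \<partial>lborel)"
    by (rule lborel_pair.Fubini'[symmetric]) simp
  also have "\<dots> = (\<integral>\<^sup>+y. ?d y \<partial>lborel)"
    by (simp add: nn_integral_multc ky)
  finally show ?thesis
    by (simp add: mult_2 ac_simps)
qed

lemma heat_mollification_L1_error:
  fixes f :: "'a::euclidean_space \<times> real \<Rightarrow> real"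
  assumes [measurable]: "f \<in> borel_measurable borel" and C: "\<And>z. \<bar>f z\<bar> \<le> C"
    and R: "\<And>z. z \<notin> cball 0 R \<Longrightarrow> f z = 0" and "e > 0"
  shows "\<exists>h>0. (\<integral>\<^sup>+z\<in>cball 0 S. (\<integral>\<^sup>+y. ennreal (heat_mollifier h (y - z) * \<bar>f y - f z\<bar>) \<partial>lborel) \<partial>lborel)
    < ennreal e"
proof -
  have "C \<ge> 0" using C[of 0] by linarith
  have "e / 6 > 0" using \<open>e > 0\<close> by simp
  from L1_approx_by_continuous[OF assms(1) C R this] obtain g where
    g: "continuous_on UNIV g" "\<And>z. \<bar>g z\<bar> \<le> C" "(\<integral>\<^sup>+z. ennreal \<bar>f z - g z\<bar> \<partial>lborel) < ennreal (e / 6)" by blast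
  define m where "m = measure lborel (cball 0 S :: ('a \<times> real) set)"
  have m: "emeasure lborel (cball 0 S :: ('a \<times> real) set) = ennreal m" "m \<ge> 0"
    using emeasure_bounded_finite[OF bounded_cball, of "0 :: 'a \<times> real" S]
    by (auto simp: m_def emeasure_eq_ennreal_measure)
  define w where "w = e / (6 * (m + 1))"
  have w: "w > 0" "w * m \<le> e / 6"
    using m(2) \<open>e > 0\<close> by (auto simp: w_def field_simps)
  have "uniformly_continuous_on (cball 0 (S + 1)) g"
    using g(1) by (intro compact_uniformly_continuous) (auto intro: continuous_on_subset)
  then obtain r0 where r0: "r0 > 0" "\<And>x y. x \<in> cball 0 (S + 1) \<Longrightarrow> y \<in> cball 0 (S + 1) \<Longrightarrow> dist x y < r0
      \<Longrightarrow> dist (g x) (g y) < w"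
    using w(1) unfolding uniformly_continuous_on_def by metis
  define r where "r = min r0 1"
  have "r > 0" using r0 by (simp add: r_def)
  have modulus: "\<bar>g y - g z\<bar> \<le> w" if z: "z \<in> cball 0 S" and yz: "dist y z < r" for y z
  proof -
    have "norm y \<le> norm z + dist y z" by (metis dist_norm norm_triangle_sub)
    then have "dist (g y) (g z) < w"
      using z yz by (intro r0(2)) (auto simp: r_def)
    then show ?thesis by (simp add: dist_real_def)
  qed
  define A where "A = 1 / (2 * r) + 2 powr (real DIM('a) / 2) * (8 / r\<^sup>2)"
  have "A > 0" using \<open>r > 0\<close> by (auto simp: A_def intro!: add_pos_nonneg)
  define h where "h = e / (6 * (2 * C * A * m + 1))"
  have pos: "2 * C * A * m \<ge> 0" using m(2) \<open>C \<ge> 0\<close> \<open>A > 0\<close> by simp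
  then have "0 < 2 * C * A * m + 1" by linarith
  then have "h > 0" unfolding h_def using \<open>e > 0\<close>
    by (intro divide_pos_pos mult_pos_pos) (assumption | simp)+
  have "2 * C * (h * A) * m = e / 6 * (2 * C * A * m / (2 * C * A * m + 1))"
  proof -
    have "2 * C * (e / (6 * B) * A) * m = e / 6 * (2 * C * A * m / B)" for B
      by (simp add: ac_simps)
    then show ?thesis unfolding h_def .
  qed
  also have "\<dots> \<le> e / 6 * 1"
  proof (rule mult_left_mono)
    have "x / (x + 1) \<le> 1" if "x \<ge> 0" for x :: real
      using that by simp
    from this[OF pos] show "2 * C * A * m / (2 * C * A * m + 1) \<le> 1" .
  qed (use \<open>e > 0\<close> in simp)
  finally have h2: "2 * C * (h * A) * m \<le> e / 6" by simp
  have "(\<integral>\<^sup>+z\<in>cball 0 S. (\<integral>\<^sup>+y. ennreal (heat_mollifier h (y - z) * \<bar>f y - f z\<bar>) \<partial>lborel) \<partial>lborel)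
    \<le> 2 * (\<integral>\<^sup>+z. ennreal \<bar>f z - g z\<bar> \<partial>lborel)
      + (ennreal w + ennreal (2 * C) * (\<integral>\<^sup>+z. heat_mollifier h z * indicator (- ball 0 r) (z :: 'a \<times> real) \<partial>lborel))
        * emeasure lborel (cball 0 S :: ('a \<times> real) set)"
  proof (rule nn_integral_mollification_error)
    show "heat_mollifier h \<in> borel_measurable (borel :: ('a \<times> real) measure)"
      by (rule smooth_borel[OF smooth_heat_mollifier[OF \<open>h > 0\<close>]])
  qed (use g w(1) modulus \<open>h > 0\<close> in \<open>auto simp: heat_mollifier_nonneg nn_integral_heat_mollifier\<close>)
  also have "\<dots> \<le> 2 * (\<integral>\<^sup>+z. ennreal \<bar>f z - g z\<bar> \<partial>lborel) + (ennreal w + ennreal (2 * C) * ennreal (h * A)) * ennreal m"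
    unfolding m(1) A_def using \<open>r > 0\<close> \<open>h > 0\<close>
    by (intro add_left_mono mult_right_mono mult_left_mono heat_mollifier_tail) auto
  also have "(ennreal w + ennreal (2 * C) * ennreal (h * A)) * ennreal m = ennreal (w * m + 2 * C * (h * A) * m)"
    using w(1) \<open>C \<ge> 0\<close> \<open>h > 0\<close> \<open>A > 0\<close> m(2)
    by (simp add: ennreal_plus[symmetric] ennreal_mult[symmetric] distrib_right del: ennreal_plus)
  also have "\<dots> \<le> ennreal (e / 3)"
    using w(2) h2 by (intro ennreal_leI) simp
  also have "2 * (\<integral>\<^sup>+z. ennreal \<bar>f z - g z\<bar> \<partial>lborel) + ennreal (e / 3) < ennreal e"
  proof -
    have "2 * (\<integral>\<^sup>+z. ennreal \<bar>f z - g z\<bar> \<partial>lborel) \<le> 2 * ennreal (e / 6)"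
      using g(3) by (intro mult_left_mono) auto
    also have "\<dots> = ennreal (e / 3)"
      using \<open>e > 0\<close> ennreal_mult[of 2 "e / 6"] by simp
    finally have "2 * (\<integral>\<^sup>+z. ennreal \<bar>f z - g z\<bar> \<partial>lborel) + ennreal (e / 3) \<le> ennreal (e / 3) + ennreal (e / 3)"
      by (rule add_right_mono)
    also have "\<dots> < ennreal e"
      using \<open>e > 0\<close> by (simp add: ennreal_plus[symmetric] ennreal_less_iff del: ennreal_plus)
    finally show ?thesis .
  qed
  finally show ?thesis
    using \<open>h > 0\<close> by (intro exI[of _ h]) (simp add: add_left_mono)
qed

lemma nn_integral_upper_tail_small:
  fixes u :: "'b::euclidean_space \<Rightarrow> real"
  assumes [measurable]: "u \<in> borel_measurable borel" and fin: "(\<integral>\<^sup>+z. ennreal (u z) \<partial>lborel) < \<infinity>" and "e > 0"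
  shows "\<exists>N\<ge>0. (\<integral>\<^sup>+z. ennreal (u z) * indicator {z. u z > N} z \<partial>lborel) < ennreal e"
proof -
  have "(\<lambda>n. \<integral>\<^sup>+z. ennreal (u z) * indicator {z. u z > real n} z \<partial>lborel) \<longlonglongrightarrow> (\<integral>\<^sup>+z. 0 \<partial>(lborel :: 'b measure))"
  proof (rule nn_integral_dominated_convergence[where w = "\<lambda>z. ennreal (u z)"])
    show "AE z in lborel. (\<lambda>n. ennreal (u z) * indicator {z. u z > real n} z) \<longlonglongrightarrow> 0"
    proof (intro always_eventually allI)
      fix z
      obtain n0 where "u z \<le> real n0" using real_arch_simple by blast
      then have "eventually (\<lambda>n. ennreal (u z) * indicator {z. u z > real n} z = 0) sequentially"
        by (intro eventually_sequentiallyI[of n0]) auto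
      then show "(\<lambda>n. ennreal (u z) * indicator {z. u z > real n} z) \<longlonglongrightarrow> 0"
        by (rule tendsto_eventually)
    qed
  qed (use fin in \<open>auto split: split_indicator\<close>)
  then have "eventually (\<lambda>n. (\<integral>\<^sup>+z. ennreal (u z) * indicator {z. u z > real n} z \<partial>lborel) < ennreal e) sequentially"
    using \<open>e > 0\<close> by (intro order_tendstoD(2)) auto
  then obtain n where "(\<integral>\<^sup>+z. ennreal (u z) * indicator {z. u z > real n} z \<partial>lborel) < ennreal e"
    using eventually_happens'[OF sequentially_bot] by blast
  then show ?thesis by (intro exI[of _ "real n"]) auto
qed

text \<open>The mollification error is bounded by \<open>2 C\<close>, so on the set where the weight \<open>u\<close> exceeds a large \<open>N\<close>
its contribution is a small tail of the integral of \<open>u\<close>; elsewhere the unweighted estimate applies.\<close>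

lemma heat_mollification_weighted_error:
  fixes f u :: "'a::euclidean_space \<times> real \<Rightarrow> real"
  assumes f[measurable]: "f \<in> borel_measurable borel" and C: "\<And>z. \<bar>f z\<bar> \<le> C"
    and R: "\<And>z. z \<notin> cball 0 R \<Longrightarrow> f z = 0"
    and u[measurable]: "u \<in> borel_measurable borel" and fin: "(\<integral>\<^sup>+z. ennreal (u z) \<partial>lborel) < \<infinity>"
    and S: "\<And>z. z \<notin> cball 0 S \<Longrightarrow> u z = 0" and "e > 0"
  shows "\<exists>h>0. (\<integral>\<^sup>+z. ennreal (u z) * (\<integral>\<^sup>+y. ennreal (heat_mollifier h (y - z) * \<bar>f y - f z\<bar>) \<partial>lborel) \<partial>lborel)
    < ennreal e"
proof -
  have "C \<ge> 0" using C[of 0] by linarith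
  have "e / (2 * (2 * C + 1)) > 0" using \<open>e > 0\<close> \<open>C \<ge> 0\<close> by simp
  from nn_integral_upper_tail_small[OF u fin this] obtain N where N: "N \<ge> 0"
    "(\<integral>\<^sup>+z. ennreal (u z) * indicator {z. u z > N} z \<partial>lborel) < ennreal (e / (2 * (2 * C + 1)))" by blast
  have "e / (2 * (N + 1)) > 0" using \<open>e > 0\<close> N by simp
  from heat_mollification_L1_error[where R = R and S = S, OF f C R this] obtain h where "h > 0" and
    h: "(\<integral>\<^sup>+z\<in>cball 0 S. (\<integral>\<^sup>+y. ennreal (heat_mollifier h (y - z) * \<bar>f y - f z\<bar>) \<partial>lborel) \<partial>lborel)
    < ennreal (e / (2 * (N + 1)))" by blast
  have [measurable]: "heat_mollifier h \<in> borel_measurable (borel :: ('a \<times> real) measure)"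
    by (rule smooth_borel[OF smooth_heat_mollifier[OF \<open>h > 0\<close>]])
  have [measurable]: "cball (0 :: 'a \<times> real) S \<in> sets borel" by simp
  define D where "D z = (\<integral>\<^sup>+y. ennreal (heat_mollifier h (y - z) * \<bar>f y - f z\<bar>) \<partial>lborel)" for z
  have [measurable]: "D \<in> borel_measurable borel"
    unfolding D_def by measurable
  have D: "D z \<le> ennreal (2 * C)" for z
  proof -
    have "D z \<le> (\<integral>\<^sup>+y. ennreal (heat_mollifier h (y - z)) * ennreal (2 * C) \<partial>lborel)"
      unfolding D_def
    proof (rule nn_integral_mono)
      fix y
      have "\<bar>f y - f z\<bar> \<le> 2 * C" using C[of y] C[of z] by linarith
      then have "heat_mollifier h (y - z) * \<bar>f y - f z\<bar> \<le> heat_mollifier h (y - z) * (2 * C)"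
        using \<open>h > 0\<close> by (intro mult_left_mono) (auto simp: heat_mollifier_nonneg)
      then show "ennreal (heat_mollifier h (y - z) * \<bar>f y - f z\<bar>) \<le> ennreal (heat_mollifier h (y - z)) * ennreal (2 * C)"
        using \<open>h > 0\<close> \<open>C \<ge> 0\<close> by (subst ennreal_mult[symmetric]) (auto simp: heat_mollifier_nonneg intro!: ennreal_leI)
    qed
    also have "\<dots> = ennreal (2 * C)"
      using nn_integral_lborel_shift(1)[of "\<lambda>y. ennreal (heat_mollifier h y)" z]
        nn_integral_heat_mollifier[OF \<open>h > 0\<close>, where 'a = 'a]
      by (simp add: nn_integral_multc)
    finally show ?thesis .
  qed
  have "(\<integral>\<^sup>+z. ennreal (u z) * D z \<partial>lborel)
    \<le> (\<integral>\<^sup>+z. ennreal N * (D z * indicator (cball 0 S) z) + ennreal (2 * C) * (ennreal (u z) * indicator {z. u z > N} z) \<partial>lborel)"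
  proof (rule nn_integral_mono)
    fix z
    consider "z \<notin> cball 0 S" | "z \<in> cball 0 S" "u z > N" | "z \<in> cball 0 S" "u z \<le> N" by linarith
    then show "ennreal (u z) * D z \<le>
      ennreal N * (D z * indicator (cball 0 S) z) + ennreal (2 * C) * (ennreal (u z) * indicator {z. u z > N} z)"
    proof cases
      case 2
      have "ennreal (u z) * D z \<le> ennreal (u z) * ennreal (2 * C)"
        by (intro mult_left_mono D) simp
      also have "\<dots> = ennreal (2 * C) * (ennreal (u z) * indicator {z. u z > N} z)"
        using 2 by (simp add: mult.commute)
      finally show ?thesis by (rule order_trans) simp
    next
      case 3
      have "ennreal (u z) * D z \<le> ennreal N * (D z * indicator (cball 0 S) z)"
        using 3 by (auto intro!: mult_right_mono ennreal_leI)
      then show ?thesis by (rule order_trans) simp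
    qed (simp add: S)
  qed
  also have "\<dots> = ennreal N * (\<integral>\<^sup>+z. D z * indicator (cball 0 S) z \<partial>lborel)
      + ennreal (2 * C) * (\<integral>\<^sup>+z. ennreal (u z) * indicator {z. u z > N} z \<partial>lborel)"
    by (simp add: nn_integral_add nn_integral_cmult)
  also have "\<dots> \<le> ennreal N * ennreal (e / (2 * (N + 1))) + ennreal (2 * C) * ennreal (e / (2 * (2 * C + 1)))"
    using h N(2) unfolding D_def by (intro add_mono mult_left_mono) auto
  also have "\<dots> = ennreal (N * (e / (2 * (N + 1))) + 2 * C * (e / (2 * (2 * C + 1))))"
  proof -
    have "ennreal N * ennreal a + ennreal (2 * C) * ennreal b = ennreal (N * a + 2 * C * b)"
      if "a \<ge> 0" "b \<ge> 0" for a b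
      using that N(1) \<open>C \<ge> 0\<close> by (simp add: ennreal_plus ennreal_mult)
    then show ?thesis using N(1) \<open>C \<ge> 0\<close> \<open>e > 0\<close> by simp
  qed
  also have "\<dots> < ennreal e"
  proof (rule ennreal_lessI)
    have "N * (e / (2 * (N + 1))) < e / 2"
      using N(1) \<open>e > 0\<close> by (simp add: field_simps)
    moreover have "2 * C * (e / (2 * (2 * C + 1))) < e / 2"
      using \<open>C \<ge> 0\<close> \<open>e > 0\<close> by (simp add: field_simps)
    ultimately show "N * (e / (2 * (N + 1))) + 2 * C * (e / (2 * (2 * C + 1))) < e" by linarith
  qed fact
  finally show ?thesis
    using \<open>h > 0\<close> unfolding D_def by blast
qed

text \<open>As the mollifier has mass one, \<open>f z\<close> can be moved under the integral.\<close>

lemma heat_mollification_pointwise_error: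
  fixes f :: "'a::euclidean_space \<times> real \<Rightarrow> real"
  assumes "h > 0" "integrable lborel f" and R: "\<And>z. z \<notin> cball 0 R \<Longrightarrow> f z = 0"
  shows "ennreal \<bar>(LINT y|lborel. heat_mollifier h (y - z) * f y) - f z\<bar>
    \<le> (\<integral>\<^sup>+y. ennreal (heat_mollifier h (y - z) * \<bar>f y - f z\<bar>) \<partial>lborel)"
proof -
  have [measurable]: "heat_mollifier h \<in> borel_measurable (borel :: ('a \<times> real) measure)"
    by (rule smooth_borel[OF smooth_heat_mollifier[OF \<open>h > 0\<close>]])
  have "(\<integral>\<^sup>+y. ennreal (heat_mollifier h (y - z)) \<partial>lborel) = ennreal 1"
    using nn_integral_lborel_shift(1)[of "\<lambda>y. ennreal (heat_mollifier h y)" z]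
      nn_integral_heat_mollifier[OF \<open>h > 0\<close>, where 'a = 'a] by simp
  then have "has_bochner_integral lborel (\<lambda>y. heat_mollifier h (y - z)) 1"
    by (intro has_bochner_integral_nn_integral) (auto simp: heat_mollifier_nonneg \<open>h > 0\<close>)
  then have 1: "integrable lborel (\<lambda>y. heat_mollifier h (y - z))" "(LINT y|lborel. heat_mollifier h (y - z)) = 1"
    by (auto simp: has_bochner_integral_iff)
  have 2: "integrable lborel (\<lambda>y. heat_mollifier h (y - z) * f y)"
    by (rule integrable_convolution[OF smooth_heat_mollifier[OF \<open>h > 0\<close>] assms(2) R])
  have "(LINT y|lborel. heat_mollifier h (y - z) * f y) - f z
    = (LINT y|lborel. heat_mollifier h (y - z) * (f y - f z))"
    using 1 2 by (simp add: right_diff_distrib)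
  also have "ennreal \<bar>\<dots>\<bar> \<le> (\<integral>\<^sup>+y. ennreal (norm (heat_mollifier h (y - z) * (f y - f z))) \<partial>lborel)"
    using integral_norm_bound_ennreal[of lborel "\<lambda>y. heat_mollifier h (y - z) * (f y - f z)"] 1 2
    by (simp add: right_diff_distrib)
  also have "\<dots> = (\<integral>\<^sup>+y. ennreal (heat_mollifier h (y - z) * \<bar>f y - f z\<bar>) \<partial>lborel)"
    by (simp add: abs_mult heat_mollifier_nonneg \<open>h > 0\<close>)
  finally show ?thesis .
qed

section \<open>The weak formulation\<close>

lemma partials_eq_0_outside:
  assumes "closed K" "\<And>z. z \<notin> K \<Longrightarrow> \<phi> z = 0" "z \<notin> K"
  shows "partials vs \<phi> z = 0"
  using assms(3)
proof (induction vs arbitrary: z)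
  case (Cons v vs)
  have "((\<lambda>z. 0) has_derivative (\<lambda>v. 0)) (at z)" by simp
  then have "(partials vs \<phi> has_derivative (\<lambda>v. 0)) (at z)"
    by (rule has_derivative_transform_within_open[where s = "- K"])
      (use Cons assms(1) in \<open>auto simp: open_Compl\<close>)
  then have "frechet_derivative (partials vs \<phi>) (at z) = (\<lambda>v. 0)"
    by (rule frechet_derivative_at[symmetric])
  then show ?case by (simp add: partials.simps)
qed (use assms in auto)

lemma test_functionsI:
  assumes "smooth \<phi>" "compact K" "K \<subseteq> \<Omega>" "\<And>z. z \<notin> K \<Longrightarrow> \<phi> z = 0"
  shows "\<phi> \<in> test_functions \<Omega>"
proof -
  have *: "closure {z. \<phi> z \<noteq> 0} \<subseteq> K"
    using assms(2,4) by (intro closure_minimal compact_imp_closed) auto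
  then have "compact (closure {z. \<phi> z \<noteq> 0})"
    using assms(2) by (metis closed_closure compact_Int_closed inf.absorb_iff2)
  with * assms show ?thesis
    by (auto simp: test_functions_def smooth_def)
qed

lemma Lp_loc_1_integrable_on_compact:
  fixes f :: "'b::euclidean_space \<Rightarrow> real"
  assumes "f \<in> Lp_loc 1 \<Omega>" "compact K" "K \<subseteq> \<Omega>"
  shows "integrable lebesgue (\<lambda>z. indicator K z * f z)"
proof -
  have K: "K \<in> sets lebesgue" using assms(2) by (simp add: compact_imp_closed)
  have "f \<in> borel_measurable (lebesgue_on \<Omega>)" using assms(1) by (simp add: Lp_loc_def)
  then have "f \<in> borel_measurable (lebesgue_on K)"
    using assms(3) by (rule measurable_restrict_mono)
  moreover have "integrable (lebesgue_on K) (\<lambda>z. \<bar>f z\<bar> powr 1)"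
    using assms by (auto simp: Lp_loc_def)
  then have "integrable (lebesgue_on K) (\<lambda>z. norm (f z))" by simp
  ultimately have "integrable (lebesgue_on K) f"
    using integrable_norm_iff by blast
  then show ?thesis
    using K by (simp add: integrable_restrict_space)
qed

lemma integrable_Lp_loc_1_mult:
  fixes f \<psi> :: "'b::euclidean_space \<Rightarrow> real"
  assumes "f \<in> Lp_loc 1 \<Omega>" "compact K" "K \<subseteq> \<Omega>"
    and \<psi>: "continuous_on UNIV \<psi>" "\<And>z. z \<notin> K \<Longrightarrow> \<psi> z = 0"
  shows "integrable lebesgue (\<lambda>z. f z * \<psi> z)"
proof -
  have f: "integrable lebesgue (\<lambda>z. indicator K z * f z)"
    by (rule Lp_loc_1_integrable_on_compact[OF assms(1-3)])
  have "bounded (\<psi> ` K)"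
    using \<psi>(1) assms(2) by (intro compact_imp_bounded compact_continuous_image) (auto intro: continuous_on_subset)
  then obtain M where M: "\<And>z. z \<in> K \<Longrightarrow> \<bar>\<psi> z\<bar> \<le> M"
    unfolding bounded_iff by (metis imageI real_norm_def)
  have "\<psi> \<in> borel_measurable borel"
    using \<psi>(1) by (rule borel_measurable_continuous_onI)
  then have "\<psi> \<in> borel_measurable lebesgue"
    by (simp add: measurable_completion)
  then have "integrable lebesgue (\<lambda>z. (indicator K z * f z) * \<psi> z)"
  proof (intro Bochner_Integration.integrable_bound[OF integrable_mult_right[OF f, of M]] always_eventually allI)
    fix z
    show "norm (indicator K z * f z * \<psi> z) \<le> norm (M * (indicator K z * f z))"
    proof (cases "z \<in> K")
      case True
      then have "\<bar>\<psi> z\<bar> \<le> \<bar>M\<bar>" using M[OF True] by simp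
      then have "\<bar>f z\<bar> * \<bar>\<psi> z\<bar> \<le> \<bar>f z\<bar> * \<bar>M\<bar>" by (rule mult_left_mono) simp
      then show ?thesis using True by (simp add: abs_mult mult.commute)
    qed simp
  qed (use f in auto)
  also have "(\<lambda>z. (indicator K z * f z) * \<psi> z) = (\<lambda>z. f z * \<psi> z)"
    using \<psi>(2) by (auto simp: fun_eq_iff indicator_def)
  finally show ?thesis .
qed

lemma lebesgue_on_integral_drop:
  fixes f :: "'b::euclidean_space \<Rightarrow> real"
  assumes "\<Omega> \<in> sets lebesgue" "\<And>z. z \<notin> \<Omega> \<Longrightarrow> f z = 0"
  shows "(LINT z|lebesgue_on \<Omega>. f z) = (LINT z|lebesgue. f z)"
proof -
  have "(LINT z|lebesgue_on \<Omega>. f z) = (LINT z|lebesgue. indicator \<Omega> z *\<^sub>R f z)"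
    using assms(1) by (intro integral_restrict_space) simp
  also have "(\<lambda>z. indicator \<Omega> z *\<^sub>R f z) = f"
    using assms(2) by (auto simp: fun_eq_iff indicator_def)
  finally show ?thesis by simp
qed

text \<open>The weak derivatives of \<open>u\<close> are moved onto \<open>\<phi>\<close>, and the equation, valid almost everywhere, identifies
\<open>\<partial>\<^sub>t u - \<Delta> u\<close> with \<open>- V u\<close>. As \<open>\<phi>\<close> has compact support, all integrals can be taken over the whole
space.\<close>

lemma solution_weak_formulation:
  fixes V u :: "'a::euclidean_space \<times> real \<Rightarrow> real"
  assumes sol: "solution V T u" and V: "V \<in> Linf_loc (UNIV \<times> {0<..})"
    and \<phi>: "smooth \<phi>" "\<And>z. z \<notin> K \<Longrightarrow> \<phi> z = 0" and K: "compact K" "K \<subseteq> UNIV \<times> {0<..<T}"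
  defines "L \<equiv> \<lambda>z. partials [(0, 1)] \<phi> z + (\<Sum>i\<in>Basis. partials [(i, 0), (i, 0)] \<phi> z)"
  shows "integrable lebesgue (\<lambda>z. u z * L z)"
    and "integrable lebesgue (\<lambda>z. V z * u z * \<phi> z)"
    and "(LINT z|lebesgue. u z * L z) = (LINT z|lebesgue. V z * u z * \<phi> z)"
proof -
  define \<Omega> where "\<Omega> = (UNIV :: 'a set) \<times> {0<..<T}"
  obtain ut D where ut: "has_weak_deriv \<Omega> [(0, 1)] u ut"
    and D: "\<And>i. i \<in> Basis \<Longrightarrow> has_weak_deriv \<Omega> [(i, 0), (i, 0)] u (D i)"
    and eq: "AE z in lebesgue_on (Q T). ut z - (\<Sum>i\<in>Basis. D i z) + V z * u z = 0"
    using sol unfolding solution_def \<Omega>_def by blast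
  have K\<Omega>: "K \<subseteq> \<Omega>" using K(2) by (simp add: \<Omega>_def)
  have "open \<Omega>" by (simp add: \<Omega>_def open_Times)
  then have [simp]: "\<Omega> \<in> sets lebesgue" by simp
  have "closed K" using K(1) by (rule compact_imp_closed)
  have zero: "partials vs \<phi> z = 0" if "z \<notin> K" for vs z
    using partials_eq_0_outside[OF \<open>closed K\<close> _ that] \<phi>(2) by blast
  have int: "integrable lebesgue (\<lambda>z. f z * partials vs \<phi> z)" if "f \<in> Lp_loc 1 \<Omega>" for f vs
    by (rule integrable_Lp_loc_1_mult[OF that K(1) K\<Omega>])
      (auto intro: smooth_imp_continuous smooth_partials \<phi>(1) zero)
  have drop: "(LINT z|lebesgue_on \<Omega>. f z * partials vs \<phi> z) = (LINT z|lebesgue. f z * partials vs \<phi> z)" for f vs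
    by (rule lebesgue_on_integral_drop) (use zero K\<Omega> in auto)
  have "\<phi> \<in> test_functions \<Omega>"
    by (rule test_functionsI[OF \<phi>(1) K(1) K\<Omega> \<phi>(2)])
  then have weak: "(LINT z|lebesgue. u z * partials vs \<phi> z) = (-1) ^ length vs * (LINT z|lebesgue. g z * \<phi> z)"
    if "has_weak_deriv \<Omega> vs u g" for vs g
    using that drop[of u vs] drop[of g "[]"] unfolding has_weak_deriv_def by simp
  have mem: "u \<in> Lp_loc 1 \<Omega>" "ut \<in> Lp_loc 1 \<Omega>" "\<And>i. i \<in> Basis \<Longrightarrow> D i \<in> Lp_loc 1 \<Omega>"
    using ut D unfolding has_weak_deriv_def by blast+
  have int0: "integrable lebesgue (\<lambda>z. f z * \<phi> z)" if "f \<in> Lp_loc 1 \<Omega>" for f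
    using int[OF that, of "[]"] by simp
  have uL: "(\<lambda>z. u z * L z) = (\<lambda>z. u z * partials [(0, 1)] \<phi> z + (\<Sum>i\<in>Basis. u z * partials [(i, 0), (i, 0)] \<phi> z))"
    by (simp add: fun_eq_iff L_def distrib_left sum_distrib_left)
  show "integrable lebesgue (\<lambda>z. u z * L z)"
    unfolding uL by (intro Bochner_Integration.integrable_add Bochner_Integration.integrable_sum int mem)
  define F where "F z = (\<Sum>i\<in>Basis. D i z * \<phi> z) - ut z * \<phi> z" for z
  have F: "integrable lebesgue F"
    unfolding F_def by (intro Bochner_Integration.integrable_diff Bochner_Integration.integrable_sum int0 mem)
  have "(LINT z|lebesgue. u z * L z) = (LINT z|lebesgue. u z * partials [(0, 1)] \<phi> z)
      + (\<Sum>i\<in>Basis. LINT z|lebesgue. u z * partials [(i, 0), (i, 0)] \<phi> z)"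
    unfolding uL using int mem by (simp add: Bochner_Integration.integral_add Bochner_Integration.integral_sum)
  also have "\<dots> = - (LINT z|lebesgue. ut z * \<phi> z) + (\<Sum>i\<in>Basis. LINT z|lebesgue. D i z * \<phi> z)"
    using weak[OF ut] weak[OF D] by simp
  also have "\<dots> = (LINT z|lebesgue. F z)"
    unfolding F_def using int0 mem by (simp add: Bochner_Integration.integral_diff Bochner_Integration.integral_sum)
  finally have LF: "(LINT z|lebesgue. u z * L z) = (LINT z|lebesgue. F z)" .
  have "Q T \<in> sets (lebesgue :: ('a \<times> real) measure)"
    unfolding Q_def by (intro sets_completionI_sets) (simp add: borel_Times)
  then have "AE z in lebesgue. z \<in> Q T \<longrightarrow> ut z - (\<Sum>i\<in>Basis. D i z) + V z * u z = 0"
    using eq by (simp add: AE_restrict_space_iff)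
  then have AE: "AE z in lebesgue. F z = V z * u z * \<phi> z"
  proof eventually_elim
    case (elim z)
    show ?case
    proof (cases "z \<in> K")
      case True
      then have "z \<in> Q T" using K(2) by (auto simp: Q_def)
      with elim have "V z * u z = (\<Sum>i\<in>Basis. D i z) - ut z" by simp
      then show ?thesis by (simp add: F_def sum_distrib_right left_diff_distrib)
    qed (simp add: F_def \<phi>(2))
  qed
  define P where "P = (UNIV :: 'a set) \<times> {0::real<..}"
  have "open P" by (simp add: P_def open_Times)
  then have "P \<in> sets lebesgue" by simp
  moreover have "V \<in> borel_measurable (lebesgue_on P)" using V by (simp add: Linf_loc_def P_def)
  ultimately have "(\<lambda>z. indicator P z *\<^sub>R V z) \<in> borel_measurable lebesgue"
    by (simp add: borel_measurable_restrict_space_iff)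
  then have "(\<lambda>z. (indicator P z *\<^sub>R V z) * (u z * \<phi> z)) \<in> borel_measurable lebesgue"
    using borel_measurable_integrable[OF int0[OF mem(1)]] by (rule borel_measurable_times)
  also have "(\<lambda>z. (indicator P z *\<^sub>R V z) * (u z * \<phi> z)) = (\<lambda>z. V z * u z * \<phi> z)"
  proof
    fix z show "(indicator P z *\<^sub>R V z) * (u z * \<phi> z) = V z * u z * \<phi> z"
    proof (cases "z \<in> K")
      case True
      then have "z \<in> P" using K(2) by (auto simp: P_def)
      then show ?thesis by simp
    qed (simp add: \<phi>(2))
  qed
  finally have meas: "(\<lambda>z. V z * u z * \<phi> z) \<in> borel_measurable lebesgue" .
  show "integrable lebesgue (\<lambda>z. V z * u z * \<phi> z)"
    using F integrable_cong_AE[OF _ meas AE] by auto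
  show "(LINT z|lebesgue. u z * L z) = (LINT z|lebesgue. V z * u z * \<phi> z)"
    unfolding LF using F by (intro integral_cong_AE meas AE) auto
qed

section \<open>The backward heat operator\<close>

text \<open>The operator \<open>\<partial>\<^sub>t + \<Delta>\<close>, the formal adjoint of \<open>- \<partial>\<^sub>t + \<Delta>\<close>.\<close>

definition backward_heat :: "('a::euclidean_space \<times> real \<Rightarrow> real) \<Rightarrow> 'a \<times> real \<Rightarrow> real" where
  "backward_heat \<phi> z = partials [(0, 1)] \<phi> z + (\<Sum>i\<in>Basis. partials [(i, 0), (i, 0)] \<phi> z)"

lemma backward_heat_diff:
  assumes "smooth f" "smooth g"
  shows "backward_heat (\<lambda>z. f z - g z) z = backward_heat f z - backward_heat g z"
proof -
  have "partials vs (\<lambda>z. f z - g z) z = partials vs f z - partials vs g z" for vs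
    using partials_add[OF assms(1) smooth_minus[OF assms(2)], of vs] partials_mult_const[OF assms(2), of vs "-1"]
    by (cases z) (simp add: fun_eq_iff)
  then show ?thesis
    by (simp add: backward_heat_def sum_subtractf)
qed

text \<open>In \<open>z\<close> the kernel \<open>heat_smoothed h (y - z)\<close> is reflected, so that the backward operator in \<open>z\<close> becomes
minus the forward heat operator on the kernel.\<close>

lemma backward_heat_convolution:
  fixes f :: "'a::euclidean_space \<times> real \<Rightarrow> real"
  assumes "h > 0" and f: "integrable lborel f" "\<And>y. y \<notin> cball 0 R \<Longrightarrow> f y = 0"
  shows "backward_heat (\<lambda>z. LINT y|lborel. heat_smoothed h (y - z) * f y) z
    = - (LINT y|lborel. heat_mollifier h (y - z) * f y)"
proof -
  let ?G = "heat_smoothed h :: 'a \<times> real \<Rightarrow> real"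
  have G: "smooth ?G" by (rule smooth_heat_smoothed[OF assms(1)])
  have int: "integrable lborel (\<lambda>y. partials vs ?G (y - z) * f y)" for vs
    by (rule integrable_convolution[OF smooth_partials[OF G] f])
  have 1: "partials [v] (\<lambda>z. LINT y|lborel. k (y - z) * f y) = (\<lambda>z. LINT y|lborel. (- partials [v] k (y - z)) * f y)"
    if "smooth k" for k v
  proof -
    have "partials [v] (\<lambda>z. LINT y|lborel. k (y - z) * f y) = (\<lambda>z. - (LINT y|lborel. partials [v] k (y - z) * f y))"
      by (rule partials_convolution[OF that f])
    then show ?thesis by simp
  qed
  have 2: "partials [v, v] (\<lambda>z. LINT y|lborel. ?G (y - z) * f y) z = (LINT y|lborel. partials [v, v] ?G (y - z) * f y)" for v
  proof -
    have "partials [v, v] (\<lambda>z. LINT y|lborel. ?G (y - z) * f y)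
      = partials [v] (\<lambda>z. LINT y|lborel. (- partials [v] ?G (y - z)) * f y)"
      by (simp only: partials_Cons[of v "[v]"] 1[OF G])
    also have "\<dots> = (\<lambda>z. LINT y|lborel. (- partials [v] (\<lambda>y. - partials [v] ?G y) (y - z)) * f y)"
      by (rule 1[OF smooth_minus[OF smooth_partials[OF G]]])
    also have "partials [v] (\<lambda>y. - partials [v] ?G y) = (\<lambda>y. - partials [v, v] ?G y)"
      using partials_mult_const[OF smooth_partials[OF G, of "[v]"], of "[v]" "-1"]
      by (simp add: partials_Cons[of v "[v]"])
    finally show ?thesis by simp
  qed
  have "backward_heat (\<lambda>z. LINT y|lborel. ?G (y - z) * f y) z
    = (LINT y|lborel. (- partials [(0, 1)] ?G (y - z)) * f y)
      + (\<Sum>i\<in>Basis. LINT y|lborel. partials [(i, 0), (i, 0)] ?G (y - z) * f y)"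
    by (simp add: backward_heat_def 2 1[OF G])
  also have "\<dots> = (LINT y|lborel. - (partials [(0, 1)] ?G (y - z) * f y)
      + (\<Sum>i\<in>Basis. partials [(i, 0), (i, 0)] ?G (y - z) * f y))"
    using int by (simp add: Bochner_Integration.integral_add Bochner_Integration.integral_sum)
  also have "\<dots> = (LINT y|lborel. - (heat_mollifier h (y - z) * f y))"
  proof (rule Bochner_Integration.integral_cong[OF refl])
    fix y
    have "- (partials [(0, 1)] ?G (y - z) * f y) + (\<Sum>i\<in>Basis. partials [(i, 0), (i, 0)] ?G (y - z) * f y)
      = - ((partials [(0, 1)] ?G (y - z) - (\<Sum>i\<in>Basis. partials [(i, 0), (i, 0)] ?G (y - z))) * f y)"
      by (simp add: left_diff_distrib sum_distrib_right)
    then show "- (partials [(0, 1)] ?G (y - z) * f y) + (\<Sum>i\<in>Basis. partials [(i, 0), (i, 0)] ?G (y - z) * f y)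
      = - (heat_mollifier h (y - z) * f y)"
      by (simp only: heat_equation_heat_smoothed[OF assms(1)])
  qed
  finally show ?thesis by simp
qed

lemma partials_flat_exp:
  assumes "smooth p"
  shows "partials [v] (\<lambda>z. flat_exp 1 a (p z)) =
    (\<lambda>z. (- a * flat_exp 1 (a + 1) (p z) + flat_exp 1 (a + 2) (p z)) * partials [v] p z)"
proof -
  have "((\<lambda>z. flat_exp 1 a (p z)) has_derivative
      (\<lambda>v. (- a * flat_exp 1 (a + 1) (p z) + flat_exp 1 (a + 2) (p z)) * partials [v] p z)) (at z)" for z
    using has_derivative_compose[OF smooth_has_derivative[OF assms, of z]
        has_field_derivative_imp_has_derivative[OF flat_exp_has_derivative[of 1 a "p z"]]]
    by simp
  from partials_eqI[OF this] show ?thesis by simp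
qed

lemma flat_exp_2_bound: "flat_exp 1 2 x \<le> 2"
proof (cases "x > 0")
  case True
  define y where "y = 1 / x"
  have "y > 0" using True by (simp add: y_def)
  then have "y\<^sup>2 / 2 \<le> exp y"
    using exp_lower_Taylor_quadratic[of y] by linarith
  then have "y\<^sup>2 * exp (- y) \<le> 2"
    by (simp add: exp_minus field_simps)
  moreover have "flat_exp 1 2 x = y\<^sup>2 * exp (- y)"
    using True by (simp add: flat_exp_def y_def powr_minus powr_numeral power_one_over inverse_eq_divide)
  ultimately show ?thesis by simp
qed (simp add: flat_exp_def)

lemma flat_exp_1_bound: "flat_exp 1 1 x \<le> 1"
proof (cases "x > 0")
  case True
  define y where "y = 1 / x"
  have "y \<le> exp y" using exp_ge_add_one_self[of y] by linarith
  then have "y * exp (- y) \<le> 1"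
    by (simp add: exp_minus field_simps)
  moreover have "flat_exp 1 1 x = y * exp (- y)"
    using True by (simp add: flat_exp_def y_def powr_minus inverse_eq_divide)
  ultimately show ?thesis by simp
qed (simp add: flat_exp_def)

lemma flat_exp_0_bound: "flat_exp 1 0 x \<le> 1"
  by (simp add: flat_exp_def)

lemma flat_exp_0_mono: "x \<le> y \<Longrightarrow> flat_exp 1 0 x \<le> flat_exp 1 0 y"
  by (auto simp: flat_exp_def field_simps)

text \<open>With \<open>g = flat_exp 1 0\<close> one has \<open>g' = flat_exp 1 2\<close>; this is \<open>4 g \<le> g'\<close>, the inequality by which the
potential term of the equation is absorbed.\<close>

lemma flat_exp_2_ge:
  assumes "x \<le> 1 / 2"
  shows "4 * flat_exp 1 0 x \<le> flat_exp 1 2 x"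
proof (cases "x > 0")
  case True
  then have "x\<^sup>2 \<le> (1 / 2)\<^sup>2" using assms by (intro power_mono) auto
  then have "4 * x\<^sup>2 \<le> 1" by (simp add: power2_eq_square)
  then have "4 \<le> x powr (- 2)"
    using True by (simp add: powr_minus powr_numeral field_simps)
  then show ?thesis
    using True by (simp add: flat_exp_def)
qed (simp add: flat_exp_def)

text \<open>This is \<open>g'' \<ge> 0\<close> for \<open>g = flat_exp 1 0\<close>.\<close>

lemma flat_exp_convex:
  assumes "x \<le> 1 / 2"
  shows "2 * flat_exp 1 3 x \<le> flat_exp 1 4 x"
proof (cases "x > 0")
  case True
  then have "x powr (- 4) = x powr (- 3) * (1 / x)"
    using powr_add[of x "-3" "-1"] by (simp add: powr_minus inverse_eq_divide)
  moreover have "2 \<le> 1 / x" using True assms by (simp add: field_simps)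
  then have "x powr (- 3) * 2 \<le> x powr (- 3) * (1 / x)" by (intro mult_left_mono) auto
  ultimately have "2 * x powr (- 3) \<le> x powr (- 4)" by simp
  then have "2 * x powr (- 3) * exp (- 1 / x) \<le> x powr (- 4) * exp (- 1 / x)"
    by (intro mult_right_mono) auto
  then show ?thesis
    using True by (simp add: flat_exp_def)
qed (simp add: flat_exp_def)

text \<open>The difference of the two sides is \<open>g'' (p) \<bar>\<nabla> p\<bar>\<^sup>2\<close>, where \<open>g = flat_exp 1 0\<close> is convex on \<open>x \<le> 1 / 2\<close>.\<close>

lemma backward_heat_flat_exp:
  assumes p: "smooth p" and le: "p z \<le> 1 / 2"
  shows "flat_exp 1 2 (p z) * backward_heat p z \<le> backward_heat (\<lambda>z. flat_exp 1 0 (p z)) z"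
proof -
  have 1: "partials [v] (\<lambda>z. flat_exp 1 0 (p z)) = (\<lambda>z. flat_exp 1 2 (p z) * partials [v] p z)" for v
    using partials_flat_exp[OF p, of v 0] by simp
  have 2: "partials [v, v] (\<lambda>z. flat_exp 1 0 (p z)) z \<ge> flat_exp 1 2 (p z) * partials [v, v] p z" for v
  proof -
    have s: "smooth (\<lambda>z. flat_exp 1 2 (p z))" "smooth (partials [v] p)"
      by (intro smooth_flat_exp p, intro smooth_partials p)
    have "((\<lambda>z. flat_exp 1 2 (p z) * partials [v] p z) has_derivative
       (\<lambda>w. flat_exp 1 2 (p z) * partials [w] (partials [v] p) z + partials [w] (\<lambda>z. flat_exp 1 2 (p z)) z * partials [v] p z)) (at z)" for z
      by (rule has_derivative_mult[OF smooth_has_derivative[OF s(1)] smooth_has_derivative[OF s(2)]])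
    from partials_eqI[OF this, of v]
    have "partials [v, v] (\<lambda>z. flat_exp 1 0 (p z)) z
      = flat_exp 1 2 (p z) * partials [v, v] p z + partials [v] (\<lambda>z. flat_exp 1 2 (p z)) z * partials [v] p z"
      by (simp add: partials_Cons[of v "[v]"] 1)
    also have "partials [v] (\<lambda>z. flat_exp 1 2 (p z)) z * partials [v] p z
      = (flat_exp 1 4 (p z) - 2 * flat_exp 1 3 (p z)) * (partials [v] p z)\<^sup>2"
      using partials_flat_exp[OF p, of v 2] by (simp add: power2_eq_square)
    finally have "partials [v, v] (\<lambda>z. flat_exp 1 0 (p z)) z = flat_exp 1 2 (p z) * partials [v, v] p z
      + (flat_exp 1 4 (p z) - 2 * flat_exp 1 3 (p z)) * (partials [v] p z)\<^sup>2" .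
    moreover have "0 \<le> (flat_exp 1 4 (p z) - 2 * flat_exp 1 3 (p z)) * (partials [v] p z)\<^sup>2"
      using flat_exp_convex[OF le] by simp
    ultimately show ?thesis by linarith
  qed
  have "flat_exp 1 2 (p z) * backward_heat p z
    = flat_exp 1 2 (p z) * partials [(0, 1)] p z + (\<Sum>i\<in>Basis. flat_exp 1 2 (p z) * partials [(i, 0), (i, 0)] p z)"
    by (simp add: backward_heat_def distrib_left sum_distrib_left)
  also have "\<dots> \<le> backward_heat (\<lambda>z. flat_exp 1 0 (p z)) z"
    unfolding backward_heat_def by (simp add: 1 sum_mono 2)
  finally show ?thesis .
qed

text \<open>The quadratic part solves the backward heat equation. The term \<open>flat_exp 1 0 (2 - t / s)\<close> vanishes for
\<open>t \<ge> 2 s\<close>, decreases in \<open>t\<close> and is at least \<open>1 / e\<close> for \<open>t \<le> s\<close>. The last term vanishes for \<open>t \<le> T1\<close>;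
its exponent \<open>- 1\<close> gives it linear growth, needed to beat \<open>2 n t\<close> for all large \<open>t\<close>, while its
derivative stays bounded.\<close>

definition barrier :: "'a::euclidean_space \<Rightarrow> real \<Rightarrow> real \<Rightarrow> real \<Rightarrow> 'a \<times> real \<Rightarrow> real" where
  "barrier y0 s K T1 z = 3 / 8 - (fst z - y0) \<bullet> (fst z - y0) + 2 * real DIM('a) * snd z
     - 2 * flat_exp 1 0 (2 - snd z / s) - K * flat_exp 1 (- 1) (snd z - T1)"

lemma smooth_barrier: "smooth (barrier y0 s K T1 :: 'a::euclidean_space \<times> real \<Rightarrow> real)"
proof -
  have "smooth (\<lambda>z::'a \<times> real. 3 / 8 - (fst z \<bullet> fst z + ((-2) * (fst z \<bullet> y0) + y0 \<bullet> y0)) + 2 * real DIM('a) * snd z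
     - 2 * flat_exp 1 0 (2 - (1 / s) * snd z) - K * flat_exp 1 (- 1) (snd z - T1))"
    by (intro smooth_diff smooth_add smooth_mult smooth_const smooth_flat_exp smooth_norm_fst smooth_inner_fst smooth_snd)
  moreover have "(\<lambda>z::'a \<times> real. 3 / 8 - (fst z \<bullet> fst z + ((-2) * (fst z \<bullet> y0) + y0 \<bullet> y0)) + 2 * real DIM('a) * snd z
     - 2 * flat_exp 1 0 (2 - (1 / s) * snd z) - K * flat_exp 1 (- 1) (snd z - T1)) = barrier y0 s K T1"
    by (auto simp: fun_eq_iff barrier_def inner_diff_left inner_diff_right inner_commute)
  ultimately show ?thesis by simp
qed

lemma backward_heat_barrier:
  fixes z :: "'a::euclidean_space \<times> real"
  assumes "s > 0"
  shows "backward_heat (barrier y0 s K T1) z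
    = 2 / s * flat_exp 1 2 (2 - snd z / s) - K * (flat_exp 1 0 (snd z - T1) + flat_exp 1 1 (snd z - T1))"
proof -
  have F: "((\<lambda>z. flat_exp 1 a (q z)) has_derivative (\<lambda>v. (- a * flat_exp 1 (a + 1) (q z) + flat_exp 1 (a + 2) (q z)) * q' v)) (at z)"
    if "(q has_derivative q') (at z)" for q q' a and z :: "'a \<times> real"
    using has_derivative_compose[OF that has_field_derivative_imp_has_derivative[OF flat_exp_has_derivative[of 1 a "q z"]]]
    by simp
  have D: "(barrier y0 s K T1 has_derivative (\<lambda>v. - 2 * ((fst z - y0) \<bullet> fst v) + (2 * real DIM('a)
      + 2 / s * flat_exp 1 2 (2 - snd z / s) - K * (flat_exp 1 0 (snd z - T1) + flat_exp 1 1 (snd z - T1))) * snd v)) (at z)"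
    for z :: "'a \<times> real"
    unfolding barrier_def using assms
    by (auto intro!: derivative_eq_intros F simp: fun_eq_iff inner_commute algebra_simps)
  have 1: "partials [(i, 0)] (barrier y0 s K T1) = (\<lambda>z. - 2 * ((fst z - y0) \<bullet> i))" for i :: 'a
    using partials_eqI[OF D, of "(i, 0)"] by simp
  have 2: "partials [(i, 0), (i, 0)] (barrier y0 s K T1) z = - 2" if "i \<in> Basis" for i :: 'a
  proof -
    have "((\<lambda>z. - 2 * ((fst z - y0) \<bullet> i)) has_derivative (\<lambda>v. - 2 * (fst v \<bullet> i))) (at z)" for z :: "'a \<times> real"
      by (auto intro!: derivative_eq_intros)
    from partials_eqI[OF this, of "(i, 0)"] show ?thesis
      using that by (simp add: partials_Cons[of "(i, 0)" "[(i, 0)]"] 1)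
  qed
  have "partials [(0, 1)] (barrier y0 s K T1) z = 2 * real DIM('a)
      + 2 / s * flat_exp 1 2 (2 - snd z / s) - K * (flat_exp 1 0 (snd z - T1) + flat_exp 1 1 (snd z - T1))"
    using partials_eqI[OF D, of "(0, 1)"] by simp
  then show ?thesis
    by (simp add: backward_heat_def 2)
qed

text \<open>The constant \<open>K\<close> is chosen such that at \<open>t \<ge> T2\<close> the last term is at least
\<open>(2 n + 1 / (2 (T2 - T1))) (t - T1) \<ge> 2 n (t - T1) + 1 / 2\<close>, which bounds the other terms because
\<open>3 / 8 + 2 n T1 \<le> 1 / 2\<close>.\<close>

lemma barrier_nonpos:
  fixes z :: "'a::euclidean_space \<times> real"
  assumes "s > 0" "T1 < T2" "0 \<le> T1" "2 * real DIM('a) * T2 \<le> 1 / 8"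
    and K: "K = (2 * real DIM('a) + 1 / (2 * (T2 - T1))) * exp (1 / (T2 - T1))"
    and "barrier y0 s K T1 z > 0"
  shows "fst z \<in> ball y0 1" "s < snd z" "snd z < T2" "barrier y0 s K T1 z \<le> 1 / 2"
proof -
  let ?n = "real DIM('a)"
  define x t where "x = fst z" and "t = snd z"
  have "K \<ge> 0" unfolding K using assms(2) by simp
  have le: "barrier y0 s K T1 z \<le> 3 / 8 - (norm (x - y0))\<^sup>2 + 2 * ?n * t - 2 * flat_exp 1 0 (2 - t / s)"
    "barrier y0 s K T1 z \<le> 3 / 8 + 2 * ?n * t - K * flat_exp 1 (- 1) (t - T1)"
  proof -
    have "0 \<le> K * flat_exp 1 (- 1) (t - T1)" "0 \<le> flat_exp 1 0 (2 - t / s)" "0 \<le> (x - y0) \<bullet> (x - y0)"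
      using \<open>K \<ge> 0\<close> by (simp_all add: flat_exp_nonneg)
    then show "barrier y0 s K T1 z \<le> 3 / 8 - (norm (x - y0))\<^sup>2 + 2 * ?n * t - 2 * flat_exp 1 0 (2 - t / s)"
      "barrier y0 s K T1 z \<le> 3 / 8 + 2 * ?n * t - K * flat_exp 1 (- 1) (t - T1)"
      unfolding barrier_def power2_norm_eq_inner x_def[symmetric] t_def[symmetric] by linarith+
  qed
  show tT2: "snd z < T2"
  proof (rule ccontr)
    assume "\<not> snd z < T2"
    then have t: "t \<ge> T2" by (simp add: t_def)
    define d where "d = T2 - T1"
    have d: "d > 0" "t - T1 \<ge> d" using assms(2) t by (auto simp: d_def)
    have "exp (- (1 / d)) \<le> exp (- 1 / (t - T1))"
      using d by (simp add: field_simps)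
    then have "(t - T1) * exp (- (1 / d)) \<le> flat_exp 1 (- 1) (t - T1)"
      using d by (simp add: flat_exp_def)
    then have "K * ((t - T1) * exp (- (1 / d))) \<le> K * flat_exp 1 (- 1) (t - T1)"
      using \<open>K \<ge> 0\<close> by (rule mult_left_mono)
    moreover have "K * ((t - T1) * exp (- (1 / d))) = (2 * ?n + 1 / (2 * d)) * (t - T1)"
      unfolding K d_def[symmetric] by (simp add: exp_minus)
    moreover have "(2 * ?n + 1 / (2 * d)) * (t - T1) = 2 * ?n * (t - T1) + (t - T1) / (2 * d)"
      by (simp add: distrib_right)
    moreover have "1 / 2 \<le> (t - T1) / (2 * d)"
      using d by (simp add: field_simps)
    moreover have "2 * ?n * T1 \<le> 2 * ?n * T2"
      using assms(2) by (intro mult_left_mono) auto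
    moreover have "2 * ?n * (t - T1) = 2 * ?n * t - 2 * ?n * T1"
      by (simp add: right_diff_distrib)
    ultimately have "barrier y0 s K T1 z \<le> 0"
      using le(2) assms(4) by linarith
    then show False using assms(6) by simp
  qed
  have nt: "2 * ?n * t \<le> 1 / 8"
  proof -
    have "2 * ?n * t \<le> 2 * ?n * T2" using tT2 by (intro mult_left_mono) (auto simp: t_def)
    then show ?thesis using assms(4) by linarith
  qed
  show "s < snd z"
  proof (rule ccontr)
    assume "\<not> s < snd z"
    then have "1 \<le> 2 - t / s" using \<open>s > 0\<close> by (simp add: t_def field_simps)
    then have "flat_exp 1 0 1 \<le> flat_exp 1 0 (2 - t / s)" by (rule flat_exp_0_mono)
    moreover have "1 / 3 \<le> flat_exp 1 0 1"
      using exp_le by (simp add: flat_exp_def exp_minus field_simps)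
    moreover have "0 \<le> (norm (x - y0))\<^sup>2" by simp
    ultimately have "barrier y0 s K T1 z \<le> 0"
      using le(1) nt by linarith
    then show False using assms(6) by simp
  qed
  have f0: "0 \<le> flat_exp 1 0 (2 - t / s)" by (rule flat_exp_nonneg)
  then have "(norm (x - y0))\<^sup>2 < 1\<^sup>2"
    using le(1) nt assms(6) by simp
  then have "norm (x - y0) < 1"
    by (rule power_less_imp_less_base) simp
  then show "fst z \<in> ball y0 1"
    by (simp add: x_def dist_norm norm_minus_commute)
  have "0 \<le> (norm (x - y0))\<^sup>2" by simp
  then show "barrier y0 s K T1 z \<le> 1 / 2"
    using le(1) nt f0 by linarith
qed

section \<open>The potential of V\<close>

lemma lebesgue_borel_version:
  fixes f :: "'b::euclidean_space \<Rightarrow> real"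
  assumes "f \<in> borel_measurable lebesgue"
  shows "\<exists>g\<in>borel_measurable borel. AE z in lebesgue. f z = g z"
proof -
  obtain g where "g \<in> borel_measurable lborel" "AE z in lborel. f z = g z"
    using completion_ex_borel_measurable_real[OF assms] by blast
  then show ?thesis by (intro bexI[of _ g] AE_completion) auto
qed

text \<open>On \<open>ball 0 R \<times> {s<..<T}\<close>, whose closure is compact and avoids \<open>t = 0\<close>, the potential agrees almost
everywhere with a bounded nonnegative Borel function.\<close>

lemma bounded_borel_potential:
  fixes V :: "'a::euclidean_space \<times> real \<Rightarrow> real"
  assumes V: "V \<in> Linf_loc (UNIV \<times> {0<..})" "AE z in lebesgue_on (UNIV \<times> {0<..}). V z \<ge> 0" and "0 < s"
  shows "\<exists>f C. f \<in> borel_measurable borel \<and> (\<forall>z. 0 \<le> f z \<and> f z \<le> C) \<and>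
    (\<forall>z. z \<notin> ball 0 R \<times> {s<..<T} \<longrightarrow> f z = 0) \<and>
    (AE z in lebesgue. z \<in> ball 0 R \<times> {s<..<T} \<longrightarrow> f z = V z)"
proof -
  define P where "P = (UNIV :: 'a set) \<times> {0::real<..}"
  define B where "B = ball (0 :: 'a) R \<times> {s<..<T}"
  define K where "K = cball (0 :: 'a) R \<times> {s..T}"
  have "open P" by (simp add: P_def open_Times)
  then have P: "P \<in> sets lebesgue" by simp
  have "open B" by (simp add: B_def open_Times)
  then have B: "B \<in> sets borel" by simp
  have "compact K" by (simp add: K_def compact_Times)
  then have K: "K \<in> sets lebesgue" by (simp add: compact_imp_closed)
  have KP: "K \<subseteq> P" using \<open>0 < s\<close> by (auto simp: K_def P_def)
  have BK: "B \<subseteq> K" by (auto simp: B_def K_def)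
  obtain C where "AE z in lebesgue_on K. \<bar>V z\<bar> \<le> C"
    using V(1) \<open>compact K\<close> KP unfolding Linf_loc_def P_def by blast
  then have C: "AE z in lebesgue. z \<in> K \<longrightarrow> \<bar>V z\<bar> \<le> C"
    using K by (simp add: AE_restrict_space_iff)
  have nn: "AE z in lebesgue. z \<in> P \<longrightarrow> V z \<ge> 0"
    using V(2) P unfolding P_def[symmetric] by (simp add: AE_restrict_space_iff)
  have "V \<in> borel_measurable (lebesgue_on P)" using V(1) by (simp add: Linf_loc_def P_def)
  then have "(\<lambda>z. indicator P z *\<^sub>R V z) \<in> borel_measurable lebesgue"
    using P by (simp add: borel_measurable_restrict_space_iff)
  from lebesgue_borel_version[OF this] obtain g where
    g[measurable]: "g \<in> borel_measurable borel" and gV: "AE z in lebesgue. indicator P z *\<^sub>R V z = g z" by blast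
  define f where "f z = (if z \<in> B then max 0 (min \<bar>C\<bar> (g z)) else 0)" for z
  have "f \<in> borel_measurable borel"
    unfolding f_def using B by measurable
  moreover have "0 \<le> f z \<and> f z \<le> \<bar>C\<bar>" for z by (simp add: f_def)
  moreover have "AE z in lebesgue. z \<in> B \<longrightarrow> f z = V z"
    using C nn gV
  proof eventually_elim
    case (elim z)
    show ?case
    proof
      assume "z \<in> B"
      then have "z \<in> P" "z \<in> K" using BK KP by auto
      with elim \<open>z \<in> B\<close> show "f z = V z" by (auto simp: f_def)
    qed
  qed
  moreover have "z \<notin> B \<longrightarrow> f z = 0" for z by (simp add: f_def)
  ultimately show ?thesis unfolding B_def by blast
qed

lemma AE_lebesgue_shift:
  fixes a :: "'b::euclidean_space"
  assumes "AE z in lebesgue. P z"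
  shows "AE z in lebesgue. P (a + z)"
proof -
  have "AE z in distr lborel borel ((+) a). P z"
    unfolding lborel_distr_plus using assms by (simp add: AE_completion_iff)
  then have "AE z in lborel. P (a + z)"
    by (rule AE_distrD[rotated]) simp
  then show ?thesis by (rule AE_completion)
qed

text \<open>Translating the time variable by \<open>snd z\<close> turns the convolution into the integral in the hypothesis
on \<open>V\<close>, because \<open>heat_smoothed h\<close> lies below the heat kernel and vanishes for negative times.\<close>

lemma smoothed_potential_bound:
  fixes f V :: "'a::euclidean_space \<times> real \<Rightarrow> real"
  assumes "h > 0" and [measurable]: "f \<in> borel_measurable borel" and f0: "\<And>z. 0 \<le> f z"
    and supp: "\<And>z. z \<notin> ball 0 R \<times> {s<..<T} \<Longrightarrow> f z = 0"
    and fV: "AE z in lebesgue. z \<in> ball 0 R \<times> {s<..<T} \<longrightarrow> f z = V z"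
    and z: "0 \<le> snd z" and "c \<ge> 0"
    and pot: "(\<integral>\<^sup>+ (x, t) \<in> ball 0 R \<times> {0<..<T}. ennreal (heat_kernel (x - fst z) t * V (x, t + snd z)) \<partial>lebesgue)
      \<le> ennreal c"
  shows "(LINT y|lborel. heat_smoothed h (y - z) * f y) \<le> c"
proof (rule integral_real_bounded[OF \<open>c \<ge> 0\<close>])
  define a where "a = (0 :: 'a, snd z)"
  have [measurable]: "heat_smoothed h \<in> borel_measurable (borel :: ('a \<times> real) measure)"
    by (rule smooth_borel[OF smooth_heat_smoothed[OF \<open>h > 0\<close>]])
  have "(\<integral>\<^sup>+y. ennreal (heat_smoothed h (y - z) * f y) \<partial>lborel)
    = (\<integral>\<^sup>+y. ennreal (heat_smoothed h (y - (- a) - z) * f (y - (- a))) \<partial>lborel)"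
    by (rule nn_integral_lborel_shift(1)[symmetric]) measurable
  also have "\<dots> = (\<integral>\<^sup>+y. ennreal (heat_smoothed h (y - (- a) - z) * f (y - (- a))) \<partial>lebesgue)"
    by (simp add: nn_integral_completion)
  also have "\<dots> \<le> (\<integral>\<^sup>+ (x, t) \<in> ball 0 R \<times> {0<..<T}. ennreal (heat_kernel (x - fst z) t * V (x, t + snd z)) \<partial>lebesgue)"
  proof (rule nn_integral_mono_AE)
    show "AE y in lebesgue. ennreal (heat_smoothed h (y - (- a) - z) * f (y - (- a)))
      \<le> (case y of (x, t) \<Rightarrow> ennreal (heat_kernel (x - fst z) t * V (x, t + snd z))) * indicator (ball 0 R \<times> {0<..<T}) y"
      using AE_lebesgue_shift[OF fV, of a]
    proof eventually_elim
      case (elim y)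
      obtain x t where y: "y = (x, t)" by (cases y)
      have ya: "a + y = (x, t + snd z)" "y - (- a) = (x, t + snd z)" "(x, t + snd z) - z = (x - fst z, t)"
        by (auto simp: y a_def prod_eq_iff)
      show ?case
      proof (cases "t > 0 \<and> a + y \<in> ball 0 R \<times> {s<..<T}")
        case True
        then have "f (x, t + snd z) = V (x, t + snd z)" using elim ya(1) by simp
        moreover have "heat_smoothed h (x - fst z, t) * f (x, t + snd z) \<le> heat_kernel (x - fst z) t * f (x, t + snd z)"
          using True \<open>h > 0\<close> f0 by (intro mult_right_mono heat_smoothed_le_heat_kernel) auto
        moreover have "y \<in> ball 0 R \<times> {0<..<T}" using True z ya(1) by (auto simp: y)
        ultimately show ?thesis unfolding ya(2,3) by (simp add: y ennreal_leI)
      next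
        case False
        then have e: "heat_smoothed h (x - fst z, t) * f (x, t + snd z) = 0"
          using supp[of "a + y"] heat_smoothed_nonpos_time[of "(x - fst z, t)" h] ya(1) by auto
        show ?thesis unfolding ya(2,3) e by simp
      qed
    qed
  qed
  also note pot
  finally show "(\<integral>\<^sup>+y. ennreal (heat_smoothed h (y - z) * f y) \<partial>lborel) \<le> ennreal c" .
qed

lemma borel_version_on_compact:
  fixes u :: "'b::euclidean_space \<Rightarrow> real"
  assumes "u \<in> Lp_loc 1 \<Omega>" "compact K" "K \<subseteq> \<Omega>" and u: "AE z in lebesgue. z \<in> \<Omega> \<longrightarrow> u z > 0"
  shows "\<exists>v. v \<in> borel_measurable borel \<and> (\<forall>z. 0 \<le> v z) \<and> (\<forall>z. z \<notin> K \<longrightarrow> v z = 0) \<and>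
    (AE z in lebesgue. z \<in> K \<longrightarrow> v z = u z) \<and> (\<integral>\<^sup>+z. ennreal (v z) \<partial>lborel) < \<infinity>"
proof -
  have int: "integrable lebesgue (\<lambda>z. indicator K z * u z)"
    by (rule Lp_loc_1_integrable_on_compact[OF assms(1-3)])
  obtain g where g[measurable]: "g \<in> borel_measurable borel" and gu: "AE z in lebesgue. indicator K z * u z = g z"
    using lebesgue_borel_version[OF borel_measurable_integrable[OF int]] by blast
  have [measurable]: "K \<in> sets borel" using assms(2) by (simp add: compact_imp_closed)
  define v where "v z = indicator K z * max 0 (g z)" for z
  have [measurable]: "v \<in> borel_measurable borel" unfolding v_def by measurable
  have vu: "AE z in lebesgue. v z = indicator K z * u z"
    using gu u by eventually_elim (use assms(3) in \<open>auto simp: v_def indicator_def split: if_splits\<close>)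
  have "(\<integral>\<^sup>+z. ennreal (v z) \<partial>lborel) = (\<integral>\<^sup>+z. ennreal (v z) \<partial>lebesgue)"
    by (simp add: nn_integral_completion)
  also have "\<dots> \<le> (\<integral>\<^sup>+z. ennreal (norm (indicator K z * u z)) \<partial>lebesgue)"
    using vu by (intro nn_integral_mono_AE) (auto elim!: eventually_mono intro!: ennreal_leI)
  also have "\<dots> < \<infinity>"
    using int by (simp add: integrable_iff_bounded)
  finally show ?thesis
    using vu by (intro exI[of _ v]) (auto simp: v_def elim!: eventually_mono)
qed

section \<open>The estimate down to the initial time\<close>

text \<open>The constant does not depend on \<open>s\<close>: the lower cut-off at time \<open>s\<close> enters only through a term of the
barrier that has the favourable sign, and through the mollification error, which is made smaller
than \<open>1 / 2\<close> by choosing \<open>h\<close> in terms of \<open>s\<close>.\<close>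

lemma interior_estimate:
  fixes V u :: "'a::euclidean_space \<times> real \<Rightarrow> real"
  assumes sol: "solution V T u"
    and V: "V \<in> Linf_loc (UNIV \<times> {0<..})" "AE z in lebesgue_on (UNIV \<times> {0<..}). V z \<ge> 0"
    and u: "AE z in lebesgue. z \<in> UNIV \<times> {0<..<T} \<longrightarrow> u z > 0"
    and T: "0 < T1" "T1 < T2" "T2 < T'" "T' \<le> T" "2 * real DIM('a) * T2 \<le> 1 / 8"
    and R: "norm y0 + 1 \<le> R"
    and pot: "\<And>x \<tau>. x \<in> cball 0 R \<Longrightarrow> \<tau> \<in> {0..T'} \<Longrightarrow>
      (\<integral>\<^sup>+ (\<xi>, t) \<in> ball 0 R \<times> {0<..<T'}. ennreal (heat_kernel (\<xi> - x) t * V (\<xi>, t + \<tau>)) \<partial>lebesgue)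
        \<le> ennreal (1 / 16)"
  shows "\<exists>C. \<forall>s>0. (\<integral>\<^sup>+ z \<in> ball y0 (1 / 4) \<times> {2 * s<..<T1}. ennreal (u z * V z) \<partial>lebesgue) \<le> ennreal C"
proof -
  define \<Omega> where "\<Omega> = (UNIV :: 'a set) \<times> {0<..<T}"
  \<comment> \<open>The constant for which the barrier is nonpositive after time \<open>T2\<close>.\<close>
  define K0 where "K0 = (2 * real DIM('a) + 1 / (2 * (T2 - T1))) * exp (1 / (T2 - T1))"
  have K0: "K0 \<ge> 0" unfolding K0_def using T by simp
  define A where "A = cball y0 1 \<times> {T1..T2}"
  have A: "compact A" "A \<subseteq> \<Omega>" using T by (auto simp: A_def \<Omega>_def intro!: compact_Times)
  have uLp: "u \<in> Lp_loc 1 \<Omega>"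
    using sol unfolding solution_def has_weak_deriv_def \<Omega>_def by blast
  have uA: "integrable lebesgue (\<lambda>z. indicator A z * u z)"
    by (rule Lp_loc_1_integrable_on_compact[OF uLp A])
  define a where "a = (LINT z|lebesgue. indicator A z * u z)"
  have ball_R: "ball y0 1 \<subseteq> ball 0 R" "ball y0 1 \<subseteq> cball 0 R"
  proof -
    have "x \<in> ball 0 R" if "x \<in> ball y0 1" for x
      using that R norm_triangle_sub[of x y0] by (auto simp: dist_norm norm_minus_commute)
    then show "ball y0 1 \<subseteq> ball 0 R" by blast
    then show "ball y0 1 \<subseteq> cball 0 R" using ball_subset_cball by blast
  qed
  have Vpos: "AE z in lebesgue. z \<in> \<Omega> \<longrightarrow> V z \<ge> 0"
  proof -
    have "open (UNIV \<times> {0<..} :: ('a \<times> real) set)" by (simp add: open_Times)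
    then have "AE z in lebesgue. z \<in> UNIV \<times> {0<..} \<longrightarrow> V z \<ge> 0"
      using V(2) by (simp add: AE_restrict_space_iff)
    then show ?thesis by eventually_elim (auto simp: \<Omega>_def)
  qed
  have uO: "AE z in lebesgue. z \<in> \<Omega> \<longrightarrow> u z > 0" using u by (simp add: \<Omega>_def)
  show ?thesis
  proof (intro exI[of _ "exp 4 * ((4 * K0 * a + 1) / 3)"] allI impI)
    fix s :: real assume "s > 0"
    obtain f C where f[measurable]: "f \<in> borel_measurable borel" and f0: "\<And>z. 0 \<le> f z" and fC: "\<And>z. f z \<le> C"
      and fsupp: "\<And>z. z \<notin> ball 0 R \<times> {s<..<T'} \<Longrightarrow> f z = 0"
      and fV: "AE z in lebesgue. z \<in> ball 0 R \<times> {s<..<T'} \<longrightarrow> f z = V z"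
      using bounded_borel_potential[OF V \<open>s > 0\<close>, of R T'] by blast
    have fR: "f y = 0" if "y \<notin> cball 0 (R + T')" for y :: "'a \<times> real"
    proof (rule fsupp, rule notI)
      assume "y \<in> ball 0 R \<times> {s<..<T'}"
      then have "norm (fst y) \<le> R" "\<bar>snd y\<bar> \<le> T'" using \<open>s > 0\<close> by (auto simp: mem_Times_iff)
      then have "norm y \<le> R + T'" using norm_Pair_le[of "fst y" "snd y"] by simp
      with that show False by simp
    qed
    have fabs: "\<bar>f z\<bar> \<le> C" for z using f0[of z] fC[of z] by simp
    have fint: "integrable lborel f"
    proof (rule Bochner_Integration.integrable_bound)
      have "emeasure lborel (cball (0 :: 'a \<times> real) (R + T')) < \<infinity>"
        by (rule emeasure_bounded_finite[OF bounded_cball])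
      then show "integrable lborel (\<lambda>z. C * indicator (cball (0 :: 'a \<times> real) (R + T')) z)"
        by simp
      show "AE z in lborel. norm (f z) \<le> norm (C * indicator (cball 0 (R + T')) z)"
      proof (intro always_eventually allI)
        fix z show "norm (f z) \<le> norm (C * indicator (cball 0 (R + T')) z)"
          using fR[of z] fabs[of z] by (cases "z \<in> cball 0 (R + T')") auto
      qed
    qed simp
    define Ks where "Ks = cball y0 1 \<times> {s..T2}"
    have Ks: "compact Ks" "Ks \<subseteq> \<Omega>"
      using T \<open>s > 0\<close> by (auto simp: Ks_def \<Omega>_def intro!: compact_Times)
    obtain v where v[measurable]: "v \<in> borel_measurable borel" and v0: "\<And>z. 0 \<le> v z"
      and vsupp: "\<And>z. z \<notin> Ks \<Longrightarrow> v z = 0" and vu: "AE z in lebesgue. z \<in> Ks \<longrightarrow> v z = u z"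
      and vfin: "(\<integral>\<^sup>+z. ennreal (v z) \<partial>lborel) < \<infinity>"
      using borel_version_on_compact[OF uLp Ks uO] by blast
    obtain S where S: "Ks \<subseteq> cball 0 S"
    proof -
      obtain S where "\<forall>z\<in>Ks. norm z \<le> S"
        using compact_imp_bounded[OF Ks(1)] unfolding bounded_iff by (rule exE)
      then have "Ks \<subseteq> cball 0 S" by (simp add: subset_iff)
      then show ?thesis by (rule that)
    qed
    have vS: "v z = 0" if "z \<notin> cball 0 S" for z
      by (rule vsupp) (use S that in blast)
    have "\<exists>h>0. (\<integral>\<^sup>+z. ennreal (v z) * (\<integral>\<^sup>+y. ennreal (heat_mollifier h (y - z) * \<bar>f y - f z\<bar>) \<partial>lborel) \<partial>lborel)
        < ennreal (1 / 2)"
      by (rule heat_mollification_weighted_error[of f C "R + T'" v S]) (use fabs fR vfin vS in auto)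
    then obtain h where h: "h > 0" and herr:
      "(\<integral>\<^sup>+z. ennreal (v z) * (\<integral>\<^sup>+y. ennreal (heat_mollifier h (y - z) * \<bar>f y - f z\<bar>) \<partial>lborel) \<partial>lborel)
        < ennreal (1 / 2)" by blast
    \<comment> \<open>The regularised potential \<open>w\<close>, and \<open>Vt\<close>, the mollification of \<open>f\<close> that replaces \<open>V\<close> in its equation.\<close>
    define w where "w = (\<lambda>z. LINT y|lborel. heat_smoothed h (y - z) * f y)"
    define Vt where "Vt = (\<lambda>z. LINT y|lborel. heat_mollifier h (y - z) * f y)"
    have sw: "smooth w" unfolding w_def
      by (rule smooth_convolution[OF smooth_heat_smoothed[OF h] fint fR])
    have sVt: "smooth Vt" unfolding Vt_def
      by (rule smooth_convolution[OF smooth_heat_mollifier[OF h] fint fR])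
    have bw: "backward_heat w z = - Vt z" for z
      unfolding w_def Vt_def by (rule backward_heat_convolution[OF h fint fR])
    have w0: "w z \<ge> 0" for z
      unfolding w_def by (intro Bochner_Integration.integral_nonneg) (simp add: heat_smoothed_nonneg f0)
    have w1: "w z \<le> 1 / 16" if "fst z \<in> cball 0 R" "snd z \<in> {0..T'}" for z
      unfolding w_def
      by (rule smoothed_potential_bound[OF h f f0 fsupp fV _ _ pot[OF that]]) (use that in auto)
    let ?b = "barrier y0 s K0 T1"
    define p where "p = (\<lambda>z. ?b z - w z)"
    have sp: "smooth p" unfolding p_def by (intro smooth_diff smooth_barrier sw)
    define \<zeta> where "\<zeta> = (\<lambda>z. flat_exp 1 0 (p z))"
    have s\<zeta>: "smooth \<zeta>" unfolding \<zeta>_def by (rule smooth_flat_exp[OF sp])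
    have psupp: "z \<in> Ks" "s < snd z" "fst z \<in> ball y0 1" "p z \<le> 1 / 2" if "p z > 0" for z
    proof -
      have "?b z > 0" using that w0[of z] by (simp add: p_def)
      note b = barrier_nonpos[OF \<open>s > 0\<close> T(2) _ T(5) K0_def this]
      show "fst z \<in> ball y0 1" "s < snd z" using b T(1) by auto
      then show "z \<in> Ks" using b T(1) by (auto simp: Ks_def mem_Times_iff)
      show "p z \<le> 1 / 2" using b(4) T(1) w0[of z] by (simp add: p_def)
    qed
    \<comment> \<open>Where \<open>p\<close> is not positive the bound is trivial; it places all values of \<open>p\<close> in the range where \<open>flat_exp 1 0\<close> is convex.\<close>
    have phalf: "p z \<le> 1 / 2" for z using psupp(4)[of z] by (cases "p z > 0") auto
    have \<zeta>0: "\<zeta> z \<ge> 0" for z by (simp add: \<zeta>_def flat_exp_nonneg)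
    have \<zeta>supp: "\<zeta> z = 0" if "z \<notin> Ks" for z
      using psupp(1)[of z] that by (auto simp: \<zeta>_def flat_exp_def)
    have bp: "backward_heat p z = backward_heat ?b z + Vt z" for z
      unfolding p_def using backward_heat_diff[OF smooth_barrier sw] bw by simp
    \<comment> \<open>The differential inequality for \<open>\<zeta>\<close>; the factor \<open>4 = 1 + 3\<close> leaves \<open>3 V \<zeta>\<close> after \<open>V \<zeta>\<close> is absorbed.\<close>
    have pt: "4 * f z * \<zeta> z \<le> backward_heat \<zeta> z + 4 * K0 * indicator A z + 2 * \<bar>Vt z - f z\<bar>"
      if "p z > 0" for z
    proof -
      define F where "F = flat_exp 1 2 (p z)"
      have F: "0 \<le> F" "F \<le> 2" by (auto simp: F_def flat_exp_nonneg flat_exp_2_bound)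
      define g where "g = flat_exp 1 0 (snd z - T1) + flat_exp 1 1 (snd z - T1)"
      have g: "0 \<le> g" "g \<le> 2"
        using flat_exp_nonneg flat_exp_0_bound[of "snd z - T1"] flat_exp_1_bound[of "snd z - T1"] by (auto simp: g_def)
      have "F * (K0 * g) \<le> 4 * K0 * indicator A z"
      proof (cases "snd z > T1")
        case True
        then have "z \<in> A" using psupp(1)[OF that] by (auto simp: A_def Ks_def)
        moreover have "F * (K0 * g) \<le> 2 * (K0 * 2)"
          using F g K0 by (intro mult_mono) auto
        ultimately show ?thesis by simp
      next
        case False
        then have "g = 0" by (simp add: g_def flat_exp_def)
        then show ?thesis using K0 by simp
      qed
      moreover have "F * (- K0 * g + Vt z) \<le> backward_heat \<zeta> z"
      proof -
        have "F * (- K0 * g + Vt z) \<le> F * backward_heat p z"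
          using F(1) \<open>s > 0\<close> flat_exp_nonneg[of 1 2 "2 - snd z / s"]
          by (intro mult_left_mono) (auto simp: bp backward_heat_barrier g_def)
        also have "\<dots> \<le> backward_heat \<zeta> z"
          unfolding F_def \<zeta>_def by (rule backward_heat_flat_exp[OF sp phalf])
        finally show ?thesis .
      qed
      moreover have "F * f z - 2 * \<bar>Vt z - f z\<bar> \<le> F * Vt z"
      proof -
        have "F * \<bar>Vt z - f z\<bar> \<le> 2 * \<bar>Vt z - f z\<bar>" using F by (intro mult_right_mono) auto
        moreover have "F * (f z - Vt z) \<le> F * \<bar>Vt z - f z\<bar>" using F by (intro mult_left_mono) auto
        ultimately show ?thesis by (simp add: right_diff_distrib)
      qed
      moreover have "4 * f z * \<zeta> z \<le> F * f z"
        using mult_right_mono[OF flat_exp_2_ge[OF phalf[of z]] f0[of z]] by (simp add: F_def \<zeta>_def ac_simps)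
      moreover have "F * (- K0 * g + Vt z) = F * Vt z - F * (K0 * g)"
        by (simp add: algebra_simps)
      ultimately show ?thesis by linarith
    qed
    have bz: "0 \<le> backward_heat \<zeta> z" if "\<not> p z > 0" for z
      using backward_heat_flat_exp[OF sp phalf, of z] that by (simp add: \<zeta>_def flat_exp_def)
    have bsupp: "backward_heat \<zeta> z = 0" if "z \<notin> Ks" for z
    proof -
      have "partials vs \<zeta> z = 0" for vs
        by (rule partials_eq_0_outside[OF compact_imp_closed[OF Ks(1)] _ that]) (rule \<zeta>supp)
      then show ?thesis by (simp add: backward_heat_def)
    qed
    have "\<zeta> z = 0" if "z \<notin> Ks" for z using \<zeta>supp that .
    note weak = solution_weak_formulation[OF sol V(1) s\<zeta> this Ks(1) Ks(2)[unfolded \<Omega>_def], folded backward_heat_def]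
    \<comment> \<open>The weighted mollification error; \<open>v\<close> represents \<open>u\<close> on the support of \<open>\<zeta>\<close>.\<close>
    define q where "q z = v z * \<bar>Vt z - f z\<bar>" for z
    have [measurable]: "Vt \<in> borel_measurable borel" by (rule smooth_borel[OF sVt])
    have [measurable]: "q \<in> borel_measurable borel" unfolding q_def by measurable
    have q0: "q z \<ge> 0" for z by (simp add: q_def v0)
    have "(\<integral>\<^sup>+z. ennreal (q z) \<partial>lborel)
      \<le> (\<integral>\<^sup>+z. ennreal (v z) * (\<integral>\<^sup>+y. ennreal (heat_mollifier h (y - z) * \<bar>f y - f z\<bar>) \<partial>lborel) \<partial>lborel)"
    proof (rule nn_integral_mono)
      fix z
      have "ennreal (q z) = ennreal (v z) * ennreal \<bar>Vt z - f z\<bar>"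
        unfolding q_def using v0 by (intro ennreal_mult) auto
      also have "\<dots> \<le> ennreal (v z) * (\<integral>\<^sup>+y. ennreal (heat_mollifier h (y - z) * \<bar>f y - f z\<bar>) \<partial>lborel)"
        unfolding Vt_def by (intro mult_left_mono heat_mollification_pointwise_error[OF h fint fR]) auto
      finally show "ennreal (q z) \<le> \<dots>" .
    qed
    also note herr
    finally have qnn: "(\<integral>\<^sup>+z. ennreal (q z) \<partial>lebesgue) < ennreal (1 / 2)"
      by (simp add: nn_integral_completion)
    have qint: "integrable lebesgue q"
      using order_less_trans[OF qnn ennreal_less_top] q0
      by (intro integrableI_nonneg) (auto simp: measurable_completion)
    have qle: "(LINT z|lebesgue. q z) \<le> 1 / 2"
      using qnn by (intro integral_real_bounded) auto
    define I where "I = (LINT z|lebesgue. V z * u z * \<zeta> z)"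
    have "(LINT z|lebesgue. 4 * (V z * u z * \<zeta> z))
      \<le> (LINT z|lebesgue. u z * backward_heat \<zeta> z + 4 * K0 * (indicator A z * u z) + 2 * q z)"
    proof (rule integral_mono_AE)
      show "integrable lebesgue (\<lambda>z. 4 * (V z * u z * \<zeta> z))" using weak(2) by simp
      show "integrable lebesgue (\<lambda>z. u z * backward_heat \<zeta> z + 4 * K0 * (indicator A z * u z) + 2 * q z)"
        using weak(1) uA qint by (intro Bochner_Integration.integrable_add integrable_mult_right)
      show "AE z in lebesgue. 4 * (V z * u z * \<zeta> z) \<le> u z * backward_heat \<zeta> z + 4 * K0 * (indicator A z * u z) + 2 * q z"
        using fV vu uO
      proof eventually_elim
        case (elim z)
        show ?case
        proof (cases "p z > 0")
          case True
          note ps = psupp[OF True]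
          have "u z > 0" using ps(1) Ks(2) elim by auto
          have "z \<in> ball 0 R \<times> {s<..<T'}"
            using ps ball_R T(3) by (auto simp: Ks_def mem_Times_iff)
          with elim have fz: "f z = V z" by simp
          have vz: "v z = u z" using elim ps(1) by simp
          have "u z * (4 * f z * \<zeta> z) \<le> u z * (backward_heat \<zeta> z + 4 * K0 * indicator A z + 2 * \<bar>Vt z - f z\<bar>)"
            using pt[OF True] \<open>u z > 0\<close> by (intro mult_left_mono) auto
          then show ?thesis unfolding q_def vz fz by (simp add: algebra_simps)
        next
          case False
          then have "\<zeta> z = 0" by (simp add: \<zeta>_def flat_exp_def)
          moreover have "0 \<le> u z * backward_heat \<zeta> z"
          proof (cases "z \<in> Ks")
            case True
            then have "u z > 0" using Ks(2) elim by auto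
            then show ?thesis using bz[OF False] by simp
          qed (simp add: bsupp)
          moreover have "0 \<le> indicator A z * u z"
            using A(2) elim by (auto simp: indicator_def intro!: less_imp_le)
          ultimately show ?thesis using q0[of z] K0 by simp
        qed
      qed
    qed
    also have "\<dots> = I + 4 * K0 * a + 2 * (LINT z|lebesgue. q z)"
      using weak uA qint by (simp add: I_def a_def)
    finally have "3 * I \<le> 4 * K0 * a + 1"
      using qle by (simp add: I_def)
    then have I: "I \<le> (4 * K0 * a + 1) / 3" by simp
    have nonneg: "AE z in lebesgue. 0 \<le> V z * u z * \<zeta> z"
      using Vpos uO
    proof eventually_elim
      case (elim z)
      show ?case
      proof (cases "z \<in> Ks")
        case True
        then have "z \<in> \<Omega>" using Ks(2) by blast
        then show ?thesis using elim \<zeta>0[of z] by simp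
      qed (simp add: \<zeta>supp)
    qed
    have low: "exp (- 4) \<le> \<zeta> z" if "z \<in> ball y0 (1 / 4) \<times> {2 * s<..<T1}" for z
    proof -
      have z: "dist y0 (fst z) < 1 / 4" "2 * s < snd z" "snd z < T1" using that by (auto simp: mem_Times_iff)
      have "5 / 16 \<le> ?b z"
      proof -
        have "(norm (fst z - y0))\<^sup>2 \<le> (1 / 4)\<^sup>2"
          using z(1) by (intro power_mono) (auto simp: dist_norm norm_minus_commute)
        moreover have "flat_exp 1 0 (2 - snd z / s) = 0" "K0 * flat_exp 1 (- 1) (snd z - T1) = 0"
          using z(2,3) \<open>s > 0\<close> by (auto simp: flat_exp_def field_simps)
        moreover have "0 \<le> 2 * real DIM('a) * snd z" using z(2) \<open>s > 0\<close> by simp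
        moreover have "(1 / 4)\<^sup>2 = (1 / 16 :: real)" by (simp add: power2_eq_square)
        ultimately show "5 / 16 \<le> ?b z"
          unfolding barrier_def power2_norm_eq_inner by linarith
      qed
      moreover have "w z \<le> 1 / 16"
      proof (rule w1)
        have "fst z \<in> ball y0 1" using z(1) by simp
        then show "fst z \<in> cball 0 R" using ball_R(2) by blast
        show "snd z \<in> {0..T'}" using z(2,3) \<open>s > 0\<close> T by simp
      qed
      ultimately have "1 / 4 \<le> p z" by (simp add: p_def)
      then have "flat_exp 1 0 (1 / 4) \<le> \<zeta> z" unfolding \<zeta>_def by (rule flat_exp_0_mono)
      then show ?thesis by (simp add: flat_exp_def)
    qed
    have "(\<integral>\<^sup>+ z \<in> ball y0 (1 / 4) \<times> {2 * s<..<T1}. ennreal (u z * V z) \<partial>lebesgue)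
      \<le> (\<integral>\<^sup>+z. ennreal (exp 4 * (V z * u z * \<zeta> z)) \<partial>lebesgue)"
    proof (rule nn_integral_mono_AE)
      show "AE z in lebesgue. ennreal (u z * V z) * indicator (ball y0 (1 / 4) \<times> {2 * s<..<T1}) z
        \<le> ennreal (exp 4 * (V z * u z * \<zeta> z))"
        using Vpos uO
      proof eventually_elim
        case (elim z)
        show ?case
        proof (cases "z \<in> ball y0 (1 / 4) \<times> {2 * s<..<T1}")
          case True
          then have "z \<in> \<Omega>" using T \<open>s > 0\<close> by (auto simp: \<Omega>_def)
          with elim have uV: "0 \<le> u z * V z" by simp
          have "1 \<le> exp 4 * \<zeta> z"
            using low[OF True] by (simp add: exp_minus field_simps)
          then have "u z * V z * 1 \<le> u z * V z * (exp 4 * \<zeta> z)"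
            using uV by (rule mult_left_mono)
          then show ?thesis using True by (simp add: ac_simps ennreal_leI)
        qed simp
      qed
    qed
    also have "\<dots> = ennreal (LINT z|lebesgue. exp 4 * (V z * u z * \<zeta> z))"
      using weak(2) nonneg by (intro nn_integral_eq_integral) auto
    also have "\<dots> = ennreal (exp 4 * I)" by (simp add: I_def)
    also have "\<dots> \<le> ennreal (exp 4 * ((4 * K0 * a + 1) / 3))"
      using I by (intro ennreal_leI mult_left_mono) auto
    finally show "(\<integral>\<^sup>+ z \<in> ball y0 (1 / 4) \<times> {2 * s<..<T1}. ennreal (u z * V z) \<partial>lebesgue)
      \<le> ennreal (exp 4 * ((4 * K0 * a + 1) / 3))" .
  qed
qed

section \<open>The estimate up to the final time\<close>

lemma nn_integral_incseq_le:
  assumes [measurable]: "f \<in> borel_measurable M" and E: "incseq E" "\<And>j. E j \<in> sets M"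
    and le: "\<And>j. (\<integral>\<^sup>+ z \<in> E j. f z \<partial>M) \<le> c"
  shows "(\<integral>\<^sup>+ z \<in> (\<Union>j. E j). f z \<partial>M) \<le> c"
proof -
  have "(\<integral>\<^sup>+ z \<in> (\<Union>j. E j). f z \<partial>M) = emeasure (density M f) (\<Union>j. E j)"
    using E(2) by (subst emeasure_density) auto
  also have "\<dots> = (SUP j. emeasure (density M f) (E j))"
    using E by (intro SUP_emeasure_incseq[symmetric]) auto
  also have "\<dots> \<le> c"
    using E(2) le by (intro SUP_least) (simp add: emeasure_density)
  finally show ?thesis .
qed

lemma cutoff_product_measurable:
  fixes V u :: "'a::euclidean_space \<times> real \<Rightarrow> real"
  assumes "u \<in> Lp_loc 1 (UNIV \<times> {0<..<T})" "V \<in> Linf_loc (UNIV \<times> {0<..})"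
  shows "(\<lambda>z. ennreal (u z * V z) * indicator (UNIV \<times> {0<..<T}) z) \<in> borel_measurable lebesgue"
proof -
  define \<Omega> where "\<Omega> = (UNIV :: 'a set) \<times> {0<..<T}"
  define P where "P = (UNIV :: 'a set) \<times> {0::real<..}"
  have "open P" "open \<Omega>" by (simp_all add: P_def \<Omega>_def open_Times)
  then have sets: "P \<in> sets lebesgue" "\<Omega> \<in> sets lebesgue" by simp_all
  have "u \<in> borel_measurable (lebesgue_on \<Omega>)" "V \<in> borel_measurable (lebesgue_on P)"
    using assms by (simp_all add: Lp_loc_def Linf_loc_def \<Omega>_def P_def)
  then have [measurable]: "(\<lambda>z. indicator \<Omega> z *\<^sub>R u z) \<in> borel_measurable lebesgue"
    "(\<lambda>z. indicator P z *\<^sub>R V z) \<in> borel_measurable lebesgue"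
    using sets by (simp_all add: borel_measurable_restrict_space_iff)
  have "(\<lambda>z. ennreal ((indicator \<Omega> z *\<^sub>R u z) * (indicator P z *\<^sub>R V z))) \<in> borel_measurable lebesgue"
    by measurable
  also have "(\<lambda>z. ennreal ((indicator \<Omega> z *\<^sub>R u z) * (indicator P z *\<^sub>R V z)))
    = (\<lambda>z. ennreal (u z * V z) * indicator \<Omega> z)"
    by (auto simp: fun_eq_iff indicator_def P_def \<Omega>_def)
  finally show ?thesis by (simp add: \<Omega>_def)
qed

text \<open>The solution itself is only known to be integrable on compact subsets of the open cylinder, whereas
its zeroth weak derivative \<open>g\<close> is integrable up to \<open>t = T\<close>. Testing with smooth cut-offs \<open>\<phi>\<close>
supported in \<open>t < T\<close> transfers the bound: \<open>\<integral> u \<phi> = \<integral> g \<phi> \<le> \<integral> \<bar>g\<bar>\<close>.\<close>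

lemma estimate_near_final_time:
  fixes V u :: "'a::euclidean_space \<times> real \<Rightarrow> real"
  assumes sol: "solution V T u"
    and V: "V \<in> Linf_loc (UNIV \<times> {0<..})"
    and u: "AE z in lebesgue. z \<in> UNIV \<times> {0<..<T} \<longrightarrow> u z > 0"
    and T: "0 < T1" "T1 < T"
  shows "(\<integral>\<^sup>+ z \<in> ball y0 (1 / 4) \<times> {T1..<T}. ennreal (u z * V z) \<partial>lebesgue) < \<infinity>"
proof -
  define \<Omega> where "\<Omega> = (UNIV :: 'a set) \<times> {0<..<T}"
  have "open \<Omega>" by (simp add: \<Omega>_def open_Times)
  then have \<Omega>: "\<Omega> \<in> sets lebesgue" by simp
  define K where "K = cball y0 2 \<times> {T1 / 2..T}"
  have K: "compact K" "K \<subseteq> Q T" "K \<subseteq> UNIV \<times> {0<..}"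
    using T by (auto simp: K_def Q_def intro!: compact_Times)
  obtain C0 where "AE z in lebesgue_on K. \<bar>V z\<bar> \<le> C0"
    using V K unfolding Linf_loc_def by blast
  then have C0: "AE z in lebesgue. z \<in> K \<longrightarrow> \<bar>V z\<bar> \<le> C0"
    using K(1) by (simp add: AE_restrict_space_iff compact_imp_closed)
  define C where "C = \<bar>C0\<bar>"
  have C: "C \<ge> 0" "AE z in lebesgue. z \<in> K \<longrightarrow> V z \<le> C"
    using C0 by (auto simp: C_def elim!: eventually_mono)
  have "u \<in> W21p_loc 1 T" using sol by (simp add: solution_def)
  moreover have "[] \<in> parabolic_dirs" by (simp add: parabolic_dirs_def)
  ultimately obtain g where g: "g \<in> Lp_loc 1 (Q T)" and ug: "has_weak_deriv \<Omega> [] u g"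
    unfolding W21p_loc_def \<Omega>_def by blast
  have uLp: "u \<in> Lp_loc 1 \<Omega>" and gLp: "g \<in> Lp_loc 1 \<Omega>" using ug by (auto simp: has_weak_deriv_def)
  have gK: "integrable lebesgue (\<lambda>z. indicator K z * g z)"
    by (rule Lp_loc_1_integrable_on_compact[OF g K(1,2)])
  define M where "M = (LINT z|lebesgue. \<bar>indicator K z * g z\<bar>)"
  \<comment> \<open>A lower bound for the cut-offs \<open>\<phi>\<close> below on the set that they are to exhaust.\<close>
  define c0 where "c0 = flat_exp 1 0 1 * flat_exp 1 0 (T1 / 2) * flat_exp 1 0 1"
  have c0: "c0 > 0" using T by (simp add: c0_def flat_exp_def)
  let ?m = "\<lambda>z. ennreal (u z * V z) * indicator \<Omega> z"
  let ?E = "\<lambda>j. ball y0 (1 / 4) \<times> {T1..T - 2 / real (Suc j)}"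
  have step: "(\<integral>\<^sup>+ z \<in> ?E j. ?m z \<partial>lebesgue) \<le> ennreal (C / c0 * M)" for j
  proof -
    define r where "r = real (Suc j)"
    have r: "r > 0" by (simp add: r_def)
    define \<phi> where "\<phi> = (\<lambda>z. flat_exp 1 0 (2 - (fst z - y0) \<bullet> (fst z - y0)) * flat_exp 1 0 (snd z - T1 / 2)
       * flat_exp 1 0 (r * (T - snd z) - 1))"
    have "smooth (\<lambda>z. flat_exp 1 0 (2 - (fst z \<bullet> fst z + ((-2) * (fst z \<bullet> y0) + y0 \<bullet> y0))) * flat_exp 1 0 (snd z - T1 / 2)
       * flat_exp 1 0 (r * (T - snd z) - 1))"
      by (intro smooth_mult smooth_flat_exp smooth_diff smooth_add smooth_const smooth_norm_fst smooth_inner_fst smooth_snd)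
    moreover have "(\<lambda>z. flat_exp 1 0 (2 - (fst z \<bullet> fst z + ((-2) * (fst z \<bullet> y0) + y0 \<bullet> y0))) * flat_exp 1 0 (snd z - T1 / 2)
       * flat_exp 1 0 (r * (T - snd z) - 1)) = \<phi>"
      by (simp add: fun_eq_iff \<phi>_def inner_diff_left inner_diff_right inner_commute algebra_simps)
    ultimately have s\<phi>: "smooth \<phi>" by simp
    define Tr where "Tr = T - 1 / r"
    have Tr: "Tr < T" using r by (simp add: Tr_def)
    define Kj where "Kj = cball y0 2 \<times> {T1 / 2..Tr}"
    have Kj: "compact Kj" "Kj \<subseteq> \<Omega>" "Kj \<subseteq> K"
      using T Tr by (auto simp: Kj_def \<Omega>_def K_def intro!: compact_Times)
    have \<phi>supp: "\<phi> z = 0" if "z \<notin> Kj" for z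
    proof (rule ccontr)
      assume "\<phi> z \<noteq> 0"
      then have 1: "(fst z - y0) \<bullet> (fst z - y0) < 2" "snd z > T1 / 2" "1 < r * (T - snd z)"
        by (auto simp: \<phi>_def flat_exp_def split: if_splits)
      have "(norm (fst z - y0))\<^sup>2 \<le> 2\<^sup>2" using 1(1) by (simp add: power2_norm_eq_inner)
      then have "norm (fst z - y0) \<le> 2" by (rule power2_le_imp_le) simp
      moreover have "snd z \<le> Tr" using 1(3) r by (simp add: Tr_def field_simps)
      ultimately have "z \<in> Kj"
        using 1(2) by (auto simp: Kj_def mem_Times_iff dist_norm norm_minus_commute)
      with that show False by simp
    qed
    have \<phi>01: "0 \<le> \<phi> z" "\<phi> z \<le> 1" for z
      unfolding \<phi>_def by (auto intro!: mult_le_one mult_nonneg_nonneg simp: flat_exp_nonneg flat_exp_0_bound)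
    have \<phi>c0: "c0 \<le> \<phi> z" if "z \<in> ?E j" for z
    proof -
      have z: "dist y0 (fst z) < 1 / 4" "T1 \<le> snd z" "snd z \<le> T - 2 / r"
        using that by (auto simp: mem_Times_iff r_def)
      have "(norm (fst z - y0))\<^sup>2 \<le> (1 / 4)\<^sup>2"
        using z(1) by (intro power_mono) (auto simp: dist_norm norm_minus_commute)
      then have "1 \<le> 2 - (fst z - y0) \<bullet> (fst z - y0)"
        by (simp add: power2_norm_eq_inner[symmetric] power2_eq_square)
      moreover have "T1 / 2 \<le> snd z - T1 / 2" using z(2) by simp
      moreover have "1 \<le> r * (T - snd z) - 1" using z(3) r by (simp add: field_simps)
      ultimately show ?thesis
        unfolding c0_def \<phi>_def by (intro mult_mono flat_exp_0_mono mult_nonneg_nonneg flat_exp_nonneg)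
    qed
    have c\<phi>: "continuous_on UNIV \<phi>" by (rule smooth_imp_continuous[OF s\<phi>])
    have int: "integrable lebesgue (\<lambda>z. f z * \<phi> z)" if "f \<in> Lp_loc 1 \<Omega>" for f
      by (rule integrable_Lp_loc_1_mult[OF that Kj(1,2) c\<phi> \<phi>supp])
    have "\<phi> \<in> test_functions \<Omega>"
      by (rule test_functionsI[OF s\<phi> Kj(1,2) \<phi>supp])
    then have "(LINT z|lebesgue_on \<Omega>. u z * \<phi> z) = (LINT z|lebesgue_on \<Omega>. g z * \<phi> z)"
      using ug unfolding has_weak_deriv_def by fastforce
    moreover have "(LINT z|lebesgue_on \<Omega>. f z * \<phi> z) = (LINT z|lebesgue. f z * \<phi> z)" for f
      by (rule lebesgue_on_integral_drop[OF \<Omega>]) (use \<phi>supp Kj(2) in auto)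
    ultimately have "(LINT z|lebesgue. u z * \<phi> z) = (LINT z|lebesgue. g z * \<phi> z)" by simp
    also have "\<dots> \<le> M"
      unfolding M_def
    proof (rule integral_mono[OF int[OF gLp] integrable_abs[OF gK]])
      fix z
      have "g z * \<phi> z \<le> \<bar>g z\<bar> * \<phi> z" using \<phi>01 by (intro mult_right_mono) auto
      also have "\<dots> \<le> \<bar>indicator K z * g z\<bar>"
      proof (cases "z \<in> Kj")
        case True
        then have "z \<in> K" using Kj(3) by blast
        then show ?thesis using mult_left_mono[OF \<phi>01(2)[of z], of "\<bar>g z\<bar>"] by simp
      qed (simp add: \<phi>supp)
      finally show "g z * \<phi> z \<le> \<bar>indicator K z * g z\<bar>" .
    qed
    finally have uM: "(LINT z|lebesgue. u z * \<phi> z) \<le> M" .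
    have nonneg: "AE z in lebesgue. 0 \<le> u z * \<phi> z"
      using u
    proof eventually_elim
      case (elim z)
      show ?case
      proof (cases "z \<in> Kj")
        case True
        then have "z \<in> \<Omega>" using Kj(2) by blast
        then show ?thesis using elim \<phi>01(1)[of z] by (simp add: \<Omega>_def)
      qed (simp add: \<phi>supp)
    qed
    have "(\<integral>\<^sup>+ z \<in> ?E j. ?m z \<partial>lebesgue) \<le> (\<integral>\<^sup>+z. ennreal (C / c0 * (u z * \<phi> z)) \<partial>lebesgue)"
    proof (rule nn_integral_mono_AE)
      show "AE z in lebesgue. ?m z * indicator (?E j) z \<le> ennreal (C / c0 * (u z * \<phi> z))"
        using u C(2)
      proof eventually_elim
        case (elim z)
        show ?case
        proof (cases "z \<in> \<Omega> \<and> z \<in> ?E j")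
          case True
          then have "snd z \<le> T" "T1 \<le> snd z" "dist y0 (fst z) < 1 / 4"
            by (auto simp: \<Omega>_def mem_Times_iff)
          then have "z \<in> K" using T by (auto simp: K_def mem_Times_iff)
          then have "V z \<le> C" "u z > 0" using elim True by (auto simp: \<Omega>_def)
          then have "u z * V z \<le> u z * C" by (intro mult_left_mono) auto
          also have "\<dots> = u z * C * 1" by simp
          also have "\<dots> \<le> u z * C * (\<phi> z / c0)"
            using \<phi>c0[of z] True c0 C(1) \<open>u z > 0\<close> by (intro mult_left_mono) auto
          finally show ?thesis using True by (simp add: ac_simps ennreal_leI)
        qed (auto simp: indicator_def)
      qed
    qed
    also have "\<dots> = ennreal (LINT z|lebesgue. C / c0 * (u z * \<phi> z))"
      using int[OF uLp] nonneg C(1) c0 by (intro nn_integral_eq_integral) (auto elim!: eventually_mono)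
    also have "\<dots> \<le> ennreal (C / c0 * M)"
    proof (rule ennreal_leI)
      have "(LINT z|lebesgue. C / c0 * (u z * \<phi> z)) = C / c0 * (LINT z|lebesgue. u z * \<phi> z)" by simp
      also have "\<dots> \<le> C / c0 * M" using uM C(1) c0 by (intro mult_left_mono) auto
      finally show "(LINT z|lebesgue. C / c0 * (u z * \<phi> z)) \<le> C / c0 * M" .
    qed
    finally show ?thesis .
  qed
  have "(\<integral>\<^sup>+ z \<in> (\<Union>j. ?E j). ?m z \<partial>lebesgue) \<le> ennreal (C / c0 * M)"
  proof (rule nn_integral_incseq_le[OF _ _ _ step])
    show "?m \<in> borel_measurable lebesgue"
      using cutoff_product_measurable[OF uLp[unfolded \<Omega>_def] V] by (simp add: \<Omega>_def)
    show "incseq ?E"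
    proof (intro monoI Sigma_mono order_refl)
      fix i j :: nat assume "i \<le> j"
      then have "2 / real (Suc j) \<le> 2 / real (Suc i)" by (intro divide_left_mono) auto
      then show "{T1..T - 2 / real (Suc i)} \<subseteq> {T1..T - 2 / real (Suc j)}" by auto
    qed
    show "?E j \<in> sets lebesgue" for j
      by (intro sets_completionI_sets) (simp add: borel_Times)
  qed
  also have "(\<Union>j. ?E j) = ball y0 (1 / 4) \<times> {T1..<T}"
  proof -
    have "\<exists>j. t \<le> T - 2 / real (Suc j)" if "t < T" for t
    proof -
      obtain j where "2 / (T - t) < real (Suc j)"
        using reals_Archimedean2 by (metis less_trans lessI of_nat_less_iff)
      then have "2 / real (Suc j) < T - t" using that by (simp add: field_simps)
      then show ?thesis by (intro exI[of _ j]) linarith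
    qed
    moreover have "t < T" if "t \<le> T - 2 / real (Suc j)" for t j
    proof -
      have "2 / real (Suc j) > 0" by simp
      with that show ?thesis by linarith
    qed
    ultimately show ?thesis by (auto simp del: of_nat_Suc)
  qed
  also have "(\<integral>\<^sup>+ z \<in> ball y0 (1 / 4) \<times> {T1..<T}. ?m z \<partial>lebesgue)
     = (\<integral>\<^sup>+ z \<in> ball y0 (1 / 4) \<times> {T1..<T}. ennreal (u z * V z) \<partial>lebesgue)"
    using T by (intro nn_integral_cong) (auto simp: indicator_def \<Omega>_def)
  finally show ?thesis by (rule le_less_trans) simp
qed

section \<open>Regularity of every point\<close>

theorem theorem4p5:
  fixes V u :: "'a::euclidean_space \<times> real \<Rightarrow> real" and T \<tau>\<^sub>0 :: real
  assumes "T > 0"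
    and "V \<in> Linf_loc (UNIV \<times> {0<..})"
    and "AE z in lebesgue_on (UNIV \<times> {0<..}). V z \<ge> 0"
    and "\<tau>\<^sub>0 > 0"
    and "\<forall>R>0. \<forall>K. compact K \<longrightarrow> (\<forall>\<epsilon>>0. \<exists>\<delta>>0. \<forall>E\<in>sets borel.
           E \<subseteq> ball 0 R \<times> {0<..<T} \<and> emeasure lebesgue E < ennreal \<delta> \<longrightarrow>
           (\<forall>y\<in>K. \<forall>\<tau>\<in>{0..\<tau>\<^sub>0}.
              (\<integral>\<^sup>+ (x, t) \<in> E. ennreal (heat_kernel (x - y) t * V (x, t + \<tau>)) \<partial>lebesgue)
                < ennreal \<epsilon>))"
    and "solution V T u"
    and "AE z in lebesgue_on (Q T). u z > 0"
  shows "regular_set V T u = UNIV"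
proof (intro set_eqI iffI UNIV_I)
  fix y :: 'a
  define \<Omega> where "\<Omega> = (UNIV :: 'a set) \<times> {0<..<T}"
  have "Q T \<in> sets (lebesgue :: ('a \<times> real) measure)"
    unfolding Q_def by (intro sets_completionI_sets) (simp add: borel_Times)
  then have "AE z in lebesgue. z \<in> Q T \<longrightarrow> u z > 0"
    using assms(7) by (simp add: AE_restrict_space_iff)
  then have u: "AE z in lebesgue. z \<in> UNIV \<times> {0<..<T} \<longrightarrow> u z > 0"
    by eventually_elim (auto simp: Q_def)
  define R where "R = norm y + 1"
  have "R > 0" by (simp add: R_def add_nonneg_pos)
  then obtain \<delta> where "\<delta> > 0" and \<delta>: "\<And>E x \<tau>. E \<in> sets borel \<Longrightarrow> E \<subseteq> ball 0 R \<times> {0<..<T} \<Longrightarrow>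
      emeasure lebesgue E < ennreal \<delta> \<Longrightarrow> x \<in> cball 0 R \<Longrightarrow> \<tau> \<in> {0..\<tau>\<^sub>0} \<Longrightarrow>
      (\<integral>\<^sup>+ (\<xi>, t) \<in> E. ennreal (heat_kernel (\<xi> - x) t * V (\<xi>, t + \<tau>)) \<partial>lebesgue) < ennreal (1 / 16)"
    using assms(5)[rule_format, of R "cball 0 R" "1 / 16"] by (auto simp del: mem_cball)
  define m where "m = measure lborel (ball (0 :: 'a) R)"
  have m: "emeasure lborel (ball (0 :: 'a) R) = ennreal m" "m \<ge> 0"
    using emeasure_bounded_finite[OF bounded_ball, of "0 :: 'a" R]
    by (auto simp: m_def emeasure_eq_ennreal_measure)
  \<comment> \<open>Short enough for the potential to be small on \<open>E\<close>, for the time shifts to stay below \<open>\<tau>\<^sub>0\<close>, and for \<open>2 n t \<le> 1 / 8\<close> in the barrier.\<close>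
  define T' where "T' = min (min T \<tau>\<^sub>0) (min (1 / (16 * real DIM('a))) (\<delta> / (2 * (m + 1))))"
  have T': "0 < T'" "T' \<le> T" "T' \<le> \<tau>\<^sub>0" "T' \<le> 1 / (16 * real DIM('a))" "T' \<le> \<delta> / (2 * (m + 1))"
    using assms(1,4) \<open>\<delta> > 0\<close> m(2) by (auto simp: T'_def)
  define E where "E = ball (0 :: 'a) R \<times> {0<..<T'}"
  have E: "E \<in> sets borel" "E \<subseteq> ball 0 R \<times> {0<..<T}"
    using T' by (auto simp: E_def borel_Times)
  have "emeasure lebesgue E = emeasure (lborel \<Otimes>\<^sub>M lborel) E"
    using E(1) by (simp add: lborel_prod)
  also have "\<dots> = ennreal (m * T')"
    unfolding E_def using m T'(1) by (subst lborel.emeasure_pair_measure_Times) (auto simp: ennreal_mult)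
  also have "\<dots> < ennreal \<delta>"
  proof (rule ennreal_lessI[OF \<open>\<delta> > 0\<close>])
    have "m * T' \<le> m * (\<delta> / (2 * (m + 1)))" using T'(5) m(2) by (rule mult_left_mono)
    also have "\<dots> < \<delta>" using m(2) \<open>\<delta> > 0\<close> by (simp add: field_simps add_strict_increasing)
    finally show "m * T' < \<delta>" .
  qed
  finally have Es: "emeasure lebesgue E < ennreal \<delta>" .
  have small: "2 * real DIM('a) * (3 * T' / 4) \<le> 1 / 8"
  proof -
    have "2 * real DIM('a) * (3 * T' / 4) \<le> 2 * real DIM('a) * T'"
      using T'(1) by (intro mult_left_mono) auto
    also have "\<dots> \<le> 2 * real DIM('a) * (1 / (16 * real DIM('a)))"
      using T'(4) by (intro mult_left_mono) auto
    also have "\<dots> = 1 / 8" by simp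
    finally show ?thesis .
  qed
  have "\<exists>C. \<forall>s>0. (\<integral>\<^sup>+ z \<in> ball y (1 / 4) \<times> {2 * s<..<T' / 2}. ennreal (u z * V z) \<partial>lebesgue) \<le> ennreal C"
  proof (rule interior_estimate[OF assms(6,2,3) u _ _ _ T'(2) small])
    show "(\<integral>\<^sup>+ (\<xi>, t) \<in> ball 0 R \<times> {0<..<T'}. ennreal (heat_kernel (\<xi> - x) t * V (\<xi>, t + \<tau>)) \<partial>lebesgue)
        \<le> ennreal (1 / 16)" if "x \<in> cball 0 R" "\<tau> \<in> {0..T'}" for x \<tau>
      using \<delta>[OF E Es that(1), of \<tau>] that(2) T'(3) unfolding E_def by (auto intro: less_imp_le)
  qed (use T'(1) in \<open>auto simp: R_def\<close>)
  then obtain C where C: "\<And>s. s > 0 \<Longrightarrow>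
      (\<integral>\<^sup>+ z \<in> ball y (1 / 4) \<times> {2 * s<..<T' / 2}. ennreal (u z * V z) \<partial>lebesgue) \<le> ennreal C" by blast
  let ?m = "\<lambda>z. ennreal (u z * V z) * indicator \<Omega> z"
  let ?U = "ball y (1 / 4)"
  have uLp: "u \<in> Lp_loc 1 (UNIV \<times> {0<..<T})"
    using assms(6) unfolding solution_def has_weak_deriv_def by blast
  have [measurable]: "?m \<in> borel_measurable lebesgue"
    unfolding \<Omega>_def by (rule cutoff_product_measurable[OF uLp assms(2)])
  have low: "(\<integral>\<^sup>+ z \<in> ?U \<times> {0<..<T' / 2}. ?m z \<partial>lebesgue) \<le> ennreal C"
  proof -
    let ?E = "\<lambda>j. ?U \<times> {2 * (1 / real (Suc j))<..<T' / 2}"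
    have "(\<integral>\<^sup>+ z \<in> (\<Union>j. ?E j). ?m z \<partial>lebesgue) \<le> ennreal C"
    proof (rule nn_integral_incseq_le)
      show "incseq ?E"
      proof (intro monoI Sigma_mono order_refl)
        fix i j :: nat assume "i \<le> j"
        then have "1 / real (Suc j) \<le> 1 / real (Suc i)" by (intro divide_left_mono) auto
        then show "{2 * (1 / real (Suc i))<..<T' / 2} \<subseteq> {2 * (1 / real (Suc j))<..<T' / 2}" by auto
      qed
      show "?E j \<in> sets lebesgue" for j
        by (intro sets_completionI_sets) (simp add: borel_Times)
      show "(\<integral>\<^sup>+ z \<in> ?E j. ?m z \<partial>lebesgue) \<le> ennreal C" for j
      proof -
        have "(\<integral>\<^sup>+ z \<in> ?E j. ?m z \<partial>lebesgue) \<le> (\<integral>\<^sup>+ z \<in> ?E j. ennreal (u z * V z) \<partial>lebesgue)"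
          by (intro nn_integral_mono) (auto simp: indicator_def)
        also have "\<dots> \<le> ennreal C" by (rule C) simp
        finally show ?thesis .
      qed
    qed measurable
    also have "(\<Union>j. ?E j) = ?U \<times> {0<..<T' / 2}"
    proof -
      have "\<exists>j. 2 * (1 / real (Suc j)) < t" if "t > 0" for t
      proof -
        obtain j where "2 / t < real (Suc j)"
          using reals_Archimedean2 by (metis less_trans lessI of_nat_less_iff)
        then show ?thesis using that by (intro exI[of _ j]) (simp add: field_simps)
      qed
      moreover have "0 < t" if "2 * (1 / real (Suc j)) < t" for t j
      proof -
        have "0 < 2 * (1 / real (Suc j))" by simp
        with that show ?thesis by linarith
      qed
      ultimately show ?thesis by (auto simp del: of_nat_Suc)
    qed
    finally show ?thesis .
  qed
  have high: "(\<integral>\<^sup>+ z \<in> ?U \<times> {T' / 2..<T}. ?m z \<partial>lebesgue) < \<infinity>"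
  proof -
    have "(\<integral>\<^sup>+ z \<in> ?U \<times> {T' / 2..<T}. ?m z \<partial>lebesgue) \<le> (\<integral>\<^sup>+ z \<in> ?U \<times> {T' / 2..<T}. ennreal (u z * V z) \<partial>lebesgue)"
      by (intro nn_integral_mono) (auto simp: indicator_def)
    also have "\<dots> < \<infinity>"
      by (rule estimate_near_final_time[OF assms(6,2) u]) (use T' in auto)
    finally show ?thesis .
  qed
  have sets: "?U \<times> {0<..<T' / 2} \<in> sets lebesgue" "?U \<times> {T' / 2..<T} \<in> sets lebesgue"
    by (intro sets_completionI_sets; simp add: borel_Times)+
  have "(\<integral>\<^sup>+ z \<in> ?U \<times> {0<..<T}. ennreal (u z * V z) \<partial>lebesgue)
    \<le> (\<integral>\<^sup>+ z. ?m z * indicator (?U \<times> {0<..<T' / 2}) z + ?m z * indicator (?U \<times> {T' / 2..<T}) z \<partial>lebesgue)"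
    by (intro nn_integral_mono) (auto simp: indicator_def \<Omega>_def)
  also have "\<dots> = (\<integral>\<^sup>+ z \<in> ?U \<times> {0<..<T' / 2}. ?m z \<partial>lebesgue) + (\<integral>\<^sup>+ z \<in> ?U \<times> {T' / 2..<T}. ?m z \<partial>lebesgue)"
    using sets by (intro nn_integral_add) auto
  also have "\<dots> < \<infinity>"
    using low high by (simp add: le_less_trans)
  finally have "(\<integral>\<^sup>+ z \<in> ?U \<times> {0<..<T}. ennreal (u z * V z) \<partial>lebesgue) < \<infinity>" .
  then show "y \<in> regular_set V T u"
    unfolding regular_set_def by (auto intro!: exI[of _ ?U])
qed

end
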